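(* Let $A\in\mathbf{R}^{n\times n}$ and $B\in\mathbf{R}^{n\times m}$ be such that $(A,B)$ is controllable and all eigenvalues of $A$ lie in the closed left-half plane. For $\gamma>0$ consider the two nested matrix equations $$A^{\mathrm T}X+XA+XBB^{\mathrm T}X=\gamma X,\qquad (\mathrm{E}_X)$$ $$(A+BB^{\mathrm T}X)^{\mathrm T}Y+Y(A+BB^{\mathrm T}X)-YBB^{\mathrm T}Y=-\gamma Y,\qquad (\mathrm{E}_Y)$$ where the solution $X$ of $(\mathrm{E}_X)$ is used as a known quantity in $(\mathrm{E}_Y)$, and define $P=P(\gamma)=Y-X$. Then the following hold. 1. For every $\gamma>0$, $(\mathrm{E}_X)$ has a unique positive definite solution $X=X(\gamma)$ and $(\mathrm{E}_Y)$ has a unique positive definite solution $Y=Y(\gamma)$; moreover $P$ is a rational matrix function of $\gamma$ and $$\lambda_i(A-BB^{\mathrm T}P)=\lambda_i(A)-2\gamma,\quad i=1,2,\ldots,n.$$ 2. $P(\gamma)$ is positive definite for every $\gamma>0$. 3. $\mathrm{tr}(B^{\mathrm T}PB)=2n\gamma$. 4. There exists a constant $k>0$ such that, for every $\gamma>0$, $$-k(\gamma-\phi(A))P\le A^{\mathrm T}P+PA-PBB^{\mathrm T}P\le-\gamma P.$$ 5. There exist positive constants $c_1$ and $c_2$ such that $$\lim_{\gamma\to\infty}\frac{\lambda_{\max}(P)}{\gamma^{2\mu_{\mathrm c}-1}}=c_1,\qquad \lim_{\gamma\downarrow0}\frac{\lambda_{\max}(P)}{\gamma}=c_2,$$ where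 $\mu_{\mathrm c}$ is the controllability index of $(A,B)$. 6. There exist a constant $\delta_{\mathrm c}>0$ and a positive scalar function $f(\gamma)$ such that $$\frac{P}{2n\gamma}<\frac{\mathrm dP}{\mathrm d\gamma}\le\frac{f(\gamma)P}{2n\gamma}\le\frac{\delta_{\mathrm c}P}{2n\gamma},\quad\forall\,\gamma>0,$$ where $f(\gamma)=\min\{\delta_{\mathrm c},\overline{\delta}_{\mathrm c}\}$ with $$\overline{\delta}_{\mathrm c}=\overline{\delta}_{\mathrm c}(\gamma)=\frac1n\mathrm{tr}(H)+\sqrt{\frac{n-1}{n}\left(\mathrm{tr}(H^2)-\frac1n(\mathrm{tr}(H))^2\right)},\qquad H=H(\gamma)=2n\gamma P^{-\frac12}\frac{\mathrm dP}{\mathrm d\gamma}P^{-\frac12}.$$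
   Context: Positive definite matrices are understood to be symmetric, and matrix inequalities between symmetric matrices are in the Loewner order. $\lambda_i(M)$, $i=1,\dots,n$, denote the eigenvalues of a square matrix $M$ counted with multiplicity (the equality of eigenvalues in item 1 is an equality of spectra with multiplicities, for a suitable ordering). $\phi(A)=\min_{i}\Re(\lambda_i(A))$, $\lambda_{\max}$ is the largest eigenvalue of a symmetric matrix, $\mathrm{tr}$ is the trace, and $P^{\frac12}$ is the positive definite square root. The controllability index $\mu_{\mathrm c}$ of a controllable pair $(A,B)$ is the smallest positive integer $\mu$ such that $\mathrm{rank}[B\ AB\ \cdots\ A^{\mu-1}B]=n$. *)

theory Defs
  imports "HOL-Analysis.Analysis" "HOL-Computational_Algebra.Polynomial"
begin

(* The characteristic polynomial det (z I - A), computed over complex poly so that all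
   roots of the real matrix A are available. *)
definition charpoly :: "real^'n^'n \<Rightarrow> complex poly" where
  "charpoly A = det (mat [:0, 1:] - (\<chi> i j. [:complex_of_real (A $ i $ j):]))"

definition eigvals :: "real^'n^'n \<Rightarrow> complex multiset" where
  "eigvals A = proots (charpoly A)"

definition phi :: "real^'n^'n \<Rightarrow> real" where
  "phi A = Min (Re ` set_mset (eigvals A))"

(* Only meant for symmetric M, whose eigenvalues are real. *)
definition lambda_max :: "real^'n^'n \<Rightarrow> real" where
  "lambda_max M = Max (Re ` set_mset (eigvals M))"

definition pos_def :: "real^'n^'n \<Rightarrow> bool" where
  "pos_def M \<longleftrightarrow> transpose M = M \<and> (\<forall>x. x \<noteq> 0 \<longrightarrow> 0 < x \<bullet> (M *v x))"

definition pos_semidef :: "real^'n^'n \<Rightarrow> bool" where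
  "pos_semidef M \<longleftrightarrow> transpose M = M \<and> (\<forall>x. 0 \<le> x \<bullet> (M *v x))"

(* The Loewner order; the library order on vectors is componentwise. *)
definition loewner_le :: "real^'n^'n \<Rightarrow> real^'n^'n \<Rightarrow> bool" (infix "\<preceq>" 50) where
  "M \<preceq> N \<longleftrightarrow> transpose M = M \<and> transpose N = N \<and> pos_semidef (N - M)"

definition loewner_less :: "real^'n^'n \<Rightarrow> real^'n^'n \<Rightarrow> bool" (infix "\<prec>" 50) where
  "M \<prec> N \<longleftrightarrow> transpose M = M \<and> transpose N = N \<and> pos_def (N - M)"

definition pd_sqrt :: "real^'n^'n \<Rightarrow> real^'n^'n" where
  "pd_sqrt M = (THE S. pos_def S \<and> S ** S = M)"

(* The rank of the block matrix [B  AB ... A^(k-1) B], whose number of columns depends on k: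
   the dimension of the span of the columns of all its blocks (cf. column_rank_def).
   The block A^i B is an iterated matrix product, since the power operation on vectors
   is componentwise. *)
definition ctrb_rank :: "real^'n^'n \<Rightarrow> real^'m^'n \<Rightarrow> nat \<Rightarrow> nat" where
  "ctrb_rank A B k = dim (\<Union>i<k. columns (((\<lambda>M. A ** M) ^^ i) B))"

definition controllable :: "real^'n^'n \<Rightarrow> real^'m^'n \<Rightarrow> bool" where
  "controllable A (B :: real^'m^'n) \<longleftrightarrow> ctrb_rank A B CARD('n) = CARD('n)"

definition ctrb_index :: "real^'n^'n \<Rightarrow> real^'m^'n \<Rightarrow> nat" where
  "ctrb_index A (B :: real^'m^'n) = (LEAST \<mu>. 0 < \<mu> \<and> ctrb_rank A B \<mu> = CARD('n))"

definition eq_X :: "real^'n^'n \<Rightarrow> real^'m^'n \<Rightarrow> real \<Rightarrow> real^'n^'n \<Rightarrow> bool" where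
  "eq_X A B \<gamma> X \<longleftrightarrow>
     transpose A ** X + X ** A + X ** B ** transpose B ** X = \<gamma> *\<^sub>R X"

definition X_sol :: "real^'n^'n \<Rightarrow> real^'m^'n \<Rightarrow> real \<Rightarrow> real^'n^'n" where
  "X_sol A B \<gamma> = (THE X. pos_def X \<and> eq_X A B \<gamma> X)"

definition eq_Y :: "real^'n^'n \<Rightarrow> real^'m^'n \<Rightarrow> real \<Rightarrow> real^'n^'n \<Rightarrow> real^'n^'n \<Rightarrow> bool" where
  "eq_Y A B \<gamma> X Y \<longleftrightarrow>
     transpose (A + B ** transpose B ** X) ** Y + Y ** (A + B ** transpose B ** X)
       - Y ** B ** transpose B ** Y = - (\<gamma> *\<^sub>R Y)"

definition Y_sol :: "real^'n^'n \<Rightarrow> real^'m^'n \<Rightarrow> real \<Rightarrow> real^'n^'n" where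
  "Y_sol A B \<gamma> = (THE Y. pos_def Y \<and> eq_Y A B \<gamma> (X_sol A B \<gamma>) Y)"

definition P_sol :: "real^'n^'n \<Rightarrow> real^'m^'n \<Rightarrow> real \<Rightarrow> real^'n^'n" where
  "P_sol A B \<gamma> = Y_sol A B \<gamma> - X_sol A B \<gamma>"

definition rational_matrix_on :: "real set \<Rightarrow> (real \<Rightarrow> real^'n^'n) \<Rightarrow> bool" where
  "rational_matrix_on S F \<longleftrightarrow>
     (\<forall>i j. \<exists>p q :: real poly. \<forall>\<gamma>\<in>S. poly q \<gamma> \<noteq> 0 \<and> F \<gamma> $ i $ j = poly p \<gamma> / poly q \<gamma>)"

definition dP :: "real^'n^'n \<Rightarrow> real^'m^'n \<Rightarrow> real \<Rightarrow> real^'n^'n" where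
  "dP A B \<gamma> = vector_derivative (P_sol A B) (at \<gamma>)"

definition H_mat :: "real^'n^'n \<Rightarrow> real^'m^'n \<Rightarrow> real \<Rightarrow> real^'n^'n" where
  "H_mat A (B :: real^'m^'n) \<gamma> =
     (let R = matrix_inv (pd_sqrt (P_sol A B \<gamma>))
      in (2 * real CARD('n) * \<gamma>) *\<^sub>R (R ** dP A B \<gamma> ** R))"

definition delta_bar :: "real^'n^'n \<Rightarrow> real^'m^'n \<Rightarrow> real \<Rightarrow> real" where
  "delta_bar A (B :: real^'m^'n) \<gamma> =
     (let n = real CARD('n); H = H_mat A B \<gamma>
      in trace H / n + sqrt ((n - 1) / n * (trace (H ** H) - (trace H)\<^sup>2 / n)))"

end

theory Submission
  imports Defs "HOL-Computational_Algebra.Fundamental_Theorem_Algebra"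
begin

text \<open>The inverse \<open>W = X\<^sup>-\<^sup>1\<close> solves \<open>\<gamma> W - A W - W A\<^sup>T = B B\<^sup>T\<close>, and \<open>Q = X Y\<^sup>-\<^sup>1 X\<close> solves
  \<open>3 \<gamma> Q - A\<^sup>T Q - Q A = X B B\<^sup>T X\<close>, so that \<open>Q = X - 2 \<gamma> V\<close> where \<open>3 \<gamma> V - A\<^sup>T V - V A = X\<close>.
  All positivity claims reduce to the fact that such a Lyapunov operator, for \<open>\<gamma> > 0\<close> and a matrix
  with spectrum in the closed left half-plane, is invertible with a positive inverse.  Moreover
  \<open>A - B B\<^sup>T P\<close> is similar to \<open>A - 2 \<gamma>\<close>, and \<open>A\<^sup>T P + P A - P B B\<^sup>T P = - \<gamma> (P + 2 X)\<close>, where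
  \<open>\<gamma> X \<le> n (\<gamma> - \<phi>(A)) P\<close>.

  Differentiating the equation for \<open>P\<close> gives a Lyapunov equation with positive right-hand side for
  \<open>P' - P / (2 n \<gamma>)\<close>.  In the other direction \<open>P' \<le> tr (P\<^sup>-\<^sup>1 P') P\<close>, and by Jacobi's formula
  \<open>\<gamma> tr (P\<^sup>-\<^sup>1 P')\<close> is \<open>\<gamma>\<close> times the logarithmic derivative of \<open>det P\<close>, which is bounded because
  \<open>det P\<close> is a rational function without zeros on the positive half-line.

  For the limits, the entries of \<open>P\<close> being rational, it suffices to bound \<open>\<lambda>\<^sub>m\<^sub>a\<^sub>x(P)\<close> to the right
  order on both sides.  The upper bound follows from \<open>B\<^sup>T P B \<le> 2 n \<gamma>\<close> and
  \<open>A\<^sup>T P A \<le> K (1 + \<gamma>)\<^sup>2 P\<close>, since the columns of \<open>A\<^sup>j B\<close>, \<open>j < \<mu>\<close>, span the space.  The lower bound at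
  \<open>0\<close> comes from \<open>tr (B\<^sup>T P B) = 2 n \<gamma>\<close>; at infinity \<open>P\<close> dominates a multiple of \<open>X\<close>, and \<open>X\<close> is large
  in a direction orthogonal to \<open>A\<^sup>j B\<close> for all \<open>j < \<mu> - 1\<close>.\<close>


text \<open>Inversion makes both nonlinear equations linear. The first one says that A + B B^T X is
  a conjugate of \<gamma> - A^T. Put into the second equation, this form yields the shift 3
  \<gamma>: each of the two linear terms contributes \<gamma>, and the right-hand side a third. Read
  once more, the second equation exhibits the closed loop as a conjugate of A - 2 \<gamma>.

  The obstacle is uniformity: one constant has to serve all \<gamma> > 0, while A may have
  eigenvalues on the imaginary axis, so that the Lyapunov operators degenerate as \<gamma> tends to
  0. The estimate of X by P is uniform because it rests on trace identities. The rest is algebra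
  instead of matrix exponentials: every object arises by linear solves, products and inverses, hence
  is rational in \<gamma> by Cramer's rule. Differentiability is then free, a rational f without
  zeros or poles on the half-line has t f'(t) / f(t) bounded there, and a bounded rational function
  has limits at both ends. Rationality also gives the continuity that carries positivity of Lyapunov
  solutions from large shifts down to small ones.\<close>

declare transpose_matrix_vector [simp del]

section \<open>Matrix algebra, transposes and traces\<close>

lemma matrix_add_rdistrib:
  fixes A B :: "'a::semiring_1^'n^'m" shows "(A + B) ** C = A ** C + B ** C"
  by (simp add: vec_eq_iff matrix_matrix_mult_def distrib_right sum.distrib)

lemma matrix_diff_ldistrib:
  fixes A :: "'a::ring_1^'n^'m" shows "A ** (B - C) = A ** B - A ** C"
  by (simp add: vec_eq_iff matrix_matrix_mult_def right_diff_distrib sum_subtractf)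

lemma matrix_diff_rdistrib:
  fixes A B :: "'a::ring_1^'n^'m" shows "(A - B) ** C = A ** C - B ** C"
  by (simp add: vec_eq_iff matrix_matrix_mult_def left_diff_distrib sum_subtractf)

lemma matrix_mult_minus_right:
  fixes A :: "'a::ring_1^'n^'m" shows "A ** (- B) = - (A ** B)"
  by (simp add: vec_eq_iff matrix_matrix_mult_def sum_negf)

lemma matrix_mult_minus_left:
  fixes A :: "'a::ring_1^'n^'m" shows "(- A) ** B = - (A ** B)"
  by (simp add: vec_eq_iff matrix_matrix_mult_def sum_negf)

lemma matrix_scaleR_left:
  fixes A :: "real^'n^'m" shows "(c *\<^sub>R A) ** B = c *\<^sub>R (A ** B)"
  by (rule scalar_matrix_assoc[symmetric])

lemma matrix_scaleR_right:
  fixes A :: "real^'n^'m" shows "A ** (c *\<^sub>R B) = c *\<^sub>R (A ** B)"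
  by (simp add: matrix_scalar_ac matrix_scaleR_left)

lemma transpose_add: "transpose (A + B) = transpose A + transpose B"
  by (simp add: vec_eq_iff transpose_def)

lemma transpose_diff: "transpose (A - B) = transpose A - transpose B"
  by (simp add: vec_eq_iff transpose_def)

lemma transpose_minus: "transpose (- A) = - transpose A"
  by (simp add: vec_eq_iff transpose_def)

lemma transpose_0 [simp]: "transpose 0 = 0"
  by (simp add: vec_eq_iff transpose_def)

lemma trace_scaleR: "trace (c *\<^sub>R (A::real^'n^'n)) = c * trace A"
  by (simp add: trace_def sum_distrib_left)

lemma trace_minus: "trace (- A :: real^'n^'n) = - trace A"
  by (simp add: trace_def sum_negf)

lemma trace_transpose: "trace (transpose A) = trace A"
  by (simp add: trace_def transpose_def)

lemmas transpose_distribs = transpose_add transpose_diff transpose_minus transpose_scalar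
  matrix_transpose_mul

lemmas matrix_ring_simps = matrix_add_ldistrib matrix_add_rdistrib matrix_diff_ldistrib
  matrix_diff_rdistrib matrix_mult_minus_left matrix_mult_minus_right matrix_scaleR_left
  matrix_scaleR_right matrix_mul_assoc

lemmas trace_distribs = trace_add trace_sub trace_scaleR trace_minus

lemma matrix_vector_scaleR_left:
  fixes A :: "real^'n^'m" shows "(c *\<^sub>R A) *v x = c *\<^sub>R (A *v x)"
  by (metis scaleR_matrix_vector_assoc)

lemma matrix_vector_minus_left:
  fixes A :: "real^'n^'m" shows "(- A) *v x = - (A *v x)"
  by (simp add: vec_eq_iff matrix_vector_mult_def sum_negf)

lemmas quadratic_form_simps = matrix_vector_mult_diff_rdistrib matrix_vector_mult_add_rdistrib
  matrix_vector_scaleR_left matrix_vector_minus_left inner_diff_right inner_add_right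

section \<open>Quadratic forms, the spectral theorem and square roots\<close>

lemma dot_transpose:
  fixes M :: "real^'n^'m" shows "x \<bullet> (M *v y) = (transpose M *v x) \<bullet> y"
  by (simp add: transpose_matrix_vector dot_lmul_matrix)

lemma dot_sym:
  fixes M :: "real^'n^'n" assumes "transpose M = M" shows "x \<bullet> (M *v y) = y \<bullet> (M *v x)"
  by (metis assms dot_transpose inner_commute)

lemma quadratic_form_add:
  fixes M :: "real^'n^'n" assumes "transpose M = M"
  shows "(x + y) \<bullet> (M *v (x + y)) = x \<bullet> (M *v x) + 2 * (x \<bullet> (M *v y)) + y \<bullet> (M *v y)"
  using dot_sym[OF assms, of x y]
  by (simp add: matrix_vector_right_distrib inner_add_left inner_add_right)

lemma pos_def_sym: "pos_def M \<Longrightarrow> transpose M = M"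
  by (simp add: pos_def_def)

lemma pos_semidef_sym: "pos_semidef M \<Longrightarrow> transpose M = M"
  by (simp add: pos_semidef_def)

lemma pos_semidef_ge0: "pos_semidef M \<Longrightarrow> 0 \<le> x \<bullet> (M *v x)"
  by (simp add: pos_semidef_def)

lemma pos_def_gt0: "pos_def M \<Longrightarrow> x \<noteq> 0 \<Longrightarrow> 0 < x \<bullet> (M *v x)"
  by (simp add: pos_def_def)

lemma pos_def_imp_semidef: "pos_def M \<Longrightarrow> pos_semidef M"
  unfolding pos_def_def pos_semidef_def
  by (metis inner_zero_left less_eq_real_def order_refl)

lemma nonneg_quadratic_imp_linear_coeff_0:
  fixes b c :: real assumes "\<And>t. 0 \<le> 2 * t * b + t^2 * c" shows "b = 0"
proof (rule ccontr)
  assume b: "b \<noteq> 0"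
  \<comment> \<open>At t = - b / k the quadratic equals (b^2 / k) (c / k - 2), which is negative
    because k > 0 and c \<le> k.\<close>
  define k where "k = \<bar>c\<bar> + 1"
  have k: "k > 0" "c \<le> k" unfolding k_def by auto
  have "2 * (- b / k) * b + (- b / k)^2 * c = (b^2 / k) * (c / k - 2)"
    using k by (simp add: field_simps power2_eq_square)
  moreover have "c / k - 2 < 0" "b^2 / k > 0" using k b by (auto simp: field_simps)
  ultimately have "2 * (- b / k) * b + (- b / k)^2 * c < 0"
    by (metis mult_pos_neg)
  then show False using assms[of "- b / k"] by simp
qed

text \<open>An isotropic vector minimises the nonnegative form on \<open>S\<close>, so the first
  variation vanishes in every direction of \<open>S\<close>. The version relative to a subspace
  feeds the spectral theorem.\<close>

lemma semidef_on_subspace_isotropic: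
  fixes M :: "real^'n^'n"
  assumes M: "transpose M = M" and S: "subspace S"
    and pos: "\<And>x. x \<in> S \<Longrightarrow> 0 \<le> x \<bullet> (M *v x)"
    and x: "x \<in> S" "x \<bullet> (M *v x) = 0" and y: "y \<in> S"
  shows "y \<bullet> (M *v x) = 0"
proof (rule nonneg_quadratic_imp_linear_coeff_0)
  fix t :: real
  have "0 \<le> (x + t *\<^sub>R y) \<bullet> (M *v (x + t *\<^sub>R y))"
    using S x y by (intro pos) (simp add: subspace_add subspace_scale)
  then show "0 \<le> 2 * t * (y \<bullet> (M *v x)) + t^2 * (y \<bullet> (M *v y))"
    using x dot_sym[OF M, of x y]
    by (simp add: quadratic_form_add[OF M] matrix_vector_mult_scaleR power2_eq_square algebra_simps)
qed

lemma pos_semidef_isotropic: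
  assumes "pos_semidef M" "x \<bullet> (M *v x) = 0" shows "M *v x = 0"
proof -
  have "(M *v x) \<bullet> (M *v x) = 0"
    using assms by (rule_tac semidef_on_subspace_isotropic[where S = UNIV]) (auto simp: pos_semidef_def)
  then show ?thesis by simp
qed

lemma pos_def_ge0: "pos_def M \<Longrightarrow> 0 \<le> x \<bullet> (M *v x)"
  by (rule pos_semidef_ge0[OF pos_def_imp_semidef])

lemma pos_defI_semidef:
  assumes "pos_semidef M" "\<And>x. M *v x = 0 \<Longrightarrow> x = 0" shows "pos_def M"
  using assms pos_semidef_isotropic[OF assms(1)] unfolding pos_def_def pos_semidef_def
  by (metis order_le_less)

text \<open>A maximiser x of the Rayleigh quotient on the unit sphere of \<open>S\<close> is
  isotropic for m - M, which is semidefinite on \<open>S\<close>. Hence (m - M) x is orthogonal to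
  \<open>S\<close>; by invariance it lies in \<open>S\<close>, so it is 0.\<close>

lemma symmetric_max_eigenvector:
  fixes M :: "real^'n^'n"
  assumes M: "transpose M = M" and S: "subspace S" "S \<noteq> {0}"
    and inv: "\<And>x. x \<in> S \<Longrightarrow> M *v x \<in> S"
  obtains x m where "x \<in> S" "norm x = 1" "M *v x = m *\<^sub>R x"
    "\<And>y. y \<in> S \<Longrightarrow> y \<bullet> (M *v y) \<le> m * (y \<bullet> y)"
proof -
  let ?K = "S \<inter> sphere 0 1"
  have cpt: "compact ?K"
    using closed_subspace[OF S(1)] by (simp add: closed_Int_compact)
  obtain z where z: "z \<in> S" "z \<noteq> 0"
    using S subspace_0[OF S(1)] by blast
  then have "z /\<^sub>R norm z \<in> ?K" using S(1) by (simp add: subspace_scale)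
  then have ne: "?K \<noteq> {}" by blast
  have cont: "continuous_on ?K (\<lambda>x. x \<bullet> (M *v x))"
    by (intro continuous_intros linear_continuous_on matrix_vector_mul_bounded_linear)
  obtain x where x: "x \<in> ?K" and mx: "\<And>y. y \<in> ?K \<Longrightarrow> y \<bullet> (M *v y) \<le> x \<bullet> (M *v x)"
    using continuous_attains_sup[OF cpt ne cont] by blast
  define m where "m = x \<bullet> (M *v x)"
  have le: "y \<bullet> (M *v y) \<le> m * (y \<bullet> y)" if "y \<in> S" for y
  proof (cases "y = 0")
    case False
    then have "y /\<^sub>R norm y \<in> ?K" using S(1) that by (simp add: subspace_scale)
    from mx[OF this] have "(y \<bullet> (M *v y)) / (norm y)^2 \<le> m"
      by (simp add: m_def matrix_vector_mult_scaleR power2_eq_square divide_simps)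
    then show ?thesis using False
      by (simp add: pos_divide_le_eq power2_norm_eq_inner)
  qed simp
  define N where "N = m *\<^sub>R mat 1 - M"
  have N: "transpose N = N" by (simp add: N_def transpose_distribs M)
  have Nv: "N *v y = m *\<^sub>R y - M *v y" for y
    by (simp add: N_def matrix_vector_mult_diff_rdistrib matrix_vector_scaleR_left)
  have xx: "x \<in> S" "x \<bullet> x = 1" "norm x = 1" using x by (auto simp: norm_eq_1)
  have NS: "N *v x \<in> S" using xx inv S(1) by (simp add: Nv subspace_diff subspace_scale)
  have "(N *v x) \<bullet> (N *v x) = 0"
  proof (rule semidef_on_subspace_isotropic[OF N S(1)])
    show "0 \<le> y \<bullet> (N *v y)" if "y \<in> S" for y
      using le[OF that] by (simp add: Nv inner_diff_right)
    show "x \<bullet> (N *v x) = 0" using xx by (simp add: Nv inner_diff_right m_def)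
  qed (use xx NS in auto)
  then have "M *v x = m *\<^sub>R x" by (simp add: Nv)
  then show ?thesis using that xx le by blast
qed

text \<open>Induction on the dimension: split off a top eigenvector; by symmetry its orthogonal
  complement within \<open>S\<close> is again invariant.\<close>

lemma symmetric_eigenbasis:
  fixes M :: "real^'n^'n"
  assumes M: "transpose M = M"
  shows "subspace S \<Longrightarrow> (\<And>x. x \<in> S \<Longrightarrow> M *v x \<in> S) \<Longrightarrow>
    \<exists>E l. finite E \<and> E \<subseteq> S \<and> pairwise orthogonal E \<and> (\<forall>b\<in>E. norm b = 1 \<and> M *v b = l b *\<^sub>R b)
      \<and> S \<subseteq> span E"
proof (induction "dim S" arbitrary: S rule: less_induct)
  case less
  show ?case
  proof (cases "S = {0}")
    case True
    then show ?thesis by (intro exI[of _ "{}"]) auto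
  next
    case False
    obtain x m where x: "x \<in> S" "norm x = 1" "M *v x = m *\<^sub>R x"
      using symmetric_max_eigenvector[OF M less.prems(1) False less.prems(2)] by metis
    let ?T = "S \<inter> {y. orthogonal x y}"
    have T: "subspace ?T"
      using less.prems(1) by (intro subspace_inter subspace_orthogonal_to_vector)
    have invT: "M *v y \<in> ?T" if "y \<in> ?T" for y
      using that less.prems(2) dot_sym[OF M, of x y] x(3) by (auto simp: orthogonal_def inner_commute)
    have "x \<notin> ?T" using x by (auto simp: orthogonal_def)
    then have "?T \<subset> S" using x by auto
    then have "dim ?T < dim S"
      by (metis T dim_psubset less.prems(1) span_eq_iff)
    from less.hyps[OF this T invT] obtain E l where E: "finite E" "E \<subseteq> ?T" "pairwise orthogonal E"
      "\<forall>b\<in>E. norm b = 1 \<and> M *v b = l b *\<^sub>R b" "?T \<subseteq> span E" by blast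
    have "S \<subseteq> span (insert x E)"
    proof
      fix y assume y: "y \<in> S"
      have "x \<bullet> x = 1" using x by (simp add: norm_eq_1)
      then have "y - (x \<bullet> y) *\<^sub>R x \<in> ?T" using y x less.prems(1)
        by (auto simp: orthogonal_def subspace_diff subspace_scale inner_diff_right)
      then have "y - (x \<bullet> y) *\<^sub>R x \<in> span (insert x E)"
        using E(5) span_mono[of E "insert x E"] by blast
      moreover have "(x \<bullet> y) *\<^sub>R x \<in> span (insert x E)" by (simp add: span_base span_scale)
      ultimately show "y \<in> span (insert x E)" by (metis diff_add_cancel span_add)
    qed
    moreover have "x \<notin> E" using E(2) \<open>x \<notin> ?T\<close> by blast
    ultimately show ?thesis using E x less.prems
      by (intro exI[of _ "insert x E"] exI[of _ "l(x := m)"])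
        (auto simp: pairwise_insert orthogonal_commute)
  qed
qed

text \<open>In an orthonormal eigenbasis of \<open>M\<close>, replace each eigenvalue, positive by
  definiteness, by its square root.\<close>

lemma pd_sqrt_exists:
  fixes M :: "real^'n^'n"
  assumes M: "pos_def M"
  obtains S where "pos_def S" "S ** S = M"
proof -
  obtain E l where E: "finite E" "pairwise orthogonal E"
      "\<And>b. b \<in> E \<Longrightarrow> norm b = 1" "\<And>b. b \<in> E \<Longrightarrow> M *v b = l b *\<^sub>R b" "span E = UNIV"
    using symmetric_eigenbasis[OF pos_def_sym[OF M] subspace_UNIV] by (metis UNIV_I top.extremum_unique)
  have bb: "b \<bullet> c = (if b = c then 1 else 0)" if "b \<in> E" "c \<in> E" for b c
    using E that by (auto simp: pairwise_def orthogonal_def norm_eq_1)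
  have l: "l b > 0" if "b \<in> E" for b
    using pos_def_gt0[OF M, of b] E(3)[OF that] E(4)[OF that] bb[OF that that] by (cases "b = 0") auto
  have expand: "x = (\<Sum>b\<in>E. (b \<bullet> x) *\<^sub>R b)" for x
  proof -
    have "x \<in> span E" by (simp add: E)
    then show ?thesis
    proof (induction rule: span_induct)
      case base
      show ?case
        unfolding subspace_def by (auto simp: inner_add_right scaleR_add_left sum.distrib)
            (metis (no_types, lifting) scaleR_scaleR scaleR_sum_right sum.cong)
    next
      case (step x)
      have "(\<Sum>b\<in>E. (b \<bullet> x) *\<^sub>R b) = (\<Sum>b\<in>E. if b = x then b else 0)"
        using step bb by (intro sum.cong) auto
      then show ?case using step E(1) by simp
    qed
  qed
  define f where "f x = (\<Sum>b\<in>E. (sqrt (l b) * (b \<bullet> x)) *\<^sub>R b)" for x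
  have lin: "linear f"
    unfolding f_def by (intro linearI)
      (auto simp: inner_add_right distrib_left scaleR_add_left sum.distrib scaleR_sum_right algebra_simps)
  define S where "S = matrix f"
  have Sv: "S *v x = f x" for x unfolding S_def using lin by (simp add: matrix_works)
  have fb: "f b = sqrt (l b) *\<^sub>R b" if "b \<in> E" for b
  proof -
    have "f b = (\<Sum>c\<in>E. if c = b then sqrt (l c) *\<^sub>R c else 0)"
      unfolding f_def using bb that by (intro sum.cong) auto
    then show ?thesis using that E(1) by simp
  qed
  have dotS: "x \<bullet> (S *v y) = (\<Sum>b\<in>E. sqrt (l b) * (b \<bullet> x) * (b \<bullet> y))" for x y
    by (auto simp: Sv f_def inner_sum_right inner_commute intro!: sum.cong)
  have "S ** S = M"
  proof -
    have "(S ** S) *v x = M *v x" for x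
    proof -
      have "x \<in> span E" by (simp add: E)
      then show ?thesis
      proof (induction rule: span_induct)
        case base
        show ?case unfolding subspace_def
          by (auto simp: matrix_vector_right_distrib matrix_vector_mult_scaleR)
      next
        case (step x)
        then show ?case using l[OF step] E(4)[OF step]
          by (simp add: matrix_vector_mul_assoc[symmetric] Sv fb linear_scale[OF lin])
      qed
    qed
    then show ?thesis by (simp add: matrix_eq)
  qed
  moreover have "transpose S = S"
  proof -
    have "(transpose S *v x) \<bullet> y = (S *v x) \<bullet> y" for x y
      unfolding dot_transpose[symmetric] inner_commute[of "S *v x" y] dotS by (simp add: mult_ac)
    then show ?thesis by (metis matrix_eq vector_eq_rdot)
  qed
  moreover have "x \<bullet> (S *v x) > 0" if "x \<noteq> 0" for x
  proof -
    have ge: "x \<bullet> (S *v x) \<ge> 0"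
      unfolding dotS using l by (intro sum_nonneg) (simp add: mult.assoc less_imp_le)
    have "x \<bullet> (S *v x) \<noteq> 0"
    proof
      assume "x \<bullet> (S *v x) = 0"
      then have "\<forall>b\<in>E. sqrt (l b) * (b \<bullet> x) * (b \<bullet> x) = 0"
        unfolding dotS using l E(1) by (subst (asm) sum_nonneg_eq_0_iff) (auto simp: mult.assoc less_imp_le)
      then have "\<forall>b\<in>E. b \<bullet> x = 0" using l by force
      then show False using expand[of x] that by simp
    qed
    then show ?thesis using ge by simp
  qed
  ultimately show thesis using that[of S] by (simp add: pos_def_def)
qed

text \<open>D = S - T satisfies S D + D T = S^2 - T^2 = 0. Pairing this with a unit eigenvector x of
  D for m gives m (x . S x + x . T x) = 0, so 0 is the only eigenvalue. Uniqueness gives meaning to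
  the description operator in \<open>pd_sqrt\<close>.\<close>

lemma pos_def_sqrt_unique:
  assumes S: "pos_def S" and T: "pos_def T" and eq: "S ** S = T ** T"
  shows "S = (T :: real^'n^'n)"
proof -
  define D where "D = S - T"
  have sym: "transpose D = D"
    using S T by (simp add: D_def transpose_distribs pos_def_sym)
  have D0: "S ** D + D ** T = 0" by (simp add: D_def matrix_ring_simps eq)
  have ev: "m = 0" if x: "norm x = 1" "D *v x = m *\<^sub>R x" for x m
  proof -
    have "0 = x \<bullet> ((S ** D + D ** T) *v x)" by (simp add: D0)
    also have "\<dots> = m * (x \<bullet> (S *v x) + x \<bullet> (T *v x))"
      using dot_transpose[of x D "T *v x"] x sym
      by (simp add: matrix_vector_mult_add_rdistrib matrix_vector_mul_assoc[symmetric]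
          matrix_vector_mult_scaleR inner_add_right distrib_left)
    finally have "m = 0 \<or> x \<bullet> (S *v x) + x \<bullet> (T *v x) = 0" by simp
    moreover have "x \<noteq> 0" using x by auto
    ultimately show ?thesis using pos_def_gt0[OF S, of x] pos_def_gt0[OF T, of x] by linarith
  qed
  have le: "y \<bullet> (N *v y) \<le> 0" if N: "transpose N = N"
    "\<And>x m. norm x = 1 \<Longrightarrow> N *v x = m *\<^sub>R x \<Longrightarrow> m = 0" for N :: "real^'n^'n" and y
  proof -
    have "(UNIV :: (real^'n) set) \<noteq> {0}" by (metis UNIV_I singletonD zero_neq_one)
    then obtain x m where x: "norm x = 1" "N *v x = m *\<^sub>R x" "y \<bullet> (N *v y) \<le> m * (y \<bullet> y)"
      using symmetric_max_eigenvector[OF N(1) subspace_UNIV] by (metis UNIV_I)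
    then show ?thesis using N(2)[OF x(1,2)] by simp
  qed
  have "m = 0" if "norm x = 1" "(- D) *v x = m *\<^sub>R x" for x m
  proof -
    have "D *v x = (- m) *\<^sub>R x"
      using that(2) by (metis matrix_vector_minus_left minus_minus scaleR_minus_left)
    then show ?thesis using ev[of x "- m"] that(1) by simp
  qed
  then have "y \<bullet> ((- D) *v y) \<le> 0" for y
    using sym by (intro le) (auto simp: transpose_distribs)
  then have "pos_semidef D" using sym by (simp add: pos_semidef_def matrix_vector_minus_left)
  moreover have "y \<bullet> (D *v y) \<le> 0" for y using sym ev by (rule le)
  ultimately have "y \<bullet> (D *v y) = 0" for y by (meson pos_semidef_ge0 order_antisym)
  then have "D *v y = 0" for y using \<open>pos_semidef D\<close> pos_semidef_isotropic by blast
  then have "D = 0" by (simp add: matrix_eq)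
  then show ?thesis by (simp add: D_def)
qed

lemma pd_sqrt:
  assumes "pos_def M" shows "pos_def (pd_sqrt M)" "pd_sqrt M ** pd_sqrt M = M"
proof -
  obtain S where S: "pos_def S" "S ** S = M" using pd_sqrt_exists[OF assms] .
  then have "pd_sqrt M = S"
    unfolding pd_sqrt_def by (intro the_equality) (auto intro: pos_def_sqrt_unique)
  then show "pos_def (pd_sqrt M)" "pd_sqrt M ** pd_sqrt M = M" using S by auto
qed

section \<open>Eigenvalues with multiplicity through the characteristic polynomial\<close>

abbreviation cmat :: "real^'n^'m \<Rightarrow> complex^'n^'m" where
  "cmat \<equiv> map_matrix complex_of_real"

lemma cmat_mult: "cmat (A ** B) = cmat A ** cmat B"
  by (simp add: vec_eq_iff matrix_matrix_mult_def)

lemma cmat_transpose: "cmat (transpose A) = transpose (cmat A)"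
  by (simp add: vec_eq_iff transpose_def)

text \<open>The Leibniz formula is an integer polynomial in the entries. It is applied to evaluation
  of polynomial entries at a point and to the substitution of z + c for z.\<close>

lemma det_ring_hom:
  fixes M :: "'a::comm_ring_1^'n^'n"
  assumes "\<And>x y. h (x + y) = h x + h y" "\<And>x y. h (x * y) = h x * h y" "h 1 = 1"
  shows "h (det M) = det (map_matrix h M)"
proof -
  have h0: "h 0 = 0" using assms(1)[of 0 0] by simp
  have hm: "h (- x) = - h x" for x using assms(1)[of x "- x"] h0 by (simp add: eq_neg_iff_add_eq_0 add.commute)
  have hsum: "h (sum f S) = (\<Sum>s\<in>S. h (f s))" for f :: "('n \<Rightarrow> 'n) \<Rightarrow> 'a" and S
    by (induction S rule: infinite_finite_induct) (auto simp: h0 assms)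
  have hprod: "h (prod f S) = (\<Prod>s\<in>S. h (f s))" for f :: "'n \<Rightarrow> 'a" and S
    by (induction S rule: infinite_finite_induct) (auto simp: assms)
  have "h (of_int (sign p)) = of_int (sign p)" for p :: "'n \<Rightarrow> 'n"
    by (simp add: sign_def assms hm)
  then show ?thesis by (simp add: det_def hsum assms hprod)
qed

lemma poly_charpoly: "poly (charpoly A) z = det (mat z - cmat A)"
proof -
  have "poly (charpoly A) z = det (map_matrix (\<lambda>p. poly p z)
      (mat [:0, 1:] - (\<chi> i j. [:complex_of_real (A $ i $ j):])))"
    unfolding charpoly_def by (rule det_ring_hom) auto
  also have "map_matrix (\<lambda>p. poly p z) (mat [:0, 1:] - (\<chi> i j. [:complex_of_real (A $ i $ j):]))
      = mat z - cmat A"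
    by (simp add: vec_eq_iff mat_def)
  finally show ?thesis .
qed

lemma det_mat_diff_eq_0_iff:
  fixes M :: "complex^'n^'n"
  shows "det (mat z - M) = 0 \<longleftrightarrow> (\<exists>x. x \<noteq> 0 \<and> M *v x = z *s x)"
proof -
  have "det (mat z - M) = 0 \<longleftrightarrow> \<not> (\<exists>B. B ** (mat z - M) = mat 1)"
    using invertible_det_nz[of "mat z - M"] by (metis invertible_left_inverse)
  also have "\<dots> \<longleftrightarrow> (\<exists>x. x \<noteq> 0 \<and> (mat z - M) *v x = 0)"
    unfolding matrix_left_invertible_ker by auto
  finally have iff: "det (mat z - M) = 0 \<longleftrightarrow> (\<exists>x. x \<noteq> 0 \<and> (mat z - M) *v x = 0)" .
  have "mat z *v x = z *s x" for x :: "complex^'n"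
    by (simp add: vec_eq_iff matrix_vector_mult_def mat_def if_distrib if_distribR cong: if_cong)
  then have "(mat z - M) *v x = 0 \<longleftrightarrow> M *v x = z *s x" for x
    by (metis matrix_vector_mult_diff_rdistrib right_minus_eq)
  with iff show ?thesis by simp
qed

text \<open>If the polynomial vanished, every complex number would be an eigenvalue, but none can
  exceed an operator bound \<open>K\<close>; the number \<bar>K\<bar> + 1 gives the
  contradiction.\<close>

lemma charpoly_nonzero: "charpoly (A :: real^'n^'n) \<noteq> 0"
proof
  assume "charpoly A = 0"
  then have sing: "\<exists>x. x \<noteq> 0 \<and> cmat A *v x = z *s x" for z
    by (simp flip: det_mat_diff_eq_0_iff poly_charpoly)
  obtain K where K: "\<And>x. norm (cmat A *v x) \<le> norm x * K"
    using bounded_linear.bounded[OF matrix_vector_mul_bounded_linear[of "cmat A"]] by metis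
  obtain x where x: "x \<noteq> 0" "cmat A *v x = complex_of_real (\<bar>K\<bar> + 1) *s x" using sing by blast
  have "complex_of_real (\<bar>K\<bar> + 1) *s x = (\<bar>K\<bar> + 1) *\<^sub>R x"
    unfolding vec_eq_iff vector_scaleR_component by (simp add: scaleR_conv_of_real del: of_real_add)
  then have "norm x * (\<bar>K\<bar> + 1) \<le> norm x * K"
    using K[of x] unfolding x(2) by (simp add: mult.commute del: of_real_add)
  then show False using x(1) by simp
qed

lemma eigvals_iff: "z \<in># eigvals A \<longleftrightarrow> (\<exists>x. x \<noteq> 0 \<and> cmat A *v x = z *s x)"
  by (simp add: eigvals_def charpoly_nonzero poly_charpoly det_mat_diff_eq_0_iff)

lemma eigvals_transpose: "eigvals (transpose A) = eigvals A"
proof -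
  have "mat [:0, 1:] - (\<chi> i j. [:complex_of_real (transpose A $ i $ j):])
     = transpose (mat [:0, 1:] - (\<chi> i j. [:complex_of_real (A $ i $ j):]))"
    by (auto simp: vec_eq_iff transpose_def mat_def)
  then show ?thesis by (simp add: eigvals_def charpoly_def)
qed

text \<open>The conjugation takes place on matrices of constant polynomials, where
  \<open>det\<close> is multiplicative. The characteristic polynomials therefore coincide and
  multiplicities are kept.\<close>

lemma eigvals_similar:
  fixes S :: "real^'n^'n"
  assumes "S ** T = mat 1"
  shows "eigvals (S ** A ** T) = eigvals A"
proof -
  define pm :: "real^'n^'n \<Rightarrow> complex poly^'n^'n" where "pm M = (\<chi> i j. [:complex_of_real (M $ i $ j):])" for M
  have sum_const: "(\<Sum>i\<in>I. [:g i:]) = [:sum g I:]" for g :: "'n \<Rightarrow> complex" and I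
    by (induction I rule: infinite_finite_induct) auto
  have pm_mult: "pm (M ** N) = pm M ** pm N" for M N
    by (simp add: pm_def vec_eq_iff matrix_matrix_mult_def sum_const mult.commute)
  have pm_1: "pm (mat 1) = mat 1"
    by (simp add: pm_def vec_eq_iff mat_def one_pCons)
  have comm: "M ** mat c = mat c ** M" for M :: "complex poly^'n^'n" and c
    by (simp add: vec_eq_iff matrix_matrix_mult_def mat_def if_distrib if_distribR mult.commute cong: if_cong)
  have ST: "pm S ** pm T = mat 1" by (simp add: assms pm_1 flip: pm_mult)
  have "mat [:0, 1:] - pm (S ** A ** T) = pm S ** (mat [:0, 1:] - pm A) ** pm T"
    by (simp add: matrix_diff_ldistrib matrix_diff_rdistrib comm pm_mult)
      (simp add: ST flip: matrix_mul_assoc)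
  then have "det (mat [:0, 1:] - pm (S ** A ** T)) = det (pm S ** pm T) * det (mat [:0, 1:] - pm A)"
    by (simp add: det_mul)
  then show ?thesis by (simp add: ST eigvals_def charpoly_def flip: pm_def)
qed

lemma pcompose_power: "pcompose (p ^ n) q = pcompose p q ^ n"
  by (induction n) (simp_all add: pcompose_mult pcompose_1)

lemma order_pcompose_linear:
  fixes p :: "complex poly"
  assumes "p \<noteq> 0"
  shows "order z (pcompose p [:c, 1:]) = order (z + c) p"
proof -
  obtain q where q: "p = [:- (z + c), 1:] ^ order (z + c) p * q" "\<not> [:- (z + c), 1:] dvd q"
    using order_decomp[OF assms] by blast
  define m where "m = order (z + c) p"
  have "pcompose p [:c, 1:] = pcompose [:- (z + c), 1:] [:c, 1:] ^ m * pcompose q [:c, 1:]"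
    using q(1) unfolding m_def[symmetric] by (metis pcompose_mult pcompose_power)
  also have "pcompose [:- (z + c), 1:] [:c, 1:] = [:- z, 1:]"
    by (simp add: pcompose_pCons)
  finally have eq: "pcompose p [:c, 1:] = [:- z, 1:] ^ m * pcompose q [:c, 1:]" .
  have nz: "poly (pcompose q [:c, 1:]) z \<noteq> 0"
    using q(2) by (simp add: poly_pcompose poly_eq_0_iff_dvd add.commute)
  then have "order z (pcompose q [:c, 1:]) = 0" by (rule order_0I)
  moreover have "pcompose q [:c, 1:] \<noteq> 0" using nz by auto
  ultimately show ?thesis
    unfolding eq by (subst order_mult) (auto simp: order_power_n_n m_def)
qed

text \<open>The characteristic polynomial of A - c at z is that of A at z + c, and this substitution
  moves every root by - c without changing its order.\<close>

lemma eigvals_diff_scaled_identity: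
  "eigvals (A - c *\<^sub>R mat 1) = image_mset (\<lambda>z. z - of_real c) (eigvals A)"
proof -
  have "charpoly (A - c *\<^sub>R mat 1) = pcompose (charpoly A) [:of_real c, 1:]"
  proof -
    have "pcompose (charpoly A) [:of_real c, 1:] = det (map_matrix (\<lambda>p. pcompose p [:of_real c, 1:])
      (mat [:0, 1:] - (\<chi> i j. [:complex_of_real (A $ i $ j):])))"
      unfolding charpoly_def by (rule det_ring_hom) (auto simp: pcompose_add pcompose_mult pcompose_1)
    also have "map_matrix (\<lambda>p. pcompose p [:of_real c, 1:])
        (mat [:0, 1:] - (\<chi> i j. [:complex_of_real (A $ i $ j):]))
      = mat [:0, 1:] - (\<chi> i j. [:complex_of_real ((A - c *\<^sub>R mat 1) $ i $ j):])"
      by (simp add: vec_eq_iff mat_def pcompose_diff pcompose_pCons)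
    finally show ?thesis by (simp add: charpoly_def)
  qed
  moreover have "proots (pcompose p [:of_real c, 1:]) = image_mset (\<lambda>z. z - of_real c) (proots p)"
    if "p \<noteq> 0" for p :: "complex poly"
  proof (rule multiset_eqI)
    fix z :: complex
    have cnt: "count (image_mset (\<lambda>z. z - of_real c) M) z = count M (z + of_real c)" for M
      by (induction M) (auto simp: algebra_simps)
    have "pcompose p [:of_real c, 1:] \<noteq> 0" using that by (simp add: pcompose_eq_0_iff)
    then have "count (proots (pcompose p [:of_real c, 1:])) z = count (proots p) (z + of_real c)"
      using that by (simp add: order_pcompose_linear)
    then show "count (proots (pcompose p [:of_real c, 1:])) z
      = count (image_mset (\<lambda>z. z - of_real c) (proots p)) z" by (simp add: cnt)
  qed
  ultimately show ?thesis by (simp add: eigvals_def charpoly_nonzero)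
qed

section \<open>Eigenvectors of a complex-linear operator inside an invariant set\<close>

locale complex_operator = vector_space scale
  for scale :: "complex \<Rightarrow> 'v::ab_group_add \<Rightarrow> 'v" (infixr "*c" 75) +
  fixes f :: "'v \<Rightarrow> 'v"
  assumes f_add: "f (x + y) = f x + f y"
    and f_scale: "f (c *c x) = c *c f x"
begin

lemma f_0 [simp]: "f 0 = 0"
  using f_add[of 0 0] by simp

definition poly_apply :: "complex poly \<Rightarrow> 'v \<Rightarrow> 'v" where
  "poly_apply p = fold_coeffs (\<lambda>a g x. a *c x + f (g x)) p (\<lambda>_. 0)"

lemma poly_apply_0 [simp]: "poly_apply 0 x = 0"
  by (simp add: poly_apply_def)

lemma poly_apply_pCons [simp]: "poly_apply (pCons a p) x = a *c x + f (poly_apply p x)"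
  by (cases "p = 0 \<and> a = 0") (auto simp: poly_apply_def)

lemma poly_apply_add: "poly_apply (p + q) x = poly_apply p x + poly_apply q x"
  by (induction p q rule: poly_induct2) (simp_all add: f_add scale_left_distrib add_ac)

lemma poly_apply_smult: "poly_apply (smult c p) x = c *c poly_apply p x"
  by (induction p) (simp_all add: f_scale scale_right_distrib)

lemma poly_apply_linear_factor:
  "poly_apply ([:- l, 1:] * q) x = poly_apply q (f x - l *c x)"
proof -
  have comm: "poly_apply q (f y) = f (poly_apply q y)" for y
    by (induction q) (simp_all add: f_add f_scale)
  have "poly_apply q (y + z) = poly_apply q y + poly_apply q z" for y z
    by (induction q) (simp_all add: f_add scale_right_distrib)
  moreover have "poly_apply q (c *c y) = c *c poly_apply q y" for c y
    by (induction q) (simp_all add: f_scale scale_right_distrib mult.commute)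
  moreover have "f x - l *c x = f x + (- l) *c x" by simp
  moreover have "[:- l, 1:] * q = smult (- l) q + pCons 0 q" by simp
  ultimately show ?thesis
    by (simp only: poly_apply_add poly_apply_smult poly_apply_pCons comm) simp
qed

lemma poly_apply_monom: "poly_apply (monom c n) x = c *c ((f ^^ n) x)"
  by (induction n) (simp_all add: monom_Suc monom_0 f_scale)

lemma poly_apply_sum: "poly_apply (sum g I) x = (\<Sum>i\<in>I. poly_apply (g i) x)"
  by (induction I rule: infinite_finite_induct) (simp_all add: poly_apply_add)

text \<open>Peel linear factors off an annihilating polynomial. Either x is already an eigenvector
  for the root l, or f x - l x is a nonzero vector, still in \<open>E\<close>, that a polynomial of
  smaller degree annihilates.\<close>

lemma eigenvector_in_invariant_set:
  assumes "p \<noteq> 0" "poly_apply p x = 0" "x \<noteq> 0" "x \<in> E"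
    and inv: "\<And>c y. y \<in> E \<Longrightarrow> f y - c *c y \<in> E"
  shows "\<exists>y c. y \<in> E \<and> y \<noteq> 0 \<and> f y = c *c y"
  using assms(1-4)
proof (induction "degree p" arbitrary: p x)
  case 0
  then obtain a where "p = [:a:]" using degree_eq_zeroE by metis
  then show ?case using 0 by simp
next
  case (Suc d)
  obtain l where "poly p l = 0"
    using fundamental_theorem_of_algebra[of p] Suc.hyps(2) by (auto simp: constant_degree)
  then obtain q where q: "p = [:- l, 1:] * q" using poly_eq_0_iff_dvd by blast
  then have "q \<noteq> 0" "degree q = d" using Suc by (auto simp: degree_mult_eq simp del: mult_pCons_left)
  show ?case
  proof (cases "f x - l *c x = 0")
    case True
    then show ?thesis using Suc.prems by auto
  next
    case False
    then show ?thesis using Suc.hyps(1)[of q "f x - l *c x"] \<open>q \<noteq> 0\<close> \<open>degree q = d\<close> Suc.prems inv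
      by (simp add: q poly_apply_linear_factor del: mult_pCons_left)
  qed
qed

end

text \<open>Dependence of a set forgets repetitions, hence the separate case of a non-injective
  family, settled by the coefficients 1 and - 1 at two equal members.\<close>

lemma linear_dependence_sequence:
  fixes g :: "nat \<Rightarrow> 'v::euclidean_space"
  shows "\<exists>u. (\<exists>i\<le>DIM('v). u i \<noteq> (0::real)) \<and> (\<Sum>i\<le>DIM('v). u i *\<^sub>R g i) = 0"
proof (cases "inj_on g {..DIM('v)}")
  case False
  then obtain i j where ij: "i \<le> DIM('v)" "j \<le> DIM('v)" "i \<noteq> j" "g i = g j" by (auto simp: inj_on_def)
  define u where "u k = (if k = i then 1 else if k = j then - 1 else (0::real))" for k
  have "u k *\<^sub>R g k = (if k = i then g i else 0) + (if k = j then - g i else 0)" for k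
    using ij by (auto simp: u_def)
  then have "(\<Sum>k\<le>DIM('v). u k *\<^sub>R g k) = 0"
    using ij by (simp add: sum.distrib)
  moreover have "u i \<noteq> 0" by (simp add: u_def)
  ultimately show ?thesis using ij by blast
next
  case True
  then have "card (g ` {..DIM('v)}) > DIM('v)" by (simp add: card_image)
  then have "dependent (g ` {..DIM('v)})" using independent_bound by fastforce
  then obtain u where u: "\<exists>v\<in>g ` {..DIM('v)}. u v \<noteq> 0" "(\<Sum>v\<in>g ` {..DIM('v)}. u v *\<^sub>R v) = 0"
    using dependent_finite[of "g ` {..DIM('v)}"] by auto
  then show ?thesis
    by (intro exI[of _ "u \<circ> g"]) (auto simp: sum.reindex[OF True])
qed

text \<open>One more iterate of f at x than the real dimension makes the iterates dependent over the
  reals; the coefficients of the relation are those of the polynomial.\<close>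

lemma annihilating_poly_exists:
  fixes scale :: "complex \<Rightarrow> 'v::euclidean_space \<Rightarrow> 'v"
  assumes "complex_operator scale f" and real: "\<And>r x. scale (of_real r) x = r *\<^sub>R x"
  shows "\<exists>p. p \<noteq> 0 \<and> complex_operator.poly_apply scale f p x = 0"
proof -
  interpret complex_operator scale f by fact
  obtain u i where u: "i \<le> DIM('v)" "u i \<noteq> (0::real)" "(\<Sum>i\<le>DIM('v). u i *\<^sub>R (f ^^ i) x) = 0"
    using linear_dependence_sequence[of "\<lambda>i. (f ^^ i) x"] by blast
  define p where "p = (\<Sum>i\<le>DIM('v). monom (complex_of_real (u i)) i)"
  have "coeff p i = of_real (u i)"
    using u(1) by (simp add: p_def coeff_sum)
  then have "p \<noteq> 0" using u(2) by auto
  moreover have "poly_apply p x = 0"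
    using u(3) by (simp add: p_def poly_apply_sum poly_apply_monom real)
  ultimately show ?thesis by blast
qed

definition cscale :: "complex \<Rightarrow> complex^'n^'m \<Rightarrow> complex^'n^'m" where
  "cscale c = map_matrix ((*) c)"

lemma complex_operator_matrix_mult: "complex_operator cscale ((**) C)"
proof
qed (auto simp: cscale_def vec_eq_iff algebra_simps matrix_matrix_mult_def sum.distrib sum_distrib_left)

text \<open>The operator acts on whole matrices because the intended \<open>E\<close> is the
  solution set of a Lyapunov equation, which left multiplication by the coefficient matrix
  preserves.\<close>

lemma matrix_mult_eigenvector_exists:
  fixes C :: "complex^'n^'n" and Z :: "complex^'n^'n"
  assumes "Z \<in> E" "Z \<noteq> 0" and inv: "\<And>c Y. Y \<in> E \<Longrightarrow> C ** Y - cscale c Y \<in> E"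
  obtains Y c where "Y \<in> E" "Y \<noteq> 0" "C ** Y = cscale c Y"
proof -
  have real: "cscale (of_real r) Y = r *\<^sub>R Y" for r and Y :: "complex^'n^'n"
    unfolding vec_eq_iff vector_scaleR_component by (simp add: cscale_def scaleR_conv_of_real)
  obtain p where "p \<noteq> 0" "complex_operator.poly_apply cscale ((**) C) p Z = 0"
    using annihilating_poly_exists[OF complex_operator_matrix_mult real] by blast
  then show ?thesis
    using complex_operator.eigenvector_in_invariant_set[OF complex_operator_matrix_mult _ _ assms(2,1) inv] that
    by blast
qed

lemma eigval_of_matrix_eq:
  fixes A :: "real^'n^'n"
  assumes "cmat A ** Y = cscale c Y" "(Y :: complex^'n^'n) \<noteq> 0"
  shows "c \<in># eigvals A"
proof -
  obtain i j where ij: "Y $ i $ j \<noteq> 0" using assms(2) by (auto simp: vec_eq_iff)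
  have "cmat A *v column j Y = c *s column j Y"
    using assms(1) by (simp add: vec_eq_iff cscale_def column_def matrix_matrix_mult_def matrix_vector_mult_def)
  moreover have "column j Y \<noteq> 0" using ij by (auto simp: vec_eq_iff column_def)
  ultimately show ?thesis by (auto simp: eigvals_iff)
qed

lemma eigvals_nonempty: "eigvals (A :: real^'n^'n) \<noteq> {#}"
proof -
  have "(mat 1 :: complex^'n^'n) \<noteq> 0" by (metis det_0 det_I mat_0 zero_neq_one)
  then obtain Y :: "complex^'n^'n" and c where "Y \<noteq> 0" "cmat A ** Y = cscale c Y"
    using matrix_mult_eigenvector_exists[of "mat 1" UNIV "cmat A"] by blast
  then show ?thesis using eigval_of_matrix_eq by fastforce
qed

section \<open>Stability and injectivity of the Lyapunov operator\<close>

definition weakly_stable :: "real^'n^'n \<Rightarrow> bool" where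
  "weakly_stable A \<longleftrightarrow> (\<forall>z \<in># eigvals A. Re z \<le> 0)"

lemma weakly_stable_transpose: "weakly_stable (transpose A) \<longleftrightarrow> weakly_stable A"
  by (simp add: weakly_stable_def eigvals_transpose)

lemma weakly_stable_similar:
  fixes S T :: "real^'n^'n"
  shows "S ** T = mat 1 \<Longrightarrow> weakly_stable (S ** A ** T) \<longleftrightarrow> weakly_stable A"
  by (simp add: weakly_stable_def eigvals_similar)

text \<open>An eigenvector \<open>Y\<close> of \<open>W \<mapsto> A W\<close> inside the solution space gives eigenvalues
  \<open>c\<close> and \<open>\<gamma> - c\<close> of \<open>A\<close>, which cannot both lie in the closed left half-plane.\<close>
lemma lyapunov_injective:
  fixes A W :: "real^'n^'n"
  assumes "weakly_stable A" "\<gamma> > 0" and W: "\<gamma> *\<^sub>R W - A ** W - W ** transpose A = 0"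
  shows "W = 0"
proof (rule ccontr)
  assume "W \<noteq> 0"
  define C where "C = cmat A"
  define E where "E = {Y. cscale (of_real \<gamma>) Y = C ** Y + Y ** transpose C}"
  have "cmat W \<noteq> 0" using \<open>W \<noteq> 0\<close> by (auto simp: vec_eq_iff)
  moreover have "cmat W \<in> E"
  proof -
    have "\<gamma> *\<^sub>R W = A ** W + W ** transpose A" using W by (simp add: algebra_simps)
    then have "cmat (\<gamma> *\<^sub>R W) = cmat (A ** W + W ** transpose A)" by simp
    then show ?thesis by (simp add: E_def C_def cscale_def vec_eq_iff
      cmat_mult[symmetric] cmat_transpose[symmetric])
  qed
  moreover have "C ** Y - cscale c Y \<in> E" if "Y \<in> E" for c Y
  proof -
    interpret complex_operator cscale "(**) C :: complex^'n^'n \<Rightarrow> complex^'n^'n"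
      by (rule complex_operator_matrix_mult)
    have sc: "cscale c Y ** Z = cscale c (Y ** Z)" for c and Y Z :: "complex^'n^'n"
      by (auto simp: cscale_def vec_eq_iff matrix_matrix_mult_def sum_distrib_left mult.assoc)
    have "cscale (of_real \<gamma>) (C ** Y) = C ** (C ** Y) + C ** Y ** transpose C"
      using that by (simp add: E_def f_scale[symmetric] f_add matrix_mul_assoc)
    moreover have "cscale (of_real \<gamma>) (cscale c Y) = C ** cscale c Y + cscale c Y ** transpose C"
    proof -
      have "cscale (of_real \<gamma>) (cscale c Y) = cscale c (cscale (of_real \<gamma>) Y)"
        by (rule scale_left_commute)
      also have "\<dots> = cscale c (C ** Y + Y ** transpose C)" using that by (simp add: E_def)
      finally show ?thesis by (simp add: f_scale sc scale_right_distrib)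
    qed
    ultimately show ?thesis
      by (simp add: E_def scale_right_diff_distrib matrix_diff_ldistrib matrix_diff_rdistrib)
  qed
  ultimately obtain Y c where Y: "Y \<in> E" "Y \<noteq> 0" "C ** Y = cscale c Y"
    using matrix_mult_eigenvector_exists[of "cmat W" E C] by blast
  have c: "c \<in># eigvals A" using Y eigval_of_matrix_eq by (simp add: C_def)
  have "Y ** transpose C = cscale (of_real \<gamma> - c) Y"
    using Y(1,3) by (simp add: E_def cscale_def vec_eq_iff algebra_simps)
  then have "transpose (Y ** transpose C) = transpose (cscale (of_real \<gamma> - c) Y)" by simp
  moreover have "transpose (cscale (of_real \<gamma> - c) Y) = cscale (of_real \<gamma> - c) (transpose Y)"
    by (simp add: cscale_def vec_eq_iff transpose_def)
  ultimately have "cmat A ** transpose Y = cscale (of_real \<gamma> - c) (transpose Y)"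
    by (simp add: matrix_transpose_mul C_def)
  moreover have "transpose Y \<noteq> 0" using Y(2) by (metis transpose_0 transpose_transpose)
  ultimately have "of_real \<gamma> - c \<in># eigvals A" by (rule eigval_of_matrix_eq)
  then have "Re (of_real \<gamma> - c) \<le> 0" "Re c \<le> 0"
    using c assms(1) by (auto simp: weakly_stable_def)
  then show False using assms(2) by simp
qed

section \<open>Rational functions on the positive half-line\<close>

text \<open>One pair of polynomials serves the whole half-line and the denominator has no zero
  there, so differentiability at every positive point follows. Values at other arguments are left
  free, since the solutions are determined for positive parameters.\<close>

definition rational_pos :: "(real \<Rightarrow> real) \<Rightarrow> bool" where
  "rational_pos f \<longleftrightarrow> (\<exists>p q. \<forall>\<gamma>>0. poly q \<gamma> \<noteq> 0 \<and> f \<gamma> = poly p \<gamma> / poly q \<gamma>)"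

lemma rational_posI:
  "(\<And>\<gamma>. \<gamma> > 0 \<Longrightarrow> poly q \<gamma> \<noteq> 0 \<and> f \<gamma> = poly p \<gamma> / poly q \<gamma>) \<Longrightarrow> rational_pos f"
  unfolding rational_pos_def by blast

lemma rational_pos_cong:
  "(\<And>\<gamma>. \<gamma> > 0 \<Longrightarrow> f \<gamma> = g \<gamma>) \<Longrightarrow> rational_pos f \<longleftrightarrow> rational_pos g"
  unfolding rational_pos_def by simp

lemma rational_pos_const [simp]: "rational_pos (\<lambda>_. c)"
  by (rule rational_posI[of 1 _ "[:c:]"]) simp

lemma rational_pos_ident [simp]: "rational_pos (\<lambda>\<gamma>. \<gamma>)"
  by (rule rational_posI[of 1 _ "[:0, 1:]"]) simp

lemma rational_pos_add:
  assumes "rational_pos f" "rational_pos g" shows "rational_pos (\<lambda>\<gamma>. f \<gamma> + g \<gamma>)"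
proof -
  from assms obtain p q p' q' where "\<forall>\<gamma>>0. poly q \<gamma> \<noteq> 0 \<and> f \<gamma> = poly p \<gamma> / poly q \<gamma>"
    "\<forall>\<gamma>>0. poly q' \<gamma> \<noteq> 0 \<and> g \<gamma> = poly p' \<gamma> / poly q' \<gamma>"
    unfolding rational_pos_def by blast
  then show ?thesis
    by (intro rational_posI[of "q * q'" _ "p * q' + p' * q"]) (simp add: add_frac_eq)
qed

lemma rational_pos_mult:
  assumes "rational_pos f" "rational_pos g" shows "rational_pos (\<lambda>\<gamma>. f \<gamma> * g \<gamma>)"
proof -
  from assms obtain p q p' q' where "\<forall>\<gamma>>0. poly q \<gamma> \<noteq> 0 \<and> f \<gamma> = poly p \<gamma> / poly q \<gamma>"
    "\<forall>\<gamma>>0. poly q' \<gamma> \<noteq> 0 \<and> g \<gamma> = poly p' \<gamma> / poly q' \<gamma>"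
    unfolding rational_pos_def by blast
  then show ?thesis
    by (intro rational_posI[of "q * q'" _ "p * p'"]) simp
qed

lemma rational_pos_inverse:
  assumes "rational_pos f" "\<And>\<gamma>. \<gamma> > 0 \<Longrightarrow> f \<gamma> \<noteq> 0" shows "rational_pos (\<lambda>\<gamma>. inverse (f \<gamma>))"
proof -
  from assms(1) obtain p q where "\<forall>\<gamma>>0. poly q \<gamma> \<noteq> 0 \<and> f \<gamma> = poly p \<gamma> / poly q \<gamma>"
    unfolding rational_pos_def by blast
  then show ?thesis using assms(2)
    by (intro rational_posI[of p _ q]) fastforce
qed

lemma rational_pos_divide:
  assumes "rational_pos f" "rational_pos g" "\<And>\<gamma>. \<gamma> > 0 \<Longrightarrow> g \<gamma> \<noteq> 0"
  shows "rational_pos (\<lambda>\<gamma>. f \<gamma> / g \<gamma>)"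
  using rational_pos_mult[OF assms(1) rational_pos_inverse[OF assms(2,3)]]
  by (simp add: divide_inverse)

lemma rational_pos_minus: "rational_pos f \<Longrightarrow> rational_pos (\<lambda>\<gamma>. - f \<gamma>)"
  using rational_pos_mult[OF rational_pos_const[of "-1"]] by simp

lemma rational_pos_diff:
  "rational_pos f \<Longrightarrow> rational_pos g \<Longrightarrow> rational_pos (\<lambda>\<gamma>. f \<gamma> - g \<gamma>)"
  using rational_pos_add[OF _ rational_pos_minus] by simp

lemma rational_pos_sum: "(\<And>i. i \<in> I \<Longrightarrow> rational_pos (f i)) \<Longrightarrow> rational_pos (\<lambda>\<gamma>. \<Sum>i\<in>I. f i \<gamma>)"
  by (induction I rule: infinite_finite_induct) (auto intro: rational_pos_add)

lemma rational_pos_prod: "(\<And>i. i \<in> I \<Longrightarrow> rational_pos (f i)) \<Longrightarrow> rational_pos (\<lambda>\<gamma>. \<Prod>i\<in>I. f i \<gamma>)"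
  by (induction I rule: infinite_finite_induct) (auto intro: rational_pos_mult)

lemma rational_pos_has_derivative:
  assumes "rational_pos f" obtains f' where "\<And>\<gamma>. \<gamma> > 0 \<Longrightarrow> (f has_real_derivative f' \<gamma>) (at \<gamma>)"
proof -
  from assms obtain p q where pq: "\<And>\<gamma>. \<gamma> > 0 \<Longrightarrow> poly q \<gamma> \<noteq> 0" "\<And>\<gamma>. \<gamma> > 0 \<Longrightarrow> f \<gamma> = poly p \<gamma> / poly q \<gamma>"
    unfolding rational_pos_def by blast
  show ?thesis
  proof
    fix \<gamma> :: real assume \<gamma>: "\<gamma> > 0"
    have "((\<lambda>\<gamma>. poly p \<gamma> / poly q \<gamma>) has_real_derivative
        (poly (pderiv p) \<gamma> * poly q \<gamma> - poly p \<gamma> * poly (pderiv q) \<gamma>) / (poly q \<gamma> * poly q \<gamma>)) (at \<gamma>)"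
      using pq(1)[OF \<gamma>] by (intro DERIV_divide poly_DERIV)
    then show "(f has_real_derivative
        (poly (pderiv p) \<gamma> * poly q \<gamma> - poly p \<gamma> * poly (pderiv q) \<gamma>) / (poly q \<gamma> * poly q \<gamma>)) (at \<gamma>)"
      by (rule has_field_derivative_transform_within_open[where S = "{0<..}"]) (simp_all add: \<gamma> pq(2))
  qed
qed

lemma rational_pos_det:
  fixes F :: "real \<Rightarrow> real^'n^'n"
  assumes "\<And>i j. rational_pos (\<lambda>\<gamma>. F \<gamma> $ i $ j)" shows "rational_pos (\<lambda>\<gamma>. det (F \<gamma>))"
  unfolding det_def
  by (intro rational_pos_sum rational_pos_mult rational_pos_prod assms rational_pos_const)

lemma rational_matrix_on_iff:
  "rational_matrix_on {0<..} F \<longleftrightarrow> (\<forall>i j. rational_pos (\<lambda>\<gamma>. F \<gamma> $ i $ j))"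
  by (simp add: rational_matrix_on_def rational_pos_def Ball_def)

lemma rational_linear_solution:
  fixes F :: "real \<Rightarrow> real^'n^'n" and b x :: "real \<Rightarrow> real^'n"
  assumes F: "\<And>i j. rational_pos (\<lambda>\<gamma>. F \<gamma> $ i $ j)" and b: "\<And>i. rational_pos (\<lambda>\<gamma>. b \<gamma> $ i)"
    and det: "\<And>\<gamma>. \<gamma> > 0 \<Longrightarrow> det (F \<gamma>) \<noteq> 0" and x: "\<And>\<gamma>. \<gamma> > 0 \<Longrightarrow> F \<gamma> *v x \<gamma> = b \<gamma>"
  shows "rational_pos (\<lambda>\<gamma>. x \<gamma> $ k)"
proof -
  have "x \<gamma> $ k = det (\<chi> i j. if j = k then b \<gamma> $ i else F \<gamma> $ i $ j) / det (F \<gamma>)" if "\<gamma> > 0" for \<gamma>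
    using x[OF that] by (simp add: cramer[OF det[OF that]])
  note eq = this
  have rat: "rational_pos (\<lambda>\<gamma>. det (\<chi> i j. if j = k then b \<gamma> $ i else F \<gamma> $ i $ j) / det (F \<gamma>))"
  proof (intro rational_pos_divide rational_pos_det det F)
    show "rational_pos (\<lambda>\<gamma>. (\<chi> i j. if j = k then b \<gamma> $ i else F \<gamma> $ i $ j) $ i $ j)" for i j
      by (cases "j = k") (simp_all add: F b)
  qed
  show ?thesis
    by (subst rational_pos_cong[OF eq]) (simp_all add: rat)
qed

lemma rational_matrix_diff:
  "rational_matrix_on {0<..} F \<Longrightarrow> rational_matrix_on {0<..} G \<Longrightarrow> rational_matrix_on {0<..} (\<lambda>\<gamma>. F \<gamma> - G \<gamma>)"
  by (simp add: rational_matrix_on_iff rational_pos_diff)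

lemma rational_matrix_mult:
  "rational_matrix_on {0<..} F \<Longrightarrow> rational_matrix_on {0<..} G \<Longrightarrow> rational_matrix_on {0<..} (\<lambda>\<gamma>. F \<gamma> ** G \<gamma>)"
  by (simp add: rational_matrix_on_iff matrix_matrix_mult_def rational_pos_mult rational_pos_sum)

lemma rational_matrix_scaleR:
  "rational_pos f \<Longrightarrow> rational_matrix_on {0<..} G \<Longrightarrow> rational_matrix_on {0<..} (\<lambda>\<gamma>. f \<gamma> *\<^sub>R G \<gamma>)"
  by (simp add: rational_matrix_on_iff rational_pos_mult)

lemma rational_matrix_const [simp]: "rational_matrix_on {0<..} (\<lambda>_. C)"
  by (simp add: rational_matrix_on_iff)

text \<open>Each column of the inverse solves a linear system with a unit vector on the right, so
  Cramer's rule applies.\<close>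

lemma rational_matrix_inverse:
  fixes F G :: "real \<Rightarrow> real^'n^'n"
  assumes F: "rational_matrix_on {0<..} F" and FG: "\<And>\<gamma>. \<gamma> > 0 \<Longrightarrow> F \<gamma> ** G \<gamma> = mat 1"
  shows "rational_matrix_on {0<..} G"
proof -
  have "rational_pos (\<lambda>\<gamma>. column j (G \<gamma>) $ i)" for i j
  proof (rule rational_linear_solution[where b = "\<lambda>_. column j (mat 1)"])
    show "F \<gamma> *v column j (G \<gamma>) = column j (mat 1)" if "\<gamma> > 0" for \<gamma>
      unfolding FG[OF that, symmetric]
      by (simp add: vec_eq_iff column_def matrix_vector_mult_def matrix_matrix_mult_def)
    show "det (F \<gamma>) \<noteq> 0" if "\<gamma> > 0" for \<gamma>
      using arg_cong[OF FG[OF that], of det] by (auto simp: det_mul)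
  qed (use F in \<open>simp_all add: rational_matrix_on_iff\<close>)
  then show ?thesis by (simp add: rational_matrix_on_iff column_def)
qed

lemma rational_matrix_has_derivative:
  fixes F :: "real \<Rightarrow> real^'n^'n"
  assumes "rational_matrix_on {0<..} F"
  obtains F' where "\<And>\<gamma>. \<gamma> > 0 \<Longrightarrow> (F has_vector_derivative F' \<gamma>) (at \<gamma>)"
proof -
  define f' where "f' i j = deriv (\<lambda>\<gamma>. F \<gamma> $ i $ j)" for i j
  have f': "((\<lambda>\<gamma>. F \<gamma> $ i $ j) has_real_derivative f' i j \<gamma>) (at \<gamma>)" if "\<gamma> > 0" for i j \<gamma>
  proof -
    have "rational_pos (\<lambda>\<gamma>. F \<gamma> $ i $ j)" using assms by (simp add: rational_matrix_on_iff)
    then obtain g where "((\<lambda>\<gamma>. F \<gamma> $ i $ j) has_real_derivative g \<gamma>) (at \<gamma>)"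
      using \<open>\<gamma> > 0\<close> rational_pos_has_derivative by metis
    then show ?thesis using DERIV_imp_deriv unfolding f'_def by fastforce
  qed
  have "(F has_vector_derivative (\<chi> i j. f' i j \<gamma>)) (at \<gamma>)" if "\<gamma> > 0" for \<gamma>
    unfolding has_vector_derivative_def
  proof (subst has_derivative_componentwise_within, rule ballI)
    fix b :: "real^'n^'n" assume "b \<in> Basis"
    then obtain i j where "b = axis i (axis j 1)" by (auto simp: Basis_vec_def)
    then have dot: "M \<bullet> b = M $ i $ j" for M by (simp add: inner_axis)
    show "((\<lambda>x. F x \<bullet> b) has_derivative (\<lambda>x. (x *\<^sub>R (\<chi> i j. f' i j \<gamma>)) \<bullet> b)) (at \<gamma>)"
      using f'[OF that, of i j]
      unfolding dot has_field_derivative_def by (simp add: mult.commute[of _ "f' i j \<gamma>"])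
  qed
  then show thesis by (rule that)
qed

section \<open>The largest eigenvalue of a symmetric matrix\<close>

lemma norm_matrix_vector_le: "norm ((M::real^'n^'m) *v x) \<le> norm M * norm x"
proof (rule power2_le_imp_le)
  have "(norm (M *v x))^2 = (\<Sum>i\<in>UNIV. (M $ i \<bullet> x)^2)"
    unfolding power2_norm_eq_inner inner_vec_def[of "M *v x"]
    by (simp add: matrix_vector_mul_component power2_eq_square)
  also have "\<dots> \<le> (\<Sum>i\<in>UNIV. (norm (M $ i))^2 * (norm x)^2)"
    using Cauchy_Schwarz_ineq[of "M $ i" x for i] by (intro sum_mono) (simp add: power2_norm_eq_inner)
  also have "\<dots> = (norm M * norm x)^2"
    by (simp add: sum_distrib_right power_mult_distrib power2_norm_eq_inner inner_vec_def[of M])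
  finally show "(norm (M *v x))^2 \<le> (norm M * norm x)^2" .
qed simp

lemma quadratic_form_le_norm: "x \<bullet> (M *v x) \<le> norm (M::real^'n^'n) * (x \<bullet> x)"
proof -
  have "x \<bullet> (M *v x) \<le> norm x * norm (M *v x)" by (rule norm_cauchy_schwarz)
  also have "\<dots> \<le> norm x * (norm M * norm x)" by (intro mult_left_mono norm_matrix_vector_le) simp
  finally show ?thesis by (simp add: power2_norm_eq_inner[symmetric] power2_eq_square mult_ac)
qed

text \<open>Split a complex eigenvector into u + i v. In u . M u + v . M v the terms with Im z
  cancel, leaving Re z times u . u + v . v.\<close>

lemma eigval_re_le:
  fixes M :: "real^'n^'n"
  assumes M: "transpose M = M" and le: "\<And>y. y \<bullet> (M *v y) \<le> m * (y \<bullet> y)" and z: "z \<in># eigvals M"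
  shows "Re z \<le> m"
proof -
  obtain y where y: "y \<noteq> 0" "cmat M *v y = z *s y" using z by (auto simp: eigvals_iff)
  define u v where "u = (\<chi> i. Re (y $ i))" and "v = (\<chi> i. Im (y $ i))"
  have comp: "(\<Sum>j\<in>UNIV. of_real (M $ i $ j) * y $ j) = z * y $ i" for i
    using y(2) by (simp add: vec_eq_iff matrix_vector_mult_def)
  have "M *v u = Re z *\<^sub>R u - Im z *\<^sub>R v" "M *v v = Im z *\<^sub>R u + Re z *\<^sub>R v"
    using arg_cong[OF comp, of Re] arg_cong[OF comp, of Im]
    by (simp_all add: vec_eq_iff matrix_vector_mult_def u_def v_def)
  then have "u \<bullet> (M *v u) + v \<bullet> (M *v v) = Re z * (u \<bullet> u + v \<bullet> v)"
    by (simp add: inner_diff_right inner_add_right inner_commute[of v u] distrib_left)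
  then have "Re z * (u \<bullet> u + v \<bullet> v) \<le> m * (u \<bullet> u + v \<bullet> v)"
    using le[of u] le[of v] by (simp add: distrib_left)
  moreover have "u \<noteq> 0 \<or> v \<noteq> 0"
    using y(1) by (auto simp: u_def v_def vec_eq_iff complex_eq_iff)
  then have "u \<bullet> u + v \<bullet> v > 0"
    using inner_ge_zero[of u] inner_ge_zero[of v] inner_gt_zero_iff[of u] inner_gt_zero_iff[of v] by linarith
  ultimately show ?thesis by simp
qed

lemma eigvalI_real:
  fixes M :: "real^'n^'n"
  assumes "M *v x = m *\<^sub>R x" "x \<noteq> 0" shows "of_real m \<in># eigvals M"
proof -
  define y where "y = (\<chi> i. complex_of_real (x $ i))"
  have "(\<Sum>j\<in>UNIV. M $ i $ j * x $ j) = m * x $ i" for i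
    using assms(1) by (simp add: vec_eq_iff matrix_vector_mult_def)
  then have "cmat M *v y = of_real m *s y"
    by (simp add: vec_eq_iff matrix_vector_mult_def y_def flip: of_real_mult of_real_sum)
  moreover have "y \<noteq> 0" using assms(2) by (auto simp: y_def vec_eq_iff)
  ultimately show ?thesis by (auto simp: eigvals_iff)
qed

text \<open>This links the definition through complex eigenvalues to the Rayleigh quotient: its
  maximum is an eigenvalue, and no eigenvalue has a larger real part.\<close>

lemma lambda_max_symmetric:
  fixes M :: "real^'n^'n"
  assumes M: "transpose M = M"
  obtains x where "norm x = 1" "M *v x = lambda_max M *\<^sub>R x" "\<And>y. y \<bullet> (M *v y) \<le> lambda_max M * (y \<bullet> y)"
proof -
  have "(UNIV :: (real^'n) set) \<noteq> {0}" by (metis UNIV_I singletonD zero_neq_one)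
  then obtain x m where x: "norm x = 1" "M *v x = m *\<^sub>R x" "\<And>y. y \<bullet> (M *v y) \<le> m * (y \<bullet> y)"
    using symmetric_max_eigenvector[OF M subspace_UNIV] by (metis UNIV_I)
  have "x \<noteq> 0" using x(1) by auto
  then have "of_real m \<in># eigvals M" using x eigvalI_real by blast
  then have "m \<in> Re ` set_mset (eigvals M)" by force
  then have "lambda_max M = m"
    unfolding lambda_max_def using eigval_re_le[OF M x(3)] by (intro Max_eqI) auto
  then show ?thesis using that x by blast
qed

text \<open>Evaluate both forms at a top eigenvector of \<open>M\<close>. With the roles exchanged
  as well, \<open>lambda_max\<close> is Lipschitz with constant 1 on symmetric matrices.\<close>

lemma lambda_max_le_add_norm:
  fixes M N :: "real^'n^'n"
  assumes "transpose M = M" "transpose N = N"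
  shows "lambda_max M \<le> lambda_max N + norm (M - N)"
proof -
  obtain x where x: "norm x = 1" "M *v x = lambda_max M *\<^sub>R x"
    using lambda_max_symmetric[OF assms(1)] by metis
  obtain le: "\<And>y. y \<bullet> (N *v y) \<le> lambda_max N * (y \<bullet> y)"
    using lambda_max_symmetric[OF assms(2)] by metis
  have xx: "x \<bullet> x = 1" using x(1) by (simp add: norm_eq_1)
  have "lambda_max M = x \<bullet> (M *v x)" by (simp add: x(2) xx)
  also have "\<dots> = x \<bullet> (N *v x) + x \<bullet> ((M - N) *v x)"
    by (simp add: matrix_vector_mult_diff_rdistrib inner_diff_right)
  also have "\<dots> \<le> lambda_max N + norm (M - N)"
    using le[of x] quadratic_form_le_norm[of x "M - N"] xx by simp
  finally show ?thesis .
qed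

lemma tendsto_lambda_max:
  fixes F :: "'b \<Rightarrow> real^'n^'n"
  assumes F: "(F \<longlongrightarrow> L) net" and sym: "eventually (\<lambda>s. transpose (F s) = F s) net" and L: "transpose L = L"
  shows "((\<lambda>s. lambda_max (F s)) \<longlongrightarrow> lambda_max L) net"
proof (rule tendsto_dist_iff[THEN iffD2], rule tendsto_sandwich[where f = "\<lambda>_. 0"])
  show "((\<lambda>s. norm (F s - L)) \<longlongrightarrow> 0) net" by (rule tendsto_norm_zero[OF LIM_zero[OF F]])
  show "eventually (\<lambda>s. dist (lambda_max (F s)) (lambda_max L) \<le> norm (F s - L)) net"
    using sym
  proof eventually_elim
    case (elim s)
    then show ?case using lambda_max_le_add_norm[OF elim L] lambda_max_le_add_norm[OF L elim]
      by (simp add: dist_real_def abs_le_iff norm_minus_commute)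
  qed
qed auto

section \<open>Lyapunov equations\<close>

definition lyap_op :: "real^'n^'n \<Rightarrow> real \<Rightarrow> real^'n^'n \<Rightarrow> real^'n^'n" where
  "lyap_op A \<gamma> W = \<gamma> *\<^sub>R W - A ** W - W ** transpose A"

lemma lyap_op_add: "lyap_op A \<gamma> (V + W) = lyap_op A \<gamma> V + lyap_op A \<gamma> W"
  by (simp add: lyap_op_def matrix_ring_simps algebra_simps)

lemma lyap_op_diff: "lyap_op A \<gamma> (V - W) = lyap_op A \<gamma> V - lyap_op A \<gamma> W"
  by (simp add: lyap_op_def matrix_ring_simps algebra_simps)

lemma lyap_op_scaleR: "lyap_op A \<gamma> (c *\<^sub>R W) = c *\<^sub>R lyap_op A \<gamma> W"
  by (simp add: lyap_op_def matrix_ring_simps algebra_simps)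

lemma lyap_op_transpose: "transpose (lyap_op A \<gamma> W) = lyap_op A \<gamma> (transpose W)"
  by (simp add: lyap_op_def transpose_distribs algebra_simps)

lemma lyap_op_eq_0:
  assumes "weakly_stable A" "\<gamma> > 0" "lyap_op A \<gamma> W = 0" shows "W = 0"
  using lyapunov_injective[OF assms(1,2)] assms(3) by (simp add: lyap_op_def)

lemma lyap_op_unique:
  assumes "weakly_stable A" "\<gamma> > 0" "lyap_op A \<gamma> V = lyap_op A \<gamma> W" shows "V = W"
  using lyap_op_eq_0[OF assms(1,2), of "V - W"] assms(3) by (simp add: lyap_op_diff)

lemma lyap_op_surj:
  fixes C :: "real^'n^'n"
  assumes "weakly_stable A" "\<gamma> > 0"
  obtains W where "lyap_op A \<gamma> W = C"
proof -
  have lin: "linear (lyap_op A \<gamma>)"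
    by (intro linearI) (auto simp: lyap_op_add lyap_op_scaleR)
  then have "inj (lyap_op A \<gamma>)"
    using lyap_op_unique[OF assms] by (auto simp: inj_def)
  then have "surj (lyap_op A \<gamma>)" using lin linear_injective_imp_surjective by blast
  then show thesis using that by (metis surjD)
qed

lemma lyap_op_symmetric:
  assumes "weakly_stable A" "\<gamma> > 0" "transpose (lyap_op A \<gamma> W) = lyap_op A \<gamma> W"
  shows "transpose W = W"
  using lyap_op_unique[OF assms(1,2), of "transpose W" W] assms(3) by (simp add: lyap_op_transpose)

definition lyap_sol :: "real^'n^'n \<Rightarrow> real \<Rightarrow> real^'n^'n \<Rightarrow> real^'n^'n" where
  "lyap_sol A \<gamma> C = (SOME W. lyap_op A \<gamma> W = C)"

lemma lyap_op_sol:
  assumes "weakly_stable A" "\<gamma> > 0" shows "lyap_op A \<gamma> (lyap_sol A \<gamma> C) = C"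
proof -
  obtain W where "lyap_op A \<gamma> W = C" using lyap_op_surj[OF assms] .
  then show ?thesis unfolding lyap_sol_def by (rule someI)
qed

lemma lyap_sol_eq:
  assumes "weakly_stable A" "\<gamma> > 0" "lyap_op A \<gamma> W = C" shows "lyap_sol A \<gamma> C = W"
  using lyap_op_unique[OF assms(1,2)] lyap_op_sol[OF assms(1,2)] assms(3) by metis

text \<open>Cramer's rule applied to the Kronecker-sum matrix of the Lyapunov operator.\<close>
lemma lyap_solution_rational:
  fixes A :: "real^'n^'n"
  assumes A: "weakly_stable A" and s: "rational_pos s" "\<And>\<gamma>. \<gamma> > 0 \<Longrightarrow> s \<gamma> > 0"
    and C: "rational_matrix_on {0<..} C"
    and W: "\<And>\<gamma>. \<gamma> > 0 \<Longrightarrow> lyap_op A (s \<gamma>) (W \<gamma>) = C \<gamma>"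
  shows "rational_matrix_on {0<..} W"
proof -
  define K :: "real \<Rightarrow> real^('n \<times> 'n)^('n \<times> 'n)" where
    "K \<gamma> = (\<chi> p q. (if p = q then s \<gamma> else 0) - (if snd p = snd q then A $ fst p $ fst q else 0)
        - (if fst p = fst q then A $ snd p $ snd q else 0))" for \<gamma>
  define vec :: "real^'n^'n \<Rightarrow> real^('n \<times> 'n)" where "vec M = (\<chi> p. M $ fst p $ snd p)" for M
  have Kvec: "K \<gamma> *v vec M = vec (lyap_op A (s \<gamma>) M)" for \<gamma> M
  proof -
    have "(\<Sum>q\<in>UNIV. K \<gamma> $ (i, j) $ q * vec M $ q) = lyap_op A (s \<gamma>) M $ i $ j" for i j
    proof -
      have a: "(\<Sum>q\<in>UNIV. (if (i, j) = q then s \<gamma> else 0) * vec M $ q) = s \<gamma> * M $ i $ j"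
        by (simp add: vec_def if_distrib if_distribR cong: if_cong)
      have b: "(\<Sum>q\<in>UNIV. (if j = snd q then A $ i $ fst q else 0) * vec M $ q) = (A ** M) $ i $ j"
        by (simp add: vec_def matrix_matrix_mult_def UNIV_Times_UNIV[symmetric] sum.cartesian_product'
            if_distrib if_distribR del: UNIV_Times_UNIV cong: if_cong)
      have c: "(\<Sum>q\<in>UNIV. (if i = fst q then A $ j $ snd q else 0) * vec M $ q) = (M ** transpose A) $ i $ j"
      proof -
        have "(\<Sum>q\<in>UNIV. (if i = fst q then A $ j $ snd q else 0) * vec M $ q)
          = (\<Sum>k\<in>UNIV. if i = k then \<Sum>l\<in>UNIV. A $ j $ l * M $ k $ l else 0)"
          unfolding UNIV_Times_UNIV[symmetric] sum.cartesian_product'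
          by (intro sum.cong) (auto simp: vec_def)
        then show ?thesis by (simp add: matrix_matrix_mult_def transpose_def mult.commute)
      qed
      show ?thesis
        using a b c by (simp add: K_def lyap_op_def left_diff_distrib sum_subtractf cong: if_cong)
    qed
    then show ?thesis by (simp add: vec_eq_iff matrix_vector_mult_def vec_def)
  qed
  have "rational_pos (\<lambda>\<gamma>. vec (W \<gamma>) $ p)" for p
  proof (rule rational_linear_solution)
    show "rational_pos (\<lambda>\<gamma>. K \<gamma> $ p $ q)" for p q
    proof -
      have "rational_pos (\<lambda>\<gamma>. if b then s \<gamma> else 0)" for b by (cases b) (simp_all add: s(1))
      then have "rational_pos (\<lambda>\<gamma>. (if p = q then s \<gamma> else 0) - c - d)" for c d
        by (intro rational_pos_diff rational_pos_const)
      then show ?thesis by (simp add: K_def)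
    qed
    show "rational_pos (\<lambda>\<gamma>. vec (C \<gamma>) $ p)" for p
      using C by (simp add: vec_def rational_matrix_on_iff)
    show "K \<gamma> *v vec (W \<gamma>) = vec (C \<gamma>)" if "\<gamma> > 0" for \<gamma>
      by (simp add: Kvec W that)
    show "det (K \<gamma>) \<noteq> 0" if "\<gamma> > 0" for \<gamma>
    proof -
      have "x = 0" if "K \<gamma> *v x = 0" for x
      proof -
        define M :: "real^'n^'n" where "M = (\<chi> i j. x $ (i, j))"
        have x: "x = vec M" by (simp add: vec_eq_iff vec_def M_def)
        then have "vec (lyap_op A (s \<gamma>) M) = 0" using that Kvec[of \<gamma> M] by simp
        then have "lyap_op A (s \<gamma>) M = 0" by (simp add: vec_eq_iff vec_def)
        then have "M = 0" using lyap_op_eq_0[OF A s(2)[OF \<open>\<gamma> > 0\<close>]] by blast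
        then show "x = 0" by (simp add: x vec_def vec_eq_iff)
      qed
      then have "\<exists>B. B ** K \<gamma> = mat 1" by (simp add: matrix_left_invertible_ker)
      then show ?thesis using invertible_left_inverse invertible_det_nz by blast
    qed
  qed
  then have "rational_pos (\<lambda>\<gamma>. vec (W \<gamma>) $ (i, j))" for i j by simp
  then show ?thesis by (simp add: vec_def rational_matrix_on_iff)
qed

lemma rational_matrix_isCont:
  assumes "rational_matrix_on {0<..} F" "\<gamma> > 0" shows "isCont F \<gamma>"
proof -
  obtain F' where "(F has_vector_derivative F') (at \<gamma>)"
    by (rule rational_matrix_has_derivative[OF assms(1)]) (use assms(2) in blast)
  then show ?thesis by (rule has_vector_derivative_continuous)
qed

lemma lyap_quadratic_form:
  assumes "transpose W = W"
  shows "x \<bullet> (lyap_op A \<gamma> W *v x) = \<gamma> * (x \<bullet> (W *v x)) - 2 * ((W *v x) \<bullet> (transpose A *v x))"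
proof -
  have "x \<bullet> (A *v (W *v x)) = (W *v x) \<bullet> (transpose A *v x)"
    unfolding dot_transpose[of x A] by (rule inner_commute)
  moreover have "x \<bullet> (W *v (transpose A *v x)) = (W *v x) \<bullet> (transpose A *v x)"
    by (simp add: dot_transpose[of x W] assms)
  ultimately show ?thesis
    by (simp add: lyap_op_def matrix_vector_mult_diff_rdistrib matrix_vector_scaleR_left
        matrix_vector_mul_assoc[symmetric] inner_diff_right)
qed

text \<open>The least eigenvalue \<open>m\<close> of the solution \<open>W\<close> satisfies
  \<open>m (\<gamma> - 2 x\<^sup>T A x) = x\<^sup>T C x > 0\<close> for a unit eigenvector \<open>x\<close>, so it never vanishes, and it is
  positive for large \<open>\<gamma>\<close>; by continuity it is positive throughout.\<close>
lemma lyap_pos_def: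
  fixes A :: "real^'n^'n"
  assumes A: "weakly_stable A" and \<gamma>: "\<gamma> > 0" and C: "pos_def (lyap_op A \<gamma> W)"
  shows "pos_def W"
proof -
  define C where "C = lyap_op A \<gamma> W"
  \<comment> \<open>Only the shift s moves while the right-hand side stays \<open>C\<close>; this is
    a rational, hence continuous, path through W at s = \<gamma>.\<close>
  define V where "V s = lyap_sol A s C" for s
  have V: "lyap_op A s (V s) = C" if "s > 0" for s
    using lyap_op_sol[OF A that] by (simp add: V_def)
  have VW: "V \<gamma> = W" using lyap_sol_eq[OF A \<gamma>] by (simp add: V_def C_def)
  have symC: "transpose C = C" using assms(3) pos_def_sym C_def by blast
  have sym: "transpose (V s) = V s" if "s > 0" for s
    using lyap_op_symmetric[OF A that] V[OF that] symC by simp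
  define m where "m s = - lambda_max (- V s)" for s
  have ev: "\<exists>x. m s * (s - 2 * (x \<bullet> (transpose A *v x))) > 0 \<and> norm x = 1"
    and ge: "m s * (y \<bullet> y) \<le> y \<bullet> (V s *v y)" if "s > 0" for s y
  proof -
    have "transpose (- V s) = - V s" using sym[OF that] by (simp add: transpose_distribs)
    then obtain x where x: "norm x = 1" "(- V s) *v x = lambda_max (- V s) *\<^sub>R x"
      and le: "\<And>y. y \<bullet> ((- V s) *v y) \<le> lambda_max (- V s) * (y \<bullet> y)"
      using lambda_max_symmetric by metis
    have Vx: "V s *v x = m s *\<^sub>R x"
      using arg_cong[OF x(2), of uminus] by (simp add: m_def matrix_vector_minus_left)
    have "x \<noteq> 0" using x(1) by auto
    then have "0 < x \<bullet> (C *v x)" using assms(3) pos_def_gt0 by (simp add: C_def)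
    also have "x \<bullet> (C *v x) = m s * (s - 2 * (x \<bullet> (transpose A *v x)))"
      using lyap_quadratic_form[OF sym[OF that], of x A s] x(1)
      by (simp add: V[OF that] Vx norm_eq_1 algebra_simps)
    finally show "\<exists>x. m s * (s - 2 * (x \<bullet> (transpose A *v x))) > 0 \<and> norm x = 1" using x(1) by blast
    show "m s * (y \<bullet> y) \<le> y \<bullet> (V s *v y)"
      using le[of y] by (simp add: m_def matrix_vector_minus_left)
  qed
  have nz: "m s \<noteq> 0" if "s > 0" for s using ev[OF that] by auto
  \<comment> \<open>At b the factor b - 2 x . A^T x is positive for every unit vector x, which
    forces m b > 0; b \<ge> \<gamma> makes [\<gamma>, b] the interval for the intermediate value
    theorem.\<close>
  define b where "b = max \<gamma> (2 * norm (transpose A) + 1)"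
  have b: "b \<ge> \<gamma>" "b > 0" "b > 2 * norm (transpose A)" using \<gamma> by (auto simp: b_def)
  have mb: "m b > 0"
  proof -
    obtain x where x: "m b * (b - 2 * (x \<bullet> (transpose A *v x))) > 0" "norm x = 1"
      using ev[OF b(2)] by blast
    have "x \<bullet> (transpose A *v x) \<le> norm (transpose A)"
      using quadratic_form_le_norm[of x "transpose A"] x(2) by (simp add: norm_eq_1)
    then have "b - 2 * (x \<bullet> (transpose A *v x)) > 0" using b by linarith
    then show ?thesis using x(1) by (simp add: zero_less_mult_iff)
  qed
  have rat: "rational_matrix_on {0<..} V"
    by (rule lyap_solution_rational[OF A, where s = "\<lambda>s. s" and C = "\<lambda>_. C"]) (simp_all add: V)
  have cont: "isCont m s" if "s > 0" for s
  proof -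
    have "eventually (\<lambda>r. r \<in> {0<..}) (at s)"
      using that by (intro eventually_at_in_open') auto
    then have "eventually (\<lambda>r. transpose (- V r) = - V r) (at s)"
      by eventually_elim (simp add: sym transpose_distribs)
    moreover have "((\<lambda>r. - V r) \<longlongrightarrow> - V s) (at s)"
      using rational_matrix_isCont[OF rat that] by (intro tendsto_minus) (simp add: isCont_def)
    moreover have "transpose (- V s) = - V s" using sym[OF that] by (simp add: transpose_distribs)
    ultimately have "((\<lambda>r. lambda_max (- V r)) \<longlongrightarrow> lambda_max (- V s)) (at s)"
      by (rule_tac tendsto_lambda_max)
    then show ?thesis unfolding isCont_def m_def by (intro tendsto_minus)
  qed
  have "m \<gamma> > 0"
  proof (rule ccontr)
    assume "\<not> m \<gamma> > 0"
    then have "\<exists>s\<ge>\<gamma>. s \<le> b \<and> m s = 0"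
      using b(1) mb cont \<gamma> by (intro IVT) auto
    then obtain s where "s \<ge> \<gamma>" "m s = 0" by blast
    then show False using nz[of s] \<gamma> by linarith
  qed
  then have "0 < y \<bullet> (W *v y)" if "y \<noteq> 0" for y
  proof -
    have "0 < m \<gamma> * (y \<bullet> y)" using \<open>m \<gamma> > 0\<close> that by simp
    then show ?thesis using ge[OF \<gamma>, of y] unfolding VW by linarith
  qed
  then show ?thesis using sym[OF \<gamma>] by (simp add: pos_def_def VW)
qed

lemma pos_def_scaled_identity: "e > 0 \<Longrightarrow> pos_def (e *\<^sub>R mat 1)"
  by (simp add: pos_def_def transpose_distribs matrix_vector_scaleR_left)

lemma pos_def_add_semidef: "pos_def M \<Longrightarrow> pos_semidef N \<Longrightarrow> pos_def (M + N)"
  unfolding pos_def_def pos_semidef_def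
  by (simp add: transpose_distribs quadratic_form_simps add_pos_nonneg)

text \<open>Add e V, where V solves the equation with the identity on the right: the perturbed
  solution is definite for every e > 0, and e may tend to 0.\<close>

lemma lyap_pos_semidef:
  fixes A :: "real^'n^'n"
  assumes A: "weakly_stable A" and \<gamma>: "\<gamma> > 0" and C: "pos_semidef (lyap_op A \<gamma> W)"
  shows "pos_semidef W"
proof -
  obtain V where V: "lyap_op A \<gamma> V = mat 1" using lyap_op_surj[OF A \<gamma>] .
  have pd: "pos_def (W + e *\<^sub>R V)" if "e > 0" for e
  proof (rule lyap_pos_def[OF A \<gamma>])
    have "lyap_op A \<gamma> (W + e *\<^sub>R V) = e *\<^sub>R mat 1 + lyap_op A \<gamma> W"
      by (simp add: lyap_op_add lyap_op_scaleR V)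
    then show "pos_def (lyap_op A \<gamma> (W + e *\<^sub>R V))"
      using pos_def_add_semidef[OF pos_def_scaled_identity[OF that] C] by simp
  qed
  have "0 \<le> x \<bullet> (W *v x)" for x
  proof (rule field_le_epsilon)
    fix e :: real assume e: "e > 0"
    define k where "k = \<bar>x \<bullet> (V *v x)\<bar> + 1"
    have k: "k > 0" by (simp add: k_def)
    have "0 \<le> x \<bullet> ((W + (e / k) *\<^sub>R V) *v x)"
      using pos_def_ge0[OF pd[of "e / k"]] e k by simp
    also have "\<dots> = x \<bullet> (W *v x) + (e / k) * (x \<bullet> (V *v x))"
      by (simp add: quadratic_form_simps)
    also have "(e / k) * (x \<bullet> (V *v x)) \<le> (e / k) * k"
      using e k by (intro mult_left_mono) (auto simp: k_def)
    finally show "0 \<le> x \<bullet> (W *v x) + e" using k by simp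
  qed
  moreover have "transpose W = W"
    using lyap_op_symmetric[OF A \<gamma>] C pos_semidef_sym by blast
  ultimately show ?thesis by (simp add: pos_semidef_def)
qed

text \<open>On the kernel of \<open>W\<close> the form of the right-hand side vanishes, hence so
  does the right-hand side itself, and W A^T v = 0 is all that remains of the equation. The kernel
  is thus A^T-invariant, which is the input for controllability.\<close>

lemma lyap_kernel:
  assumes C: "pos_semidef (lyap_op A \<gamma> W)" and W: "transpose W = W" and v: "W *v v = 0"
  shows "lyap_op A \<gamma> W *v v = 0" "W *v (transpose A *v v) = 0"
proof -
  have "v \<bullet> (lyap_op A \<gamma> W *v v) = 0"
    by (simp add: lyap_quadratic_form[OF W] v)
  then show 1: "lyap_op A \<gamma> W *v v = 0" using pos_semidef_isotropic[OF C] by blast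
  then show "W *v (transpose A *v v) = 0"
    by (simp add: lyap_op_def matrix_vector_mult_diff_rdistrib matrix_vector_scaleR_left
        matrix_vector_mul_assoc[symmetric] v)
qed

section \<open>Inverses and traces of positive definite matrices\<close>

lemma pos_def_inverse:
  fixes M :: "real^'n^'n"
  assumes M: "pos_def M"
  shows "M ** matrix_inv M = mat 1" "matrix_inv M ** M = mat 1" "pos_def (matrix_inv M)"
proof -
  have "x = 0" if "M *v x = 0" for x
    using pos_def_gt0[OF M, of x] that by fastforce
  then have "invertible M" using matrix_left_invertible_ker invertible_left_inverse by blast
  then have "M ** matrix_inv M = mat 1 \<and> matrix_inv M ** M = mat 1"
    unfolding matrix_inv_def invertible_def by (rule someI_ex)
  then show *: "M ** matrix_inv M = mat 1" "matrix_inv M ** M = mat 1" by auto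
  have "transpose (matrix_inv M) ** M = mat 1"
    using arg_cong[OF *(1), of transpose] by (simp add: matrix_transpose_mul pos_def_sym[OF M])
  then have sym: "transpose (matrix_inv M) = matrix_inv M"
    using matrix_mul_assoc[of "transpose (matrix_inv M)" M "matrix_inv M"] by (simp add: *(1))
  have "0 < x \<bullet> (matrix_inv M *v x)" if "x \<noteq> 0" for x
  proof -
    have x: "M *v (matrix_inv M *v x) = x" by (simp add: matrix_vector_mul_assoc *)
    then have "matrix_inv M *v x \<noteq> 0" using that by fastforce
    from pos_def_gt0[OF M this] show ?thesis by (simp add: x inner_commute)
  qed
  then show "pos_def (matrix_inv M)" using sym by (simp add: pos_def_def)
qed

lemma right_inverse_unique:
  fixes M :: "real^'n^'n"
  assumes "M ** N = mat 1" shows "matrix_inv M = N" "N ** M = mat 1"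
proof -
  show NM: "N ** M = mat 1" using assms matrix_left_right_inverse by blast
  then have "\<exists>N. M ** N = mat 1 \<and> N ** M = mat 1" using assms by blast
  then have "M ** matrix_inv M = mat 1 \<and> matrix_inv M ** M = mat 1"
    unfolding matrix_inv_def by (rule someI_ex)
  then show "matrix_inv M = N"
    using matrix_mul_assoc[of N M "matrix_inv M"] by (simp add: NM)
qed

lemma matrix_mult_cancel:
  fixes M :: "'a::semiring_1^'n^'m"
  shows "X ** W = mat 1 \<Longrightarrow> M ** X ** W = M"
  by (simp flip: matrix_mul_assoc)

text \<open>With \<open>y = N\<^sup>-\<^sup>1 x\<close>, expand \<open>0 \<le> (M\<^sup>-\<^sup>1 x - y)\<^sup>T M (M\<^sup>-\<^sup>1 x - y)\<close>.\<close>
lemma inverse_antimono: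
  fixes M N :: "real^'n^'n"
  assumes M: "pos_def M" and N: "transpose N = N" "transpose N' = N'"
    and inv: "M ** M' = mat 1" "N ** N' = mat 1"
  shows "x \<bullet> (N' *v x) + ((N' *v x) \<bullet> (N *v (N' *v x)) - (N' *v x) \<bullet> (M *v (N' *v x)))
    \<le> x \<bullet> (M' *v x)"
proof -
  have M': "M' = matrix_inv M" using right_inverse_unique[OF inv(1)] by simp
  define y where "y = N' *v x"
  define u where "u = M' *v x"
  have Mu: "M *v u = x" and Ny: "N *v y = x"
    by (simp_all add: u_def y_def matrix_vector_mul_assoc inv)
  have "0 \<le> (u - y) \<bullet> (M *v (u - y))"
    using pos_def_ge0[OF M] by blast
  also have "\<dots> = u \<bullet> x - 2 * (y \<bullet> x) + y \<bullet> (M *v y)"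
    using dot_sym[OF pos_def_sym[OF M], of u y]
    by (simp add: matrix_vector_mult_diff_distrib inner_diff_left inner_diff_right Mu)
  finally show ?thesis
    by (simp add: y_def[symmetric] u_def[symmetric] Ny inner_commute[of x])
qed

lemma norm_matrix_sq: "(norm (M :: real^'n^'m))^2 = trace (M ** transpose M)"
  by (simp add: power2_norm_eq_inner inner_vec_def trace_def matrix_matrix_mult_def transpose_def)

lemma norm_matrix_sq': "(norm (M :: real^'n^'m))^2 = trace (transpose M ** M)"
  unfolding norm_matrix_sq by (rule trace_mul_sym)

text \<open>With S = P^(1/2) the left-hand side is the squared norm of (C^T S) (S x), and the
  squared Frobenius norm of C^T S is the trace on the right.\<close>

lemma trace_bound_quadratic:
  fixes P :: "real^'n^'n" and C :: "real^'m^'n"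
  assumes P: "pos_def P"
  shows "x \<bullet> ((P ** C ** transpose C ** P) *v x) \<le> trace (transpose C ** P ** C) * (x \<bullet> (P *v x))"
proof -
  obtain S where S: "pos_def S" "S ** S = P" using pd_sqrt_exists[OF P] .
  have sym: "transpose S = S" "transpose P = P" using S P by (auto simp: pos_def_sym)
  have "x \<bullet> ((P ** C ** transpose C ** P) *v x) = (norm ((transpose C ** P) *v x))^2"
    by (simp add: power2_norm_eq_inner dot_transpose matrix_transpose_mul sym
        matrix_vector_mul_assoc matrix_mul_assoc)
  also have "(transpose C ** P) *v x = (transpose C ** S) *v (S *v x)"
    by (simp add: matrix_vector_mul_assoc matrix_mul_assoc flip: S(2))
  also have "(norm ((transpose C ** S) *v (S *v x)))^2 \<le> (norm (transpose C ** S) * norm (S *v x))^2"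
    by (intro power_mono norm_matrix_vector_le) simp
  also have "\<dots> = trace (transpose C ** P ** C) * (x \<bullet> (P *v x))"
  proof -
    have "(norm (transpose C ** S))^2 = trace (transpose C ** P ** C)"
      by (simp add: norm_matrix_sq matrix_transpose_mul sym matrix_mul_assoc flip: S(2))
    moreover have "(norm (S *v x))^2 = x \<bullet> (P *v x)"
      using dot_transpose[of x S "S *v x"] by (simp add: power2_norm_eq_inner sym S(2) matrix_vector_mul_assoc)
    ultimately show ?thesis by (simp add: power_mult_distrib)
  qed
  finally show ?thesis .
qed

lemma pos_def_diag_pos: "pos_def (M :: real^'n^'n) \<Longrightarrow> 0 < M $ i $ i"
  using pos_def_gt0[of M "axis i 1"]
  by (simp add: matrix_vector_mult_basis inner_axis' column_def axis_eq_0_iff)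

lemma trace_pos_def: "pos_def (M :: real^'n^'n) \<Longrightarrow> 0 < trace M"
  unfolding trace_def by (intro sum_pos pos_def_diag_pos) auto

lemma pos_def_congruence:
  fixes T :: "real^'n^'n"
  assumes "pos_def M" "T ** T' = mat 1" shows "pos_def (transpose T ** M ** T)"
proof -
  have "0 < x \<bullet> ((transpose T ** M ** T) *v x)" if "x \<noteq> 0" for x
  proof -
    have "T' ** T = mat 1" using right_inverse_unique[OF assms(2)] by simp
    then have "T' *v (T *v x) = x" by (simp add: matrix_vector_mul_assoc)
    then have "T *v x \<noteq> 0" using that by fastforce
    from pos_def_gt0[OF assms(1) this] show ?thesis
      by (simp add: matrix_vector_mul_assoc[symmetric] dot_transpose[of x "transpose T"])
  qed
  then show ?thesis using pos_def_sym[OF assms(1)]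
    by (simp add: pos_def_def transpose_distribs matrix_mul_assoc)
qed

lemma pos_semidef_congruence:
  fixes C :: "real^'m^'n"
  assumes "pos_semidef M" shows "pos_semidef (transpose C ** M ** C)"
  using assms
  by (simp add: pos_semidef_def transpose_distribs matrix_mul_assoc
      matrix_vector_mul_assoc[symmetric] dot_transpose[of _ "transpose C"])

lemma pos_semidef_gram: "pos_semidef (C ** transpose (C :: real^'m^'n))"
  using pos_semidef_congruence[of "mat 1" "transpose C"] by (simp add: pos_semidef_def)

text \<open>No sum of eigenvalues is formed. If \<gamma> W - M W - W M^T = 1, multiplying by the
  inverse of W and taking traces gives 0 < tr (W^-1) = n \<gamma> - 2 tr M. The choice \<gamma> = 2
  e / n turns this into tr M < e.\<close>

lemma weakly_stable_trace:
  fixes M :: "real^'n^'n"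
  assumes M: "weakly_stable M" shows "trace M \<le> 0"
proof (rule field_le_epsilon)
  fix e :: real assume e: "e > 0"
  define \<gamma> where "\<gamma> = 2 * e / real CARD('n)"
  have \<gamma>: "\<gamma> > 0" using e by (simp add: \<gamma>_def)
  obtain W where W: "lyap_op M \<gamma> W = mat 1" using lyap_op_surj[OF M \<gamma>] .
  have "pos_def W" using pos_def_scaled_identity[of 1] by (rule_tac lyap_pos_def[OF M \<gamma>]) (simp add: W)
  note inv = pos_def_inverse[OF this]
  let ?X = "matrix_inv W"
  have "trace ?X = trace (?X ** lyap_op M \<gamma> W)" by (simp add: W)
  also have "\<dots> = \<gamma> * real CARD('n) - trace (?X ** M ** W) - trace (transpose M)"
    by (simp add: lyap_op_def matrix_ring_simps trace_distribs inv trace_I)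
  also have "trace (?X ** M ** W) = trace M"
    by (simp add: trace_mul_sym[of "?X ** M"] matrix_mul_assoc inv)
  finally have "trace ?X = 2 * e - 2 * trace M" by (simp add: \<gamma>_def trace_transpose)
  then show "trace M \<le> 0 + e" using trace_pos_def[OF inv(3)] by simp
qed

lemma phi_le: "z \<in># eigvals A \<Longrightarrow> phi A \<le> Re z"
  by (simp add: phi_def)

text \<open>The eigenvalues of phi(A) - A are phi(A) - \<lambda> and have nonpositive real part, so
  the trace of this matrix is nonpositive.\<close>

lemma trace_ge_phi:
  fixes A :: "real^'n^'n" shows "real CARD('n) * phi A \<le> trace A"
proof -
  have "weakly_stable (phi A *\<^sub>R mat 1 - A)"
    unfolding weakly_stable_def
  proof
    fix z assume "z \<in># eigvals (phi A *\<^sub>R mat 1 - A)"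
    then obtain x where x: "x \<noteq> 0" "cmat (phi A *\<^sub>R mat 1 - A) *v x = z *s x"
      unfolding eigvals_iff by blast
    have e0: "cmat (phi A *\<^sub>R mat 1 - A) = mat (of_real (phi A)) - cmat A"
      unfolding vec_eq_iff by (auto simp: mat_def)
    have e1: "mat (of_real (phi A)) *v x = of_real (phi A) *s x"
      by (simp add: vec_eq_iff matrix_vector_mult_def mat_def if_distrib if_distribR cong: if_cong)
    have e2: "of_real (phi A) *s x - cmat A *v x = z *s x"
      using x(2) unfolding e0 matrix_vector_mult_diff_rdistrib e1 .
    have "(cmat A *v x) $ i = (of_real (phi A) - z) * x $ i" for i
    proof -
      have "of_real (phi A) * x $ i - (cmat A *v x) $ i = z * x $ i"
        using arg_cong[OF e2, of "\<lambda>y. y $ i"]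
        unfolding vector_minus_component vector_smult_component .
      then show ?thesis unfolding left_diff_distrib by (simp only: diff_eq_eq eq_diff_eq add.commute)
    qed
    then have "cmat A *v x = (of_real (phi A) - z) *s x"
      unfolding vec_eq_iff vector_smult_component by blast
    then have "of_real (phi A) - z \<in># eigvals A" using x(1) unfolding eigvals_iff by blast
    then have "phi A \<le> Re (of_real (phi A) - z)" by (rule phi_le)
    then show "Re z \<le> 0" by simp
  qed
  from weakly_stable_trace[OF this] have "phi A * real CARD('n) - trace A \<le> 0"
    unfolding trace_sub trace_scaleR trace_I .
  then show ?thesis by (simp add: mult.commute)
qed

lemma phi_nonpos: "weakly_stable A \<Longrightarrow> phi A \<le> 0"
proof -
  assume A: "weakly_stable A"
  obtain z where z: "z \<in># eigvals A" using eigvals_nonempty multiset_nonemptyE by blast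
  then have "Re z \<le> 0" using A by (simp add: weakly_stable_def)
  then show ?thesis using phi_le[OF z] by linarith
qed

section \<open>Controllability\<close>

lemma transpose_iterated_mult:
  fixes A :: "real^'n^'n" and B :: "real^'m^'n"
  shows "transpose (((\<lambda>M. A ** M) ^^ i) B) *v v = transpose B *v (((*v) (transpose A) ^^ i) v)"
proof (induction i arbitrary: v)
  case (Suc i)
  have "transpose (((\<lambda>M. A ** M) ^^ Suc i) B) *v v = transpose (((\<lambda>M. A ** M) ^^ i) B) *v (transpose A *v v)"
    by (simp add: matrix_transpose_mul matrix_vector_mul_assoc)
  also have "\<dots> = transpose B *v (((*v) (transpose A) ^^ i) (transpose A *v v))" by (rule Suc)
  finally show ?case by (simp add: funpow_swap1)
qed simp

lemma orthogonal_ctrb_columns_iff: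
  fixes A :: "real^'n^'n" and B :: "real^'m^'n"
  shows "(\<forall>c\<in>(\<Union>i<k. columns (((\<lambda>M. A ** M) ^^ i) B)). c \<bullet> v = 0)
    \<longleftrightarrow> (\<forall>i<k. transpose B *v (((*v) (transpose A) ^^ i) v) = 0)"
proof -
  have "(transpose C *v v) $ j = column j C \<bullet> v" for C :: "real^'m^'n" and j
    by (simp add: matrix_vector_mul_component) (simp add: transpose_def column_def)
  then have "(\<forall>c\<in>columns C. c \<bullet> v = 0) \<longleftrightarrow> transpose C *v v = 0" for C :: "real^'m^'n"
  proof -
    assume *: "\<And>(C :: real^'m^'n) j. (transpose C *v v) $ j = column j C \<bullet> v"
    have "(\<forall>c\<in>columns C. c \<bullet> v = 0) \<longleftrightarrow> (\<forall>j. column j C \<bullet> v = 0)" by (auto simp: columns_def)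
    then show ?thesis by (simp add: vec_eq_iff[of "transpose C *v v"] *)
  qed
  then have "(\<forall>c\<in>(\<Union>i<k. columns (((\<lambda>M. A ** M) ^^ i) B)). c \<bullet> v = 0)
    \<longleftrightarrow> (\<forall>i<k. transpose (((\<lambda>M. A ** M) ^^ i) B) *v v = 0)"
    by (simp add: Ball_def) blast
  then show ?thesis unfolding transpose_iterated_mult .
qed

lemma ctrb_rank_full_imp_zero:
  fixes A :: "real^'n^'n" and B :: "real^'m^'n"
  assumes "ctrb_rank A B k = CARD('n)"
    and v: "\<And>i. i < k \<Longrightarrow> transpose B *v (((*v) (transpose A) ^^ i) v) = 0"
  shows "v = 0"
proof -
  let ?S = "\<Union>i<k. columns (((\<lambda>M. A ** M) ^^ i) B)"
  have full: "span ?S = UNIV"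
    using assms(1) dim_eq_full[of ?S] by (simp add: ctrb_rank_def)
  have "c \<bullet> v = 0" if "c \<in> span ?S" for c
    using that
  proof (induction rule: span_induct)
    case base
    show ?case by (simp add: subspace_def inner_add_left)
  next
    case (step c)
    then show ?case using orthogonal_ctrb_columns_iff[of A B k v] v by blast
  qed
  from this[of v] show ?thesis by (simp add: full)
qed

lemma ctrb_rank_deficient_obtain:
  fixes A :: "real^'n^'n" and B :: "real^'m^'n"
  assumes "ctrb_rank A B k \<noteq> CARD('n)"
  obtains v where "v \<noteq> 0" "\<And>i. i < k \<Longrightarrow> transpose B *v (((*v) (transpose A) ^^ i) v) = 0"
proof -
  let ?S = "\<Union>i<k. columns (((\<lambda>M. A ** M) ^^ i) B)"
  have "dim ?S \<noteq> DIM(real^'n)" using assms by (simp add: ctrb_rank_def)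
  then have "dim ?S < DIM(real^'n)" using dim_subset_UNIV[of ?S] by linarith
  then obtain v where v: "v \<noteq> 0" "\<And>y. y \<in> span ?S \<Longrightarrow> orthogonal v y"
    by (rule orthogonal_to_subspace_exists) blast
  then have "\<forall>c\<in>?S. c \<bullet> v = 0" by (auto simp: orthogonal_def inner_commute span_base)
  then have "\<forall>i<k. transpose B *v (((*v) (transpose A) ^^ i) v) = 0"
    by (rule orthogonal_ctrb_columns_iff[THEN iffD1])
  then show thesis using that v(1) by blast
qed

text \<open>The form in which controllability is used: a set stable under A^T inside the kernel of
  B^T contains no nonzero vector. Stating it for a predicate \<open>R\<close> covers both a kernel
  and the image of a kernel under X.\<close>

lemma controllable_invariant_zero:
  fixes A :: "real^'n^'n" and B :: "real^'m^'n"
  assumes "controllable A B" "R v"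
    and "\<And>v. R v \<Longrightarrow> transpose B *v v = 0" "\<And>v. R v \<Longrightarrow> R (transpose A *v v)"
  shows "v = 0"
proof (rule ctrb_rank_full_imp_zero)
  show "ctrb_rank A B CARD('n) = CARD('n)" using assms(1) by (simp add: controllable_def)
  have "R (((*v) (transpose A) ^^ i) v)" for i
    by (induction i) (simp_all add: assms(2,4))
  then show "transpose B *v (((*v) (transpose A) ^^ i) v) = 0" for i by (rule assms(3))
qed

section \<open>The two nested equations at a fixed parameter\<close>

locale nested_riccati =
  fixes A :: "real^'n^'n" and B :: "real^'m^'n"
  assumes ctrb: "controllable A B" and stab: "weakly_stable A"
begin

text \<open>Each object is reached by a linear solve, a product or an inverse, so rationality in
  \<gamma> passes along the chain. \<open>Z\<close> is the inverse of the solution of the second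
  equation, arranged so that X Z X = Q. The definitions are meaningful for \<gamma> > 0.\<close>

definition W :: "real \<Rightarrow> real^'n^'n" where "W \<gamma> = lyap_sol A \<gamma> (B ** transpose B)"
definition X :: "real \<Rightarrow> real^'n^'n" where "X \<gamma> = matrix_inv (W \<gamma>)"
definition V :: "real \<Rightarrow> real^'n^'n" where "V \<gamma> = lyap_sol (transpose A) (3 * \<gamma>) (X \<gamma>)"
definition Q :: "real \<Rightarrow> real^'n^'n" where "Q \<gamma> = X \<gamma> - (2 * \<gamma>) *\<^sub>R V \<gamma>"
definition Z :: "real \<Rightarrow> real^'n^'n" where "Z \<gamma> = W \<gamma> ** Q \<gamma> ** W \<gamma>"
definition Y :: "real \<Rightarrow> real^'n^'n" where "Y \<gamma> = matrix_inv (Z \<gamma>)"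
definition P :: "real \<Rightarrow> real^'n^'n" where "P \<gamma> = Y \<gamma> - X \<gamma>"

lemma stab_T: "weakly_stable (transpose A)"
  using stab by (simp add: weakly_stable_transpose)

context
  fixes \<gamma> :: real assumes \<gamma>: "\<gamma> > 0"
begin

section \<open>The first equation at a fixed parameter\<close>

lemma lyap_W: "lyap_op A \<gamma> (W \<gamma>) = B ** transpose B"
  unfolding W_def by (rule lyap_op_sol[OF stab \<gamma>])

lemma W_pos: "pos_def (W \<gamma>)"
proof (rule pos_defI_semidef)
  have G: "pos_semidef (lyap_op A \<gamma> (W \<gamma>))" unfolding lyap_W by (rule pos_semidef_gram)
  show psd: "pos_semidef (W \<gamma>)" by (rule lyap_pos_semidef[OF stab \<gamma> G])
  fix v assume v: "W \<gamma> *v v = 0"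
  show "v = 0"
  proof (rule controllable_invariant_zero[OF ctrb, where R = "\<lambda>v. W \<gamma> *v v = 0", OF v])
    fix v assume v: "W \<gamma> *v v = 0"
    note k = lyap_kernel[OF G pos_semidef_sym[OF psd] v]
    show "W \<gamma> *v (transpose A *v v) = 0" by (rule k(2))
    have "(transpose B *v v) \<bullet> (transpose B *v v) = v \<bullet> ((B ** transpose B) *v v)"
      by (simp add: matrix_vector_mul_assoc[symmetric] dot_transpose[of v B])
    also have "\<dots> = 0" using k(1) by (simp add: lyap_W)
    finally show "transpose B *v v = 0" by simp
  qed
qed

lemma X_pos: "pos_def (X \<gamma>)" and XW: "X \<gamma> ** W \<gamma> = mat 1" and WX: "W \<gamma> ** X \<gamma> = mat 1"
  using pos_def_inverse[OF W_pos] by (simp_all add: X_def)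

lemma WT: "transpose (W \<gamma>) = W \<gamma>" and XT: "transpose (X \<gamma>) = X \<gamma>"
  using W_pos X_pos by (simp_all add: pos_def_sym)

lemmas XW_simps = XW WX matrix_mult_cancel[OF XW] matrix_mult_cancel[OF WX]

text \<open>Multiplying by S = R^-1 on both sides turns the quadratic term into the constant B B^T
  and the other terms into the Lyapunov operator at S; multiplying back by R is the converse. This
  serves existence and uniqueness alike.\<close>

lemma eq_X_iff_lyap:
  assumes "R ** S = mat 1"
  shows "eq_X A B \<gamma> R \<longleftrightarrow> lyap_op A \<gamma> S = B ** transpose B"
proof -
  have SR: "S ** R = mat 1" using right_inverse_unique[OF assms] by simp
  note c = assms SR matrix_mult_cancel[OF assms] matrix_mult_cancel[OF SR]
  let ?E = "\<gamma> *\<^sub>R R - (transpose A ** R + R ** A + R ** B ** transpose B ** R)"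
  have 1: "S ** ?E ** S = lyap_op A \<gamma> S - B ** transpose B"
    by (simp add: lyap_op_def matrix_ring_simps c algebra_simps)
  have 2: "R ** (S ** ?E ** S) ** R = ?E"
    by (simp only: matrix_mul_assoc c(1) matrix_mul_lid c(4) matrix_mult_cancel[OF SR])
  have "eq_X A B \<gamma> R \<longleftrightarrow> ?E = 0" by (auto simp: eq_X_def)
  also have "\<dots> \<longleftrightarrow> lyap_op A \<gamma> S - B ** transpose B = 0"
  proof
    assume "?E = 0" then show "lyap_op A \<gamma> S - B ** transpose B = 0" unfolding 1[symmetric] by simp
  next
    assume "lyap_op A \<gamma> S - B ** transpose B = 0"
    then have "R ** (S ** ?E ** S) ** R = 0" unfolding 1 by simp
    then show "?E = 0" unfolding 2 .
  qed
  finally show ?thesis by simp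
qed

lemma eq_X_X: "eq_X A B \<gamma> (X \<gamma>)"
  using eq_X_iff_lyap[OF XW] lyap_W by simp

lemma X_eq: "transpose A ** X \<gamma> + X \<gamma> ** A + X \<gamma> ** B ** transpose B ** X \<gamma> = \<gamma> *\<^sub>R X \<gamma>"
  using eq_X_X by (simp add: eq_X_def)

lemma eq_X_unique: "pos_def R \<Longrightarrow> eq_X A B \<gamma> R \<Longrightarrow> R = X \<gamma>"
proof -
  assume R: "pos_def R" "eq_X A B \<gamma> R"
  note inv = pos_def_inverse[OF R(1)]
  have "lyap_op A \<gamma> (matrix_inv R) = B ** transpose B" using R(2) eq_X_iff_lyap[OF inv(1)] by simp
  then have "W \<gamma> = matrix_inv R" unfolding W_def by (rule lyap_sol_eq[OF stab \<gamma>])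
  then show "R = X \<gamma>" using right_inverse_unique(1)[OF inv(2)] by (simp add: X_def)
qed

lemma X_sol_eq: "X_sol A B \<gamma> = X \<gamma>"
  unfolding X_sol_def by (rule the_equality) (use X_pos eq_X_X eq_X_unique in blast)+

section \<open>The second equation at a fixed parameter\<close>

lemma three_gamma_pos: "3 * \<gamma> > 0" using \<gamma> by simp

lemma lyap_V: "lyap_op (transpose A) (3 * \<gamma>) (V \<gamma>) = X \<gamma>"
  unfolding V_def by (rule lyap_op_sol[OF stab_T three_gamma_pos])

lemma V_pos: "pos_def (V \<gamma>)"
  by (rule lyap_pos_def[OF stab_T three_gamma_pos]) (simp add: lyap_V X_pos)

lemma lyap_X: "lyap_op (transpose A) (3 * \<gamma>) (X \<gamma>) = (2 * \<gamma>) *\<^sub>R X \<gamma> + X \<gamma> ** B ** transpose B ** X \<gamma>"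
proof -
  have "X \<gamma> ** B ** transpose B ** X \<gamma> = \<gamma> *\<^sub>R X \<gamma> - transpose A ** X \<gamma> - X \<gamma> ** A"
    by (simp add: X_eq[symmetric])
  moreover have "(3 * \<gamma>) *\<^sub>R X \<gamma> = (2 * \<gamma>) *\<^sub>R X \<gamma> + \<gamma> *\<^sub>R X \<gamma>"
    by (simp flip: scaleR_add_left)
  ultimately show ?thesis by (simp add: lyap_op_def)
qed

lemma lyap_Q: "lyap_op (transpose A) (3 * \<gamma>) (Q \<gamma>) = X \<gamma> ** B ** transpose B ** X \<gamma>"
  by (simp add: Q_def lyap_op_diff lyap_op_scaleR lyap_V lyap_X)

lemma XGX_psd: "pos_semidef (X \<gamma> ** B ** transpose B ** X \<gamma>)"
  using pos_semidef_gram[of "X \<gamma> ** B"] by (simp add: matrix_transpose_mul XT matrix_mul_assoc)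

text \<open>The kernel of \<open>Q\<close> is invariant under A, whereas controllability asks for
  invariance under A^T. The map X repairs this: on the kernel B^T X v = 0, so the first equation
  reads A^T X v = X (\<gamma> v - A v), and the image of the kernel under X is
  A^T-invariant.\<close>

lemma Q_pos: "pos_def (Q \<gamma>)"
proof (rule pos_defI_semidef)
  have G: "pos_semidef (lyap_op (transpose A) (3 * \<gamma>) (Q \<gamma>))" unfolding lyap_Q by (rule XGX_psd)
  show psd: "pos_semidef (Q \<gamma>)" by (rule lyap_pos_semidef[OF stab_T three_gamma_pos G])
  fix v assume v: "Q \<gamma> *v v = 0"
  have "X \<gamma> *v v = 0"
  proof (rule controllable_invariant_zero[OF ctrb, where R = "\<lambda>u. \<exists>v. Q \<gamma> *v v = 0 \<and> u = X \<gamma> *v v"])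
    show "\<exists>v'. Q \<gamma> *v v' = 0 \<and> X \<gamma> *v v = X \<gamma> *v v'" using v by blast
  next
    fix u assume "\<exists>v. Q \<gamma> *v v = 0 \<and> u = X \<gamma> *v v"
    then obtain v where v: "Q \<gamma> *v v = 0" "u = X \<gamma> *v v" by blast
    note k = lyap_kernel[OF G pos_semidef_sym[OF psd] v(1)]
    have "(transpose B *v u) \<bullet> (transpose B *v u) = v \<bullet> ((X \<gamma> ** B ** transpose B ** X \<gamma>) *v v)"
      by (simp add: v(2) matrix_vector_mul_assoc[symmetric] dot_transpose[of v "X \<gamma>"] dot_transpose[of _ B] XT)
    also have "\<dots> = 0" using k(1) by (simp add: lyap_Q)
    finally show "transpose B *v u = 0" by simp
    have "Q \<gamma> *v (A *v v) = 0" using k(2) by simp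
    have "\<gamma> *\<^sub>R (X \<gamma> *v v) = transpose A *v (X \<gamma> *v v) + X \<gamma> *v (A *v v)"
      using arg_cong[OF X_eq, of "\<lambda>M. M *v v"] k(1) unfolding lyap_Q
      by (simp add: matrix_vector_mult_add_rdistrib matrix_vector_scaleR_left matrix_vector_mul_assoc)
    then have "transpose A *v u = X \<gamma> *v (\<gamma> *\<^sub>R v - A *v v)"
      unfolding v(2) matrix_vector_mult_diff_distrib matrix_vector_mult_scaleR by simp
    moreover have "Q \<gamma> *v (\<gamma> *\<^sub>R v - A *v v) = 0"
      using \<open>Q \<gamma> *v (A *v v) = 0\<close> v(1) by (simp add: matrix_vector_mult_diff_distrib matrix_vector_mult_scaleR)
    ultimately show "\<exists>v. Q \<gamma> *v v = 0 \<and> transpose A *v u = X \<gamma> *v v" by blast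
  qed
  then show "v = 0" using pos_def_gt0[OF X_pos, of v] by fastforce
qed

lemma Z_pos: "pos_def (Z \<gamma>)"
  using pos_def_congruence[OF Q_pos WX] by (simp add: Z_def WT)

lemma Y_pos: "pos_def (Y \<gamma>)" and YZ: "Y \<gamma> ** Z \<gamma> = mat 1" and ZY: "Z \<gamma> ** Y \<gamma> = mat 1"
  using pos_def_inverse[OF Z_pos] by (simp_all add: Y_def)

lemma PT: "transpose (P \<gamma>) = P \<gamma>"
  using Y_pos by (simp add: pos_def_sym P_def transpose_diff XT)

lemma Q_eq: "X \<gamma> ** Z \<gamma> ** X \<gamma> = Q \<gamma>"
  by (simp add: Z_def matrix_mul_assoc XW_simps)

lemma AX_eq: "A + B ** transpose B ** X \<gamma> = W \<gamma> ** (\<gamma> *\<^sub>R mat 1 - transpose A) ** X \<gamma>"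
proof -
  have "A + B ** transpose B ** X \<gamma> = W \<gamma> ** (X \<gamma> ** (A + B ** transpose B ** X \<gamma>))"
    by (simp only: matrix_mul_assoc WX matrix_mul_lid)
  also have "X \<gamma> ** (A + B ** transpose B ** X \<gamma>) = \<gamma> *\<^sub>R X \<gamma> - transpose A ** X \<gamma>"
    unfolding X_eq[symmetric] by (simp add: matrix_ring_simps)
  also have "W \<gamma> ** \<dots> = W \<gamma> ** (\<gamma> *\<^sub>R mat 1 - transpose A) ** X \<gamma>"
    by (simp add: matrix_ring_simps)
  finally show ?thesis .
qed

lemma AX_T_eq: "transpose (A + B ** transpose B ** X \<gamma>) = X \<gamma> ** (\<gamma> *\<^sub>R mat 1 - A) ** W \<gamma>"
  unfolding AX_eq by (simp add: transpose_distribs WT XT matrix_mul_assoc)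

text \<open>Write A + B B^T X as a conjugate of \<gamma> - A^T, then multiply on both sides by S =
  R^-1 and by X. Of the shift 3 \<gamma>, two parts come from the linear terms and one from the
  right-hand side.\<close>

lemma eq_Y_iff_lyap:
  assumes "R ** S = mat 1"
  shows "eq_Y A B \<gamma> (X \<gamma>) R \<longleftrightarrow> lyap_op (transpose A) (3 * \<gamma>) (X \<gamma> ** S ** X \<gamma>) = X \<gamma> ** B ** transpose B ** X \<gamma>"
proof -
  have SR: "S ** R = mat 1" using right_inverse_unique[OF assms] by simp
  note c = assms SR matrix_mult_cancel[OF assms] matrix_mult_cancel[OF SR] XW_simps
  let ?F = "W \<gamma> ** (\<gamma> *\<^sub>R mat 1 - transpose A) ** X \<gamma>"
  let ?FT = "X \<gamma> ** (\<gamma> *\<^sub>R mat 1 - A) ** W \<gamma>"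
  let ?E = "?FT ** R + R ** ?F - R ** B ** transpose B ** R + \<gamma> *\<^sub>R R"
  have 3: "(3 * \<gamma>) *\<^sub>R M = \<gamma> *\<^sub>R M + \<gamma> *\<^sub>R M + \<gamma> *\<^sub>R M" for M :: "real^'n^'n"
    by (simp flip: scaleR_add_left)
  have 1: "X \<gamma> ** (S ** ?E ** S) ** X \<gamma>
     = lyap_op (transpose A) (3 * \<gamma>) (X \<gamma> ** S ** X \<gamma>) - X \<gamma> ** B ** transpose B ** X \<gamma>"
  proof -
    let ?T = "X \<gamma> ** S ** X \<gamma>"
    have a: "X \<gamma> ** (S ** (?FT ** R) ** S) ** X \<gamma> = \<gamma> *\<^sub>R ?T - ?T ** A"
      by (simp add: matrix_ring_simps c)
    have b: "X \<gamma> ** (S ** (R ** ?F) ** S) ** X \<gamma> = \<gamma> *\<^sub>R ?T - transpose A ** ?T"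
      by (simp add: matrix_ring_simps c)
    have d: "X \<gamma> ** (S ** (R ** B ** transpose B ** R) ** S) ** X \<gamma> = X \<gamma> ** B ** transpose B ** X \<gamma>"
      by (simp add: matrix_ring_simps c)
    have e: "X \<gamma> ** (S ** (\<gamma> *\<^sub>R R) ** S) ** X \<gamma> = \<gamma> *\<^sub>R ?T"
      by (simp add: matrix_ring_simps c)
    have lin: "X \<gamma> ** (S ** (E1 + E2 - E3 + E4) ** S) ** X \<gamma> = X \<gamma> ** (S ** E1 ** S) ** X \<gamma>
      + X \<gamma> ** (S ** E2 ** S) ** X \<gamma> - X \<gamma> ** (S ** E3 ** S) ** X \<gamma> + X \<gamma> ** (S ** E4 ** S) ** X \<gamma>"
      for E1 E2 E3 E4
      by (simp only: matrix_add_ldistrib matrix_add_rdistrib matrix_diff_ldistrib matrix_diff_rdistrib)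
    show ?thesis unfolding lin a b d e lyap_op_def 3 by (simp add: algebra_simps)
  qed
  have 2: "R ** (W \<gamma> ** (X \<gamma> ** (S ** E ** S) ** X \<gamma>) ** W \<gamma>) ** R = E" for E
    by (simp add: matrix_mul_assoc c)
  have "eq_Y A B \<gamma> (X \<gamma>) R \<longleftrightarrow> ?E = 0"
    unfolding eq_Y_def AX_T_eq unfolding AX_eq by (simp add: eq_neg_iff_add_eq_0)
  also have "\<dots> \<longleftrightarrow> X \<gamma> ** (S ** ?E ** S) ** X \<gamma> = 0"
  proof
    assume "X \<gamma> ** (S ** ?E ** S) ** X \<gamma> = 0"
    then have "R ** (W \<gamma> ** (X \<gamma> ** (S ** ?E ** S) ** X \<gamma>) ** W \<gamma>) ** R = 0" by simp
    then show "?E = 0" unfolding 2 .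
  qed simp
  finally show ?thesis unfolding 1 by simp
qed

lemma eq_Y_Y: "eq_Y A B \<gamma> (X \<gamma>) (Y \<gamma>)"
  unfolding eq_Y_iff_lyap[OF YZ] Q_eq by (rule lyap_Q)

lemma eq_Y_unique: "pos_def R \<Longrightarrow> eq_Y A B \<gamma> (X \<gamma>) R \<Longrightarrow> R = Y \<gamma>"
proof -
  assume R: "pos_def R" "eq_Y A B \<gamma> (X \<gamma>) R"
  note inv = pos_def_inverse[OF R(1)]
  have "lyap_op (transpose A) (3 * \<gamma>) (X \<gamma> ** matrix_inv R ** X \<gamma>) = lyap_op (transpose A) (3 * \<gamma>) (Q \<gamma>)"
    using R(2) eq_Y_iff_lyap[OF inv(1)] by (simp add: lyap_Q)
  then have "X \<gamma> ** matrix_inv R ** X \<gamma> = Q \<gamma>" by (rule lyap_op_unique[OF stab_T three_gamma_pos])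
  then have "W \<gamma> ** (X \<gamma> ** matrix_inv R ** X \<gamma>) ** W \<gamma> = Z \<gamma>" by (simp add: Z_def)
  then have "Z \<gamma> = matrix_inv R" by (simp add: matrix_mul_assoc XW_simps)
  then show "R = Y \<gamma>" using right_inverse_unique(1)[OF inv(2)] by (simp add: Y_def)
qed

lemma Y_sol_eq: "Y_sol A B \<gamma> = Y \<gamma>"
  unfolding Y_sol_def X_sol_eq by (rule the_equality) (use Y_pos eq_Y_Y eq_Y_unique in blast)+

lemma P_sol_eq: "P_sol A B \<gamma> = P \<gamma>"
  by (simp add: P_sol_def P_def X_sol_eq Y_sol_eq)

section \<open>The difference P = Y - X\<close>

lemma Z_eq: "Z \<gamma> = W \<gamma> - (2 * \<gamma>) *\<^sub>R (W \<gamma> ** V \<gamma> ** W \<gamma>)"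
  by (simp add: Z_def Q_def matrix_ring_simps XW_simps)

lemma WVW_pos: "pos_def (W \<gamma> ** V \<gamma> ** W \<gamma>)"
  using pos_def_congruence[OF V_pos WX] by (simp add: WT)

text \<open>Z lies below W by the definite matrix 2 \<gamma> W V W, and inversion reverses the
  order. The strict gain in \<open>inverse_antimono\<close> appears at the vector X x, which is
  nonzero with x.\<close>

lemma P_pos: "pos_def (P \<gamma>)"
proof -
  have "0 < x \<bullet> (P \<gamma> *v x)" if "x \<noteq> 0" for x
  proof -
    have "W \<gamma> *v (X \<gamma> *v x) = x" by (simp add: matrix_vector_mul_assoc WX)
    then have "X \<gamma> *v x \<noteq> 0" using that by fastforce
    from pos_def_gt0[OF WVW_pos this]
    have "0 < (X \<gamma> *v x) \<bullet> (W \<gamma> *v (X \<gamma> *v x)) - (X \<gamma> *v x) \<bullet> (Z \<gamma> *v (X \<gamma> *v x))"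
      using \<gamma> by (simp add: Z_eq quadratic_form_simps)
    then have "x \<bullet> (X \<gamma> *v x) < x \<bullet> (Y \<gamma> *v x)"
      using inverse_antimono[OF Z_pos WT XT ZY WX, of x] by linarith
    then show ?thesis by (simp add: P_def quadratic_form_simps)
  qed
  then show ?thesis by (simp add: pos_def_def PT)
qed

lemma Y_eq: "transpose (A + B ** transpose B ** X \<gamma>) ** Y \<gamma> + Y \<gamma> ** (A + B ** transpose B ** X \<gamma>)
       - Y \<gamma> ** B ** transpose B ** Y \<gamma> = - (\<gamma> *\<^sub>R Y \<gamma>)"
  using eq_Y_Y by (simp add: eq_Y_def)

lemma P_eq: "transpose A ** P \<gamma> + P \<gamma> ** A - P \<gamma> ** B ** transpose B ** P \<gamma>
    = - (\<gamma> *\<^sub>R (P \<gamma> + 2 *\<^sub>R X \<gamma>))"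
proof -
  have y: "- (\<gamma> *\<^sub>R Y \<gamma>) = transpose A ** Y \<gamma> + X \<gamma> ** B ** transpose B ** Y \<gamma>
    + Y \<gamma> ** A + Y \<gamma> ** B ** transpose B ** X \<gamma> - Y \<gamma> ** B ** transpose B ** Y \<gamma>"
    unfolding Y_eq[symmetric] by (simp add: transpose_distribs XT matrix_ring_simps)
  have "- (\<gamma> *\<^sub>R (P \<gamma> + 2 *\<^sub>R X \<gamma>)) = - (\<gamma> *\<^sub>R Y \<gamma>) - \<gamma> *\<^sub>R X \<gamma>"
    by (simp add: P_def scaleR_add_right scaleR_diff_right scaleR_2)
  also have "\<dots> = transpose A ** P \<gamma> + P \<gamma> ** A - P \<gamma> ** B ** transpose B ** P \<gamma>"
    unfolding y X_eq[symmetric] by (simp add: P_def matrix_ring_simps)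
  finally show ?thesis by simp
qed

text \<open>The closed loop is A + B B^T X - B B^T Y. By the second equation, Y times it equals -
  \<gamma> Y - (A + B B^T X)^T Y, where the transposed matrix is a conjugate of \<gamma> - A; the
  two \<gamma> add up to the shift.\<close>

lemma closed_loop_eq:
  "A - B ** transpose B ** P \<gamma> = (Z \<gamma> ** X \<gamma>) ** A ** (W \<gamma> ** Y \<gamma>) - (2 * \<gamma>) *\<^sub>R mat 1"
proof -
  note c = XW_simps YZ ZY matrix_mult_cancel[OF YZ] matrix_mult_cancel[OF ZY]
  have "Y \<gamma> ** (A + B ** transpose B ** X \<gamma>) - Y \<gamma> ** B ** transpose B ** Y \<gamma>
    = - (\<gamma> *\<^sub>R Y \<gamma>) - transpose (A + B ** transpose B ** X \<gamma>) ** Y \<gamma>"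
    unfolding Y_eq[symmetric] by simp
  also have "\<dots> = X \<gamma> ** A ** W \<gamma> ** Y \<gamma> - (2 * \<gamma>) *\<^sub>R Y \<gamma>"
    unfolding AX_T_eq by (simp add: matrix_ring_simps c scaleR_2 flip: scaleR_scaleR)
  finally have "Z \<gamma> ** (Y \<gamma> ** (A + B ** transpose B ** X \<gamma>) - Y \<gamma> ** B ** transpose B ** Y \<gamma>)
    = Z \<gamma> ** (X \<gamma> ** A ** W \<gamma> ** Y \<gamma> - (2 * \<gamma>) *\<^sub>R Y \<gamma>)" by simp
  then show ?thesis by (simp add: P_def matrix_ring_simps c algebra_simps)
qed

lemma ZXWY: "(Z \<gamma> ** X \<gamma>) ** (W \<gamma> ** Y \<gamma>) = mat 1"
  by (simp add: matrix_mul_assoc XW_simps ZY)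

lemma eigvals_closed_loop:
  "eigvals (A - B ** transpose B ** P \<gamma>) = image_mset (\<lambda>z. z - of_real (2 * \<gamma>)) (eigvals A)"
  unfolding closed_loop_eq eigvals_diff_scaled_identity eigvals_similar[OF ZXWY] by simp

lemma trace_BPB: "trace (transpose B ** P \<gamma> ** B) = 2 * real CARD('n) * \<gamma>"
proof -
  have WYZX: "(W \<gamma> ** Y \<gamma>) ** (Z \<gamma> ** X \<gamma>) = mat 1" using right_inverse_unique[OF ZXWY] by simp
  have "trace A - trace (B ** transpose B ** P \<gamma>) = trace ((Z \<gamma> ** X \<gamma>) ** A ** (W \<gamma> ** Y \<gamma>)) - 2 * \<gamma> * real CARD('n)"
    using arg_cong[OF closed_loop_eq, of trace] by (simp add: trace_distribs trace_I)
  also have "trace ((Z \<gamma> ** X \<gamma>) ** A ** (W \<gamma> ** Y \<gamma>)) = trace ((W \<gamma> ** Y \<gamma>) ** (Z \<gamma> ** X \<gamma>) ** A)"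
    by (metis matrix_mul_assoc trace_mul_sym)
  finally have "trace (B ** transpose B ** P \<gamma>) = 2 * real CARD('n) * \<gamma>" by (simp add: WYZX)
  moreover have "trace (B ** (transpose B ** P \<gamma>)) = trace (transpose B ** P \<gamma> ** B)"
    by (rule trace_mul_sym)
  ultimately show ?thesis by (simp add: matrix_mul_assoc)
qed

text \<open>The trace of W times the first equation gives n \<gamma> = 2 tr A + tr (B^T X B), and tr
  A \<ge> n phi(A). The resulting n \<gamma> - 2 n phi(A) is relaxed to 2 n (\<gamma> - phi(A)), so
  that a single factor governs the comparison of X with P.\<close>

lemma trace_BXB_le: "trace (transpose B ** X \<gamma> ** B) \<le> 2 * real CARD('n) * (\<gamma> - phi A)"
proof -
  have "trace (W \<gamma> ** (transpose A ** X \<gamma> + X \<gamma> ** A + X \<gamma> ** B ** transpose B ** X \<gamma>)) = \<gamma> * real CARD('n)"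
    unfolding X_eq by (simp add: matrix_scaleR_right WX trace_distribs trace_I)
  moreover have "trace (W \<gamma> ** (transpose A ** X \<gamma>)) = trace A"
    by (simp add: trace_mul_sym[of "W \<gamma>"] matrix_mult_cancel[OF XW] trace_transpose)
  moreover have "trace (B ** (transpose B ** X \<gamma>)) = trace (transpose B ** X \<gamma> ** B)"
    by (rule trace_mul_sym)
  ultimately have "trace A + trace A + trace (transpose B ** X \<gamma> ** B) = \<gamma> * real CARD('n)"
    by (simp add: matrix_add_ldistrib matrix_mul_assoc WX trace_add)
  moreover have "real CARD('n) * \<gamma> \<ge> 0" using \<gamma> by simp
  ultimately show ?thesis using trace_ge_phi[of A]
    by (simp add: algebra_simps)
qed

lemma gamma_minus_phi: "\<gamma> - phi A \<ge> \<gamma>" "\<gamma> - phi A > 0"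
  using phi_nonpos[OF stab] \<gamma> by auto

text \<open>\<open>D = a V - X\<close> solves a Lyapunov equation with right-hand side
  \<open>(a - 2 \<gamma>) X - X B B\<^sup>T X \<ge> 0\<close>, so \<open>X \<le> a V\<close>; inverting gives the claim.\<close>
lemma X_le_P:
  "\<gamma> * (x \<bullet> (X \<gamma> *v x)) \<le> real CARD('n) * (\<gamma> - phi A) * (x \<bullet> (P \<gamma> *v x))"
proof -
  define b where "b = real CARD('n) * (\<gamma> - phi A)"
  \<comment> \<open>The part 2 \<gamma> cancels the term 2 \<gamma> X in \<open>lyap_X\<close>, and
    2 b is the bound of \<open>trace_BXB_le\<close>, so the right-hand side for \<open>D\<close> is
    2 b X - X B B^T X \<ge> 0.\<close>
  define a where "a = 2 * \<gamma> + 2 * b"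
  have b: "b > 0" using gamma_minus_phi(2) by (simp add: b_def)
  define D where "D = a *\<^sub>R V \<gamma> - X \<gamma>"
  have LD: "lyap_op (transpose A) (3 * \<gamma>) D = (2 * b) *\<^sub>R X \<gamma> - X \<gamma> ** B ** transpose B ** X \<gamma>"
    unfolding D_def lyap_op_diff lyap_op_scaleR lyap_V lyap_X a_def
    by (simp add: scaleR_add_left)
  have "pos_semidef (lyap_op (transpose A) (3 * \<gamma>) D)"
    unfolding pos_semidef_def
  proof (intro conjI allI)
    show "transpose (lyap_op (transpose A) (3 * \<gamma>) D) = lyap_op (transpose A) (3 * \<gamma>) D"
      unfolding LD using pos_semidef_sym[OF XGX_psd] by (simp add: transpose_diff transpose_scalar XT)
    fix y
    have "y \<bullet> ((X \<gamma> ** B ** transpose B ** X \<gamma>) *v y) \<le> trace (transpose B ** X \<gamma> ** B) * (y \<bullet> (X \<gamma> *v y))"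
      by (rule trace_bound_quadratic[OF X_pos])
    also have "\<dots> \<le> (2 * b) * (y \<bullet> (X \<gamma> *v y))"
      using trace_BXB_le pos_def_ge0[OF X_pos]
      by (intro mult_right_mono) (simp_all add: b_def mult.assoc)
    finally show "0 \<le> y \<bullet> (lyap_op (transpose A) (3 * \<gamma>) D *v y)"
      unfolding LD by (simp add: quadratic_form_simps)
  qed
  then have D: "pos_semidef D" by (rule lyap_pos_semidef[OF stab_T three_gamma_pos])
  have WDW: "W \<gamma> ** D ** W \<gamma> = a *\<^sub>R (W \<gamma> ** V \<gamma> ** W \<gamma>) - W \<gamma>"
    by (simp add: D_def matrix_ring_simps XW_simps)
  \<comment> \<open>W V W \<ge> W / a and Z = W - 2 \<gamma> W V W, where 1 - 2 \<gamma> / a = b /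
    (\<gamma> + b). Inversion then gives Y \<ge> (1 + \<gamma> / b) X, that is, b P \<ge> \<gamma>
    X.\<close>
  have ineq: "(\<gamma> + b) * (y \<bullet> (Z \<gamma> *v y)) \<le> b * (y \<bullet> (W \<gamma> *v y))" for y
  proof -
    have "0 \<le> y \<bullet> ((W \<gamma> ** D ** W \<gamma>) *v y)"
      using pos_semidef_congruence[OF D, of "W \<gamma>"] by (simp add: WT pos_semidef_def)
    then have "y \<bullet> (W \<gamma> *v y) \<le> a * (y \<bullet> ((W \<gamma> ** V \<gamma> ** W \<gamma>) *v y))"
      unfolding WDW by (simp add: quadratic_form_simps)
    then have "\<gamma> * (y \<bullet> (W \<gamma> *v y)) \<le> \<gamma> * (a * (y \<bullet> ((W \<gamma> ** V \<gamma> ** W \<gamma>) *v y)))"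
      using \<gamma> by (intro mult_left_mono) auto
    moreover have Zy: "y \<bullet> (Z \<gamma> *v y) = y \<bullet> (W \<gamma> *v y) - 2 * \<gamma> * (y \<bullet> ((W \<gamma> ** V \<gamma> ** W \<gamma>) *v y))"
      by (simp add: Z_eq quadratic_form_simps)
    ultimately show ?thesis unfolding Zy by (simp add: a_def algebra_simps)
  qed
  define M where "M = ((\<gamma> + b) / b) *\<^sub>R Z \<gamma>"
  define M' where "M' = (b / (\<gamma> + b)) *\<^sub>R Y \<gamma>"
  have M: "pos_def M" using Z_pos b \<gamma>
    by (simp add: M_def pos_def_def transpose_scalar matrix_vector_scaleR_left)
  have MM': "M ** M' = mat 1" using b \<gamma> by (simp add: M_def M'_def matrix_ring_simps ZY)
  have "y \<bullet> (M *v y) \<le> y \<bullet> (W \<gamma> *v y)" for y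
    using ineq[of y] b by (simp add: M_def matrix_vector_scaleR_left pos_divide_le_eq mult.commute)
  then have "x \<bullet> (X \<gamma> *v x) \<le> x \<bullet> (M' *v x)"
    using inverse_antimono[OF M WT XT MM' WX, of x] by (smt (verit))
  then have "(\<gamma> + b) * (x \<bullet> (X \<gamma> *v x)) \<le> b * (x \<bullet> (Y \<gamma> *v x))"
    using b \<gamma> by (simp add: M'_def matrix_vector_scaleR_left pos_le_divide_eq mult.commute)
  then show ?thesis
    unfolding b_def[symmetric] by (simp add: P_def quadratic_form_simps algebra_simps)
qed

end

end

section \<open>Derivatives of matrix functions\<close>

lemma bounded_bilinear_matrix_mult:
  "bounded_bilinear ((**) :: real^'n^'m \<Rightarrow> real^'p^'n \<Rightarrow> real^'p^'m)"
  unfolding bilinear_conv_bounded_bilinear[symmetric] bilinear_def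
  by (auto intro!: linearI simp: matrix_ring_simps)

lemma has_vector_derivative_matrix_mult:
  fixes F :: "real \<Rightarrow> real^'n^'m" and G :: "real \<Rightarrow> real^'p^'n"
  assumes "(F has_vector_derivative F') (at x)" "(G has_vector_derivative G') (at x)"
  shows "((\<lambda>x. F x ** G x) has_vector_derivative (F x ** G' + F' ** G x)) (at x)"
  by (rule bounded_bilinear.has_vector_derivative[OF bounded_bilinear_matrix_mult assms])

lemma has_vector_derivative_transpose:
  fixes F :: "real \<Rightarrow> real^'n^'m"
  assumes "(F has_vector_derivative F') (at x)"
  shows "((\<lambda>x. transpose (F x)) has_vector_derivative transpose F') (at x)"
proof (rule bounded_linear.has_vector_derivative[OF _ assms])
  have "linear (transpose :: real^'n^'m \<Rightarrow> real^'m^'n)"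
    by (intro linearI) (simp_all add: transpose_add transpose_scalar)
  then show "bounded_linear (transpose :: real^'n^'m \<Rightarrow> real^'m^'n)"
    by (simp add: linear_conv_bounded_linear)
qed

lemma has_real_derivative_matrix_entry:
  fixes F :: "real \<Rightarrow> real^'n^'m"
  assumes "(F has_vector_derivative F') (at x)"
  shows "((\<lambda>x. F x $ i $ j) has_real_derivative F' $ i $ j) (at x)"
proof -
  have "bounded_linear (\<lambda>M :: real^'n^'m. M $ i $ j)"
    by (intro bounded_linear_compose[OF bounded_linear_vec_nth bounded_linear_vec_nth])
  from bounded_linear.has_vector_derivative[OF this assms] show ?thesis
    by (simp add: has_real_derivative_iff_has_vector_derivative)
qed

text \<open>Jacobi's formula.  The \<open>i\<close>-th row of \<open>F' = F' F\<^sup>-\<^sup>1 F\<close> is a combination of the rows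
  of \<open>F\<close>, so that Cramer's lemma evaluates the determinant with this row inserted.\<close>
lemma has_real_derivative_det:
  fixes F :: "real \<Rightarrow> real^'n^'n"
  assumes F: "(F has_vector_derivative F') (at x)" and R: "R ** F x = mat 1"
  shows "((\<lambda>x. det (F x)) has_real_derivative det (F x) * trace (F' ** R)) (at x)"
proof -
  let ?U = "UNIV :: 'n set"
  let ?row = "\<lambda>i. \<chi> r. if r = i then F' $ i else F x $ r"
  have D: "((\<lambda>x. det (F x)) has_real_derivative
     (\<Sum>p | p permutes ?U. of_int (sign p) * (\<Sum>i\<in>?U. F' $ i $ p i * (\<Prod>j\<in>?U - {i}. F x $ j $ p j)))) (at x)"
    unfolding det_def
    by (intro DERIV_sum DERIV_cmult has_field_derivative_prod has_real_derivative_matrix_entry F)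
  have prod: "F' $ i $ p i * (\<Prod>j\<in>?U - {i}. F x $ j $ p j) = (\<Prod>j\<in>?U. ?row i $ j $ p j)" for i p
  proof -
    have "(\<Prod>j\<in>?U. ?row i $ j $ p j) = ?row i $ i $ p i * (\<Prod>j\<in>?U - {i}. ?row i $ j $ p j)"
      by (rule prod.remove) auto
    also have "(\<Prod>j\<in>?U - {i}. ?row i $ j $ p j) = (\<Prod>j\<in>?U - {i}. F x $ j $ p j)"
      by (intro prod.cong) auto
    finally show ?thesis by simp
  qed
  have det_row: "det (?row i) = (F' ** R) $ i $ i * det (F x)" for i
  proof -
    have "F' = (F' ** R) ** F x" using R by (simp flip: matrix_mul_assoc)
    then have "F' $ i = (\<Sum>k\<in>?U. (F' ** R) $ i $ k *s row k (F x))"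
      by (simp add: vec_eq_iff row_def matrix_matrix_mult_def[of "F' ** R"])
    then have "?row i = (\<chi> r. if r = i then \<Sum>k\<in>?U. (F' ** R) $ i $ k *s row k (F x) else row r (F x))"
      by (simp add: vec_eq_iff row_def)
    then show ?thesis using cramer_lemma_transpose[of i "(F' ** R) $ i" "F x"] by simp
  qed
  have "(\<Sum>p | p permutes ?U. of_int (sign p) * (\<Sum>i\<in>?U. F' $ i $ p i * (\<Prod>j\<in>?U - {i}. F x $ j $ p j)))
    = (\<Sum>i\<in>?U. det (?row i))"
    unfolding prod det_def sum_distrib_left by (rule sum.swap)
  also have "\<dots> = det (F x) * trace (F' ** R)"
    unfolding det_row trace_def by (simp add: sum_distrib_left mult.commute)
  finally show ?thesis using D by simp
qed

section \<open>Logarithmic derivatives of zero-free rational functions\<close>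

lemma linear_factor_scale_bound:
  fixes r :: complex
  assumes "\<And>t::real. t > 0 \<Longrightarrow> of_real t \<noteq> r"
  obtains c where "\<And>t. t > 0 \<Longrightarrow> t \<le> c * norm (of_real t - r)"
proof (cases "Im r = 0")
  case True
  have "t \<le> 1 * norm (of_real t - r)" if "t > 0" for t
  proof -
    have "Re r \<le> 0" using assms[of "Re r"] True by (cases "Re r > 0") (auto simp: complex_eq_iff)
    moreover have "Re (of_real t - r) \<le> norm (of_real t - r)" by (rule complex_Re_le_cmod)
    ultimately show ?thesis by simp
  qed
  then show ?thesis by (rule that)
next
  case False
  \<comment> \<open>In t \<le> |t - r| + |r| the second term is a multiple of |Im r|, and |Im r| is
    at most |t - r|.\<close>
  have "t \<le> (1 + norm r / \<bar>Im r\<bar>) * norm (of_real t - r)" if "t > 0" for t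
  proof -
    have im: "\<bar>Im r\<bar> \<le> norm (of_real t - r)" using abs_Im_le_cmod[of "of_real t - r"] by simp
    have "t \<le> norm (of_real t - r) + norm r"
      using norm_triangle_ineq[of "of_real t - r" r] that by simp
    also have "norm r = norm r / \<bar>Im r\<bar> * \<bar>Im r\<bar>" using False by simp
    also have "\<dots> \<le> norm r / \<bar>Im r\<bar> * norm (of_real t - r)" using im by (intro mult_left_mono) auto
    finally show ?thesis by (simp add: distrib_right)
  qed
  then show ?thesis by (rule that)
qed

text \<open>t p'(t) / p(t) is the sum of t / (t - r) over the roots r, and each term is bounded
  because r stays off the positive axis. The induction removes one root at a time.\<close>

lemma complex_poly_log_derivative_bound:
  fixes p :: "complex poly"
  assumes "\<And>t::real. t > 0 \<Longrightarrow> poly p (of_real t) \<noteq> 0"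
  shows "\<exists>C. \<forall>t>0. norm (of_real t * poly (pderiv p) (of_real t)) \<le> C * norm (poly p (of_real t))"
  using assms
proof (induction "degree p" arbitrary: p)
  case 0
  then obtain a where "p = [:a:]" using degree_eq_zeroE by metis
  then have "\<forall>t>0. norm (of_real t * poly (pderiv p) (of_real t)) \<le> 0 * norm (poly p (of_real t))"
    by (simp add: pderiv_pCons)
  then show ?case by blast
next
  case (Suc d)
  obtain l where l: "poly p l = 0"
    using fundamental_theorem_of_algebra[of p] Suc.hyps(2) by (auto simp: constant_degree)
  then obtain q where q: "p = [:- l, 1:] * q" using poly_eq_0_iff_dvd by blast
  have ev: "poly p z = (z - l) * poly q z" for z by (simp add: q algebra_simps)
  have "q \<noteq> 0" using Suc.hyps(2) by (auto simp: q)
  then have "degree q = d" using Suc.hyps(2) by (auto simp: q degree_mult_eq simp del: mult_pCons_left)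
  moreover have "poly q (of_real t) \<noteq> 0" if "t > 0" for t using Suc.prems[OF that] by (simp add: ev)
  ultimately obtain C where C: "\<And>t. t > 0 \<Longrightarrow>
      norm (of_real t * poly (pderiv q) (of_real t)) \<le> C * norm (poly q (of_real t))"
    using Suc.hyps(1)[of q] by blast
  have "of_real t \<noteq> l" if "t > 0" for t using Suc.prems[OF that] l by auto
  then obtain c where c: "\<And>t. t > 0 \<Longrightarrow> t \<le> c * norm (of_real t - l)"
    using linear_factor_scale_bound by blast
  have "norm (of_real t * poly (pderiv p) (of_real t)) \<le> (c + C) * norm (poly p (of_real t))" if t: "t > 0" for t
  proof -
    have "poly (pderiv p) z = poly q z + (z - l) * poly (pderiv q) z" for z
      unfolding q pderiv_mult by (simp add: pderiv_pCons algebra_simps)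
    then have "of_real t * poly (pderiv p) (of_real t)
        = of_real t * (poly q (of_real t) + (of_real t - l) * poly (pderiv q) (of_real t))" by simp
    then have "of_real t * poly (pderiv p) (of_real t) = of_real t * poly q (of_real t)
        + (of_real t - l) * (of_real t * poly (pderiv q) (of_real t))"
      by (simp only: distrib_left mult.left_commute)
    then have "norm (of_real t * poly (pderiv p) (of_real t)) \<le> norm (of_real t * poly q (of_real t))
        + norm ((of_real t - l) * (of_real t * poly (pderiv q) (of_real t)))"
      by (metis norm_triangle_ineq)
    also have "norm (of_real t * poly q (of_real t)) \<le> c * norm (of_real t - l) * norm (poly q (of_real t))"
      using mult_right_mono[OF c[OF t], of "norm (poly q (of_real t))"] t by (simp add: norm_mult)
    also have "norm ((of_real t - l) * (of_real t * poly (pderiv q) (of_real t)))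
       \<le> norm (of_real t - l) * (C * norm (poly q (of_real t)))"
      unfolding norm_mult[of "of_real t - l"] by (intro mult_left_mono C t) simp
    finally show ?thesis by (simp only: ev norm_mult distrib_right mult_ac)
  qed
  then show ?case by blast
qed

lemma real_poly_log_derivative_bound:
  fixes p :: "real poly"
  assumes "\<And>t. t > 0 \<Longrightarrow> poly p t \<noteq> 0"
  obtains C where "\<And>t. t > 0 \<Longrightarrow> \<bar>t * poly (pderiv p) t\<bar> \<le> C * \<bar>poly p t\<bar>"
proof -
  define c where "c = map_poly complex_of_real"
  have ev: "poly (c q) (of_real t) = of_real (poly q t)" for q t
    unfolding c_def by (induction q) (simp_all add: map_poly_pCons)
  have d: "pderiv (c p) = c (pderiv p)"
    by (rule poly_eqI) (simp add: c_def coeff_pderiv coeff_map_poly)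
  have "poly (c p) (of_real t) \<noteq> 0" if "t > 0" for t using assms[OF that] by (simp add: ev)
  then obtain C where C: "\<forall>t>0. norm (of_real t * poly (pderiv (c p)) (of_real t)) \<le> C * norm (poly (c p) (of_real t))"
    using complex_poly_log_derivative_bound[of "c p"] by blast
  show thesis
  proof (rule that)
    fix t :: real assume "t > 0"
    with C have "norm (complex_of_real t * of_real (poly (pderiv p) t)) \<le> C * norm (complex_of_real (poly p t))"
      unfolding d ev by blast
    then show "\<bar>t * poly (pderiv p) t\<bar> \<le> C * \<bar>poly p t\<bar>"
      by (simp flip: of_real_mult)
  qed
qed

text \<open>For f = p / q one has t f' / f = t p' / p - t q' / q, so the two constants add.\<close>

lemma rational_pos_log_derivative_bound:
  assumes f: "rational_pos f" and nz: "\<And>t. t > 0 \<Longrightarrow> f t \<noteq> 0"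
    and f': "\<And>t. t > 0 \<Longrightarrow> (f has_real_derivative f' t) (at t)"
  obtains C where "\<And>t. t > 0 \<Longrightarrow> \<bar>t * f' t\<bar> \<le> C * \<bar>f t\<bar>"
proof -
  from f obtain p q where pq: "\<And>\<gamma>. \<gamma> > 0 \<Longrightarrow> poly q \<gamma> \<noteq> 0" "\<And>\<gamma>. \<gamma> > 0 \<Longrightarrow> f \<gamma> = poly p \<gamma> / poly q \<gamma>"
    unfolding rational_pos_def by blast
  have "poly p t \<noteq> 0" if "t > 0" for t using nz[OF that] pq(2)[OF that] by auto
  then obtain C where C: "\<And>t. t > 0 \<Longrightarrow> \<bar>t * poly (pderiv p) t\<bar> \<le> C * \<bar>poly p t\<bar>"
    using real_poly_log_derivative_bound by blast
  obtain D where D: "\<And>t. t > 0 \<Longrightarrow> \<bar>t * poly (pderiv q) t\<bar> \<le> D * \<bar>poly q t\<bar>"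
    using real_poly_log_derivative_bound pq(1) by blast
  have "\<bar>t * f' t\<bar> \<le> (C + D) * \<bar>f t\<bar>" if t: "t > 0" for t
  proof -
    have "((\<lambda>\<gamma>. poly p \<gamma> / poly q \<gamma>) has_real_derivative f' t) (at t)"
      using f'[OF t] by (rule has_field_derivative_transform_within_open[where S = "{0<..}"])
        (simp_all add: t pq(2))
    then have "f' t * poly q t + poly (pderiv q) t * (poly p t / poly q t) = poly (pderiv p) t"
    proof -
      assume *: "((\<lambda>\<gamma>. poly p \<gamma> / poly q \<gamma>) has_real_derivative f' t) (at t)"
      have "((\<lambda>\<gamma>. poly p \<gamma> / poly q \<gamma>) has_real_derivative
          (poly (pderiv p) t * poly q t - poly p t * poly (pderiv q) t) / (poly q t * poly q t)) (at t)"
        using pq(1)[OF t] by (intro DERIV_divide poly_DERIV)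
      from DERIV_unique[OF * this] show ?thesis using pq(1)[OF t] by (simp add: field_simps)
    qed
    then have eq: "f' t * poly q t = poly (pderiv p) t - poly (pderiv q) t * f t"
      by (simp add: pq(2)[OF t])
    have "(t * f' t) * poly q t = t * poly (pderiv p) t - t * poly (pderiv q) t * f t"
      unfolding mult.assoc eq right_diff_distrib ..
    then have "\<bar>t * f' t\<bar> * \<bar>poly q t\<bar> \<le> \<bar>t * poly (pderiv p) t\<bar> + \<bar>t * poly (pderiv q) t\<bar> * \<bar>f t\<bar>"
      by (metis abs_mult abs_triangle_ineq4)
    also have "\<dots> \<le> C * \<bar>poly p t\<bar> + D * \<bar>poly q t\<bar> * \<bar>f t\<bar>"
      using C[OF t] D[OF t] by (intro add_mono mult_right_mono) auto
    also have "\<bar>poly p t\<bar> = \<bar>f t\<bar> * \<bar>poly q t\<bar>"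
    proof -
      have "poly p t = f t * poly q t" using pq[OF t] by simp
      then show ?thesis by (simp add: abs_mult)
    qed
    finally have "\<bar>t * f' t\<bar> * \<bar>poly q t\<bar> \<le> ((C + D) * \<bar>f t\<bar>) * \<bar>poly q t\<bar>" by (simp add: algebra_simps)
    then show ?thesis using pq(1)[OF t] by (simp add: mult_le_cancel_right)
  qed
  then show thesis by (rule that)
qed

section \<open>Bounding quadratic forms by traces\<close>

lemma quadratic_form_le_trace:
  assumes "pos_def (N :: real^'n^'n)" shows "y \<bullet> (N *v y) \<le> trace N * (y \<bullet> y)"
proof -
  obtain T where T: "pos_def T" "T ** T = N" using pd_sqrt_exists[OF assms] .
  have "y \<bullet> (N *v y) = (norm (T *v y))^2"
    using dot_transpose[of y T "T *v y"]
    by (simp add: power2_norm_eq_inner pos_def_sym[OF T(1)] matrix_vector_mul_assoc T(2))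
  also have "\<dots> \<le> (norm T * norm y)^2" by (intro power_mono norm_matrix_vector_le) simp
  also have "\<dots> = trace N * (y \<bullet> y)"
    by (simp add: power_mult_distrib norm_matrix_sq pos_def_sym[OF T(1)] T(2) power2_norm_eq_inner)
  finally show ?thesis .
qed

text \<open>Congruence by P^(-1/2) turns \<open>D\<close> into a positive definite matrix of trace
  tr (D P^-1), and the form of a definite matrix is bounded by its trace.\<close>

lemma relative_trace_bound:
  fixes P D :: "real^'n^'n"
  assumes P: "pos_def P" and D: "pos_def D"
  shows "x \<bullet> (D *v x) \<le> trace (D ** matrix_inv P) * (x \<bullet> (P *v x))"
proof -
  obtain S where S: "pos_def S" "S ** S = P" using pd_sqrt_exists[OF P] .
  define R where "R = matrix_inv S"
  note inv = pos_def_inverse[OF S(1), folded R_def]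
  have sym: "transpose S = S" "transpose R = R" using S(1) inv(3) by (auto simp: pos_def_sym)
  have "P ** (R ** R) = mat 1" by (simp add: matrix_mul_assoc matrix_mult_cancel[OF inv(1)] inv flip: S(2))
  then have Pinv: "matrix_inv P = R ** R" by (rule right_inverse_unique)
  have N: "pos_def (R ** D ** R)" using pos_def_congruence[OF D inv(2)] by (simp add: sym)
  have "D = S ** (R ** D ** R) ** S" by (simp add: matrix_mul_assoc matrix_mult_cancel[OF inv(2)] inv)
  then have "x \<bullet> (D *v x) = x \<bullet> ((S ** (R ** D ** R) ** S) *v x)" by simp
  also have "\<dots> = (S *v x) \<bullet> ((R ** D ** R) *v (S *v x))"
    by (simp add: matrix_vector_mul_assoc[symmetric] dot_transpose[of x S] sym)
  also have "\<dots> \<le> trace (R ** D ** R) * ((S *v x) \<bullet> (S *v x))" by (rule quadratic_form_le_trace[OF N])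
  also have "(S *v x) \<bullet> (S *v x) = x \<bullet> (P *v x)"
    using dot_transpose[of x S "S *v x"] by (simp add: sym S(2) matrix_vector_mul_assoc)
  also have "trace (R ** D ** R) = trace (D ** matrix_inv P)"
    unfolding Pinv by (metis matrix_mul_assoc trace_mul_sym)
  finally show ?thesis .
qed

text \<open>Deflating the top eigenvector, \<open>H - \<lambda> x x\<^sup>T\<close> has trace \<open>t - \<lambda>\<close> and squared norm
  \<open>s - \<lambda>\<^sup>2\<close>; Cauchy--Schwarz against the projection \<open>I - x x\<^sup>T\<close> of squared norm \<open>n - 1\<close>
  gives \<open>(t - \<lambda>)\<^sup>2 \<le> (n - 1) (s - \<lambda>\<^sup>2)\<close>.\<close>
lemma quadratic_form_le_trace_moments:
  fixes H :: "real^'n^'n"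
  assumes H: "transpose H = H"
  defines "n \<equiv> real CARD('n)"
  shows "y \<bullet> (H *v y) \<le> (trace H / n + sqrt ((n - 1) / n * (trace (H ** H) - (trace H)^2 / n))) * (y \<bullet> y)"
proof -
  obtain x where x: "norm x = 1" "H *v x = lambda_max H *\<^sub>R x"
    and le: "\<And>y. y \<bullet> (H *v y) \<le> lambda_max H * (y \<bullet> y)" using lambda_max_symmetric[OF H] by metis
  define l t s where "l = lambda_max H" and "t = trace H" and "s = trace (H ** H)"
  have n: "n > 0" by (simp add: n_def)
  have xx: "x \<bullet> x = 1" using x(1) by (simp add: norm_eq_1)
  define E :: "real^'n^'n" where "E = (\<chi> i j. x $ i * x $ j)"
  have IM: "mat 1 \<bullet> M = trace M" for M :: "real^'n^'n"
    by (simp add: inner_vec_def trace_def mat_def if_distrib if_distribR cong: if_cong)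
  have xE: "(\<Sum>i\<in>UNIV. x $ i * x $ i) = 1" using xx by (simp add: inner_vec_def)
  have EM: "E \<bullet> M = x \<bullet> (M *v x)" for M
    by (simp add: inner_vec_def E_def matrix_vector_mult_def sum_distrib_left mult_ac)
  have Ex: "E *v x = x"
    using xE by (simp add: vec_eq_iff E_def matrix_vector_mult_def mult.assoc flip: sum_distrib_left)
  have EH: "E \<bullet> H = l" by (simp add: EM x(2) xx l_def)
  have EE: "E \<bullet> E = 1" by (simp add: EM Ex xx)
  have IE: "mat 1 \<bullet> E = 1" using xE by (simp add: IM trace_def E_def)
  have EI: "E \<bullet> mat 1 = 1" and HE: "H \<bullet> E = l" using IE EH by (simp_all add: inner_commute)
  have II: "mat 1 \<bullet> (mat 1 :: real^'n^'n) = n" by (simp add: IM trace_I n_def)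
  have HH: "H \<bullet> H = s"
    using norm_matrix_sq[of H] by (simp add: power2_norm_eq_inner H s_def)
  have IH: "mat 1 \<bullet> H = t" by (simp add: IM t_def)
  have "((mat 1 - E) \<bullet> (H - l *\<^sub>R E))^2 \<le> ((mat 1 - E) \<bullet> (mat 1 - E)) * ((H - l *\<^sub>R E) \<bullet> (H - l *\<^sub>R E))"
    by (rule Cauchy_Schwarz_ineq)
  also have "(mat 1 - E) \<bullet> (H - l *\<^sub>R E) = t - l"
    by (simp add: inner_diff_left inner_diff_right IH IE EH EE HE EI)
  also have "(mat 1 - E) \<bullet> (mat 1 - E) = n - 1"
    by (simp add: inner_diff_left inner_diff_right II EE IE EI)
  also have "(H - l *\<^sub>R E) \<bullet> (H - l *\<^sub>R E) = s - l^2"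
    by (simp add: inner_diff_left inner_diff_right HH EH EE HE power2_eq_square)
  finally have ineq: "(t - l)^2 \<le> (n - 1) * (s - l^2)" .
  have "n * (l - t / n)^2 \<le> n * ((n - 1) / n * (s - t^2 / n))"
  proof -
    have a: "n * (l - t / n)^2 = n * l^2 - 2 * t * l + t^2 / n"
      using n by (simp add: power2_eq_square field_simps)
    have b: "n * ((n - 1) / n * (s - t^2 / n)) = (n - 1) * s - t^2 + t^2 / n"
      using n by (simp add: field_simps)
    show ?thesis unfolding a b using ineq by (simp add: power2_eq_square algebra_simps)
  qed
  then have "(l - t / n)^2 \<le> (n - 1) / n * (s - t^2 / n)" using n mult_left_le_imp_le by blast
  then have "l - t / n \<le> sqrt ((n - 1) / n * (s - t^2 / n))" by (rule real_le_rsqrt)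
  then have "l \<le> t / n + sqrt ((n - 1) / n * (s - t^2 / n))" by simp
  then have "l * (y \<bullet> y) \<le> (t / n + sqrt ((n - 1) / n * (s - t^2 / n))) * (y \<bullet> y)"
    by (intro mult_right_mono) auto
  then show ?thesis using le[of y] by (simp add: l_def t_def s_def)
qed

text \<open>Cauchy-Schwarz against the identity. It keeps the radicand in \<open>delta_bar\<close>
  nonnegative; as \<open>sqrt\<close> is an odd function, a negative radicand would give a negative
  summand.\<close>

lemma trace_sq_le:
  fixes H :: "real^'n^'n"
  assumes H: "transpose H = H"
  shows "(trace H)^2 \<le> real CARD('n) * trace (H ** H)"
proof -
  have IM: "mat 1 \<bullet> M = trace M" for M :: "real^'n^'n"
    by (simp add: inner_vec_def trace_def mat_def if_distrib if_distribR cong: if_cong)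
  have "(mat 1 \<bullet> H)^2 \<le> (mat 1 \<bullet> (mat 1 :: real^'n^'n)) * (H \<bullet> H)" by (rule Cauchy_Schwarz_ineq)
  moreover have "H \<bullet> H = trace (H ** H)"
    using norm_matrix_sq[of H] by (simp add: power2_norm_eq_inner H)
  ultimately show ?thesis by (simp add: IM trace_I)
qed

section \<open>Dependence of the solutions on the parameter\<close>

lemma pos_def_scaleR: "c > 0 \<Longrightarrow> pos_def M \<Longrightarrow> pos_def (c *\<^sub>R M)"
  by (simp add: pos_def_def transpose_scalar matrix_vector_scaleR_left)

lemma pos_def_add: "pos_def M \<Longrightarrow> pos_def N \<Longrightarrow> pos_def (M + N)"
  by (intro pos_def_add_semidef pos_def_imp_semidef)

context nested_riccati
begin

lemma rational_W: "rational_matrix_on {0<..} W"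
  by (rule lyap_solution_rational[OF stab, where s = "\<lambda>s. s" and C = "\<lambda>_. B ** transpose B"])
    (simp_all add: lyap_W)

lemma rational_X: "rational_matrix_on {0<..} X"
  by (rule rational_matrix_inverse[OF rational_W]) (rule WX)

lemma rational_V: "rational_matrix_on {0<..} V"
proof (rule lyap_solution_rational[OF stab_T, where s = "\<lambda>s. 3 * s", OF _ _ rational_X])
  show "rational_pos (\<lambda>s. 3 * s)" by (intro rational_pos_mult) simp_all
qed (simp_all add: lyap_V)

lemma rational_P: "rational_matrix_on {0<..} P"
proof -
  have "rational_matrix_on {0<..} Q"
    unfolding Q_def[abs_def]
    by (intro rational_matrix_diff rational_matrix_scaleR rational_pos_mult rational_X rational_V) simp_all
  then have "rational_matrix_on {0<..} Z"
    unfolding Z_def[abs_def] by (intro rational_matrix_mult rational_W)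
  then have "rational_matrix_on {0<..} Y"
    by (rule rational_matrix_inverse) (rule ZY)
  then show ?thesis
    unfolding P_def[abs_def] by (intro rational_matrix_diff rational_X)
qed

definition X' :: "real \<Rightarrow> real^'n^'n" where "X' \<gamma> = vector_derivative X (at \<gamma>)"
definition P' :: "real \<Rightarrow> real^'n^'n" where "P' \<gamma> = vector_derivative P (at \<gamma>)"

context
  fixes \<gamma> :: real assumes \<gamma>: "\<gamma> > 0"
begin

lemma has_derivative_X: "(X has_vector_derivative X' \<gamma>) (at \<gamma>)"
proof -
  obtain D where "(X has_vector_derivative D) (at \<gamma>)"
    by (rule rational_matrix_has_derivative[OF rational_X]) (use \<gamma> in blast)
  then show ?thesis unfolding X'_def by (simp add: vector_derivative_at)
qed

lemma has_derivative_P: "(P has_vector_derivative P' \<gamma>) (at \<gamma>)"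
proof -
  obtain D where "(P has_vector_derivative D) (at \<gamma>)"
    by (rule rational_matrix_has_derivative[OF rational_P]) (use \<gamma> in blast)
  then show ?thesis unfolding P'_def by (simp add: vector_derivative_at)
qed

lemma derivative_eqI:
  fixes F G :: "real \<Rightarrow> real^'n^'n"
  assumes "(F has_vector_derivative F') (at \<gamma>)" "(G has_vector_derivative G') (at \<gamma>)"
    and "\<And>t. t > 0 \<Longrightarrow> F t = G t"
  shows "F' = G'"
proof -
  have "(G has_vector_derivative F') (at \<gamma>)"
    by (rule has_vector_derivative_transform_within_open[OF assms(1), where S = "{0<..}"])
      (use \<gamma> assms(3) in auto)
  then show ?thesis using assms(2) by (rule vector_derivative_unique_at)
qed

lemma has_derivative_P_sol: "(P_sol A B has_vector_derivative P' \<gamma>) (at \<gamma>)"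
  by (rule has_vector_derivative_transform_within_open[OF has_derivative_P, where S = "{0<..}"])
    (use \<gamma> P_sol_eq in auto)

lemma dP_eq: "dP A B \<gamma> = P' \<gamma>"
  unfolding dP_def by (rule vector_derivative_at[OF has_derivative_P_sol])

lemma X'_T: "transpose (X' \<gamma>) = X' \<gamma>"
  by (rule derivative_eqI[OF has_vector_derivative_transpose[OF has_derivative_X] has_derivative_X]) (rule XT)

lemma P'_T: "transpose (P' \<gamma>) = P' \<gamma>"
  by (rule derivative_eqI[OF has_vector_derivative_transpose[OF has_derivative_P] has_derivative_P]) (rule PT)

lemma derivative_X_eq:
  "transpose A ** X' \<gamma> + X' \<gamma> ** A + (X \<gamma> ** B ** transpose B ** X' \<gamma> + X' \<gamma> ** B ** transpose B ** X \<gamma>)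
    = X \<gamma> + \<gamma> *\<^sub>R X' \<gamma>"
proof -
  note d = has_derivative_X has_vector_derivative_const has_vector_derivative_matrix_mult has_vector_derivative_add
  have l: "((\<lambda>t. transpose A ** X t + X t ** A + X t ** (B ** transpose B ** X t)) has_vector_derivative
      (transpose A ** X' \<gamma> + 0 ** X \<gamma>) + (X \<gamma> ** 0 + X' \<gamma> ** A)
      + (X \<gamma> ** (B ** transpose B ** X' \<gamma> + 0 ** X \<gamma>) + X' \<gamma> ** (B ** transpose B ** X \<gamma>))) (at \<gamma>)"
    by (intro d)
  have r: "((\<lambda>t. t *\<^sub>R X t) has_vector_derivative (\<gamma> *\<^sub>R X' \<gamma> + 1 *\<^sub>R X \<gamma>)) (at \<gamma>)"
    by (intro has_vector_derivative_scaleR has_derivative_X DERIV_ident)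
  have "transpose A ** X t + X t ** A + X t ** (B ** transpose B ** X t) = t *\<^sub>R X t" if "t > 0" for t
    using X_eq[OF that] by (simp add: matrix_mul_assoc)
  from derivative_eqI[OF l r this] show ?thesis
    by (simp add: matrix_mul_assoc matrix_add_ldistrib add.commute)
qed

text \<open>The derivative of the first equation is F^T X' + X' F - \<gamma> X' = X with F = A + B
  B^T X. Since F^T = X (\<gamma> - A) W, this is a Lyapunov equation with shift \<gamma> for X A W,
  a conjugate of A, and right-hand side X.\<close>

lemma X'_pos: "pos_def (X' \<gamma>)"
proof (rule lyap_pos_def)
  show "weakly_stable (X \<gamma> ** A ** W \<gamma>)" using weakly_stable_similar[OF XW[OF \<gamma>]] stab by simp
  have "\<gamma> *\<^sub>R X' \<gamma> - X \<gamma> ** A ** W \<gamma> ** X' \<gamma> - X' \<gamma> ** transpose (X \<gamma> ** A ** W \<gamma>)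
    = transpose (A + B ** transpose B ** X \<gamma>) ** X' \<gamma> + X' \<gamma> ** (A + B ** transpose B ** X \<gamma>) - \<gamma> *\<^sub>R X' \<gamma>"
    unfolding AX_T_eq[OF \<gamma>] unfolding AX_eq[OF \<gamma>]
    by (simp add: transpose_distribs WT[OF \<gamma>] XT[OF \<gamma>] matrix_ring_simps XW_simps[OF \<gamma>])
  also have "\<dots> = X \<gamma>"
  proof -
    have "transpose (A + B ** transpose B ** X \<gamma>) ** X' \<gamma> + X' \<gamma> ** (A + B ** transpose B ** X \<gamma>)
      = transpose A ** X' \<gamma> + X' \<gamma> ** A + (X \<gamma> ** B ** transpose B ** X' \<gamma> + X' \<gamma> ** B ** transpose B ** X \<gamma>)"
      by (simp add: transpose_distribs XT[OF \<gamma>] matrix_ring_simps)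
    then show ?thesis unfolding derivative_X_eq by simp
  qed
  finally show "pos_def (lyap_op (X \<gamma> ** A ** W \<gamma>) \<gamma> (X' \<gamma>))"
    using X_pos[OF \<gamma>] by (simp add: lyap_op_def)
qed (rule \<gamma>)

text \<open>The closed-loop matrix moved back by 2 \<gamma>: it is a conjugate of A, so the
  positivity results for weakly stable matrices apply to its transpose.\<close>

definition "M_cl = A - B ** transpose B ** P \<gamma> + (2 * \<gamma>) *\<^sub>R mat 1"

lemma M_cl_stable: "weakly_stable (transpose M_cl)"
proof -
  have "M_cl = (Z \<gamma> ** X \<gamma>) ** A ** (W \<gamma> ** Y \<gamma>)"
    unfolding M_cl_def closed_loop_eq[OF \<gamma>] by simp
  then show ?thesis
    using weakly_stable_similar[OF ZXWY[OF \<gamma>]] stab by (simp add: weakly_stable_transpose)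
qed

text \<open>The shift 3 \<gamma>, less 2 \<gamma> from each side, leaves - \<gamma> S. This cancels
  the \<gamma> P in the equation for P and the \<gamma> P' in its derivative.\<close>

lemma lyap_op_M_cl:
  "lyap_op (transpose M_cl) (3 * \<gamma>) S
    = - (transpose (A - B ** transpose B ** P \<gamma>) ** S + S ** (A - B ** transpose B ** P \<gamma>)) - \<gamma> *\<^sub>R S"
proof -
  have 3: "(3 * \<gamma>) *\<^sub>R S - (2 * \<gamma>) *\<^sub>R S - (2 * \<gamma>) *\<^sub>R S = - (\<gamma> *\<^sub>R S)"
    by (simp flip: scaleR_diff_left)
  have "lyap_op (transpose M_cl) (3 * \<gamma>) S
    = - (transpose (A - B ** transpose B ** P \<gamma>) ** S + S ** (A - B ** transpose B ** P \<gamma>))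
      + ((3 * \<gamma>) *\<^sub>R S - (2 * \<gamma>) *\<^sub>R S - (2 * \<gamma>) *\<^sub>R S)"
    unfolding lyap_op_def M_cl_def
    by (simp add: transpose_add transpose_scalar matrix_add_ldistrib matrix_add_rdistrib
        matrix_scaleR_left matrix_scaleR_right)
  then show ?thesis unfolding 3 by simp
qed

lemma lyap_M_cl_P: "lyap_op (transpose M_cl) (3 * \<gamma>) (P \<gamma>)
    = (2 * \<gamma>) *\<^sub>R X \<gamma> + P \<gamma> ** B ** transpose B ** P \<gamma>"
proof -
  have "transpose (A - B ** transpose B ** P \<gamma>) ** P \<gamma> + P \<gamma> ** (A - B ** transpose B ** P \<gamma>)
    = (transpose A ** P \<gamma> + P \<gamma> ** A - P \<gamma> ** B ** transpose B ** P \<gamma>) - P \<gamma> ** B ** transpose B ** P \<gamma>"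
    by (simp add: transpose_distribs PT[OF \<gamma>] matrix_ring_simps)
  then show ?thesis unfolding lyap_op_M_cl P_eq[OF \<gamma>]
    by (simp add: scaleR_add_right)
qed

lemma derivative_P_eq:
  "transpose A ** P' \<gamma> + P' \<gamma> ** A - (P \<gamma> ** B ** transpose B ** P' \<gamma> + P' \<gamma> ** B ** transpose B ** P \<gamma>)
    = - (P \<gamma> + 2 *\<^sub>R X \<gamma> + \<gamma> *\<^sub>R (P' \<gamma> + 2 *\<^sub>R X' \<gamma>))"
proof -
  note d = has_derivative_P has_vector_derivative_const has_vector_derivative_matrix_mult
    has_vector_derivative_add has_vector_derivative_diff
  have l: "((\<lambda>t. transpose A ** P t + P t ** A - P t ** (B ** transpose B ** P t)) has_vector_derivative
      (transpose A ** P' \<gamma> + 0 ** P \<gamma>) + (P \<gamma> ** 0 + P' \<gamma> ** A)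
      - (P \<gamma> ** (B ** transpose B ** P' \<gamma> + 0 ** P \<gamma>) + P' \<gamma> ** (B ** transpose B ** P \<gamma>))) (at \<gamma>)"
    by (intro d)
  have "((\<lambda>t. 2 *\<^sub>R X t) has_vector_derivative 2 *\<^sub>R X' \<gamma>) (at \<gamma>)"
    by (rule bounded_linear.has_vector_derivative[OF bounded_linear_scaleR_right has_derivative_X])
  then have r: "((\<lambda>t. - (t *\<^sub>R (P t + 2 *\<^sub>R X t))) has_vector_derivative
      - (\<gamma> *\<^sub>R (P' \<gamma> + 2 *\<^sub>R X' \<gamma>) + 1 *\<^sub>R (P \<gamma> + 2 *\<^sub>R X \<gamma>))) (at \<gamma>)"
    by (intro has_vector_derivative_minus has_vector_derivative_scaleR has_vector_derivative_add
        has_derivative_P DERIV_ident)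
  have "transpose A ** P t + P t ** A - P t ** (B ** transpose B ** P t) = - (t *\<^sub>R (P t + 2 *\<^sub>R X t))"
    if "t > 0" for t
    using P_eq[OF that] by (simp add: matrix_mul_assoc)
  from derivative_eqI[OF l r this] show ?thesis
    by (simp add: matrix_mul_assoc matrix_add_ldistrib add_ac)
qed

lemma lyap_M_cl_P': "lyap_op (transpose M_cl) (3 * \<gamma>) (P' \<gamma>)
    = P \<gamma> + 2 *\<^sub>R X \<gamma> + (2 * \<gamma>) *\<^sub>R X' \<gamma>"
proof -
  have "transpose (A - B ** transpose B ** P \<gamma>) ** P' \<gamma> + P' \<gamma> ** (A - B ** transpose B ** P \<gamma>)
    = transpose A ** P' \<gamma> + P' \<gamma> ** A - (P \<gamma> ** B ** transpose B ** P' \<gamma> + P' \<gamma> ** B ** transpose B ** P \<gamma>)"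
    by (simp add: transpose_distribs PT[OF \<gamma>] matrix_ring_simps)
  then show ?thesis unfolding lyap_op_M_cl derivative_P_eq
    by (simp add: scaleR_add_right mult.commute)
qed

lemma PGP_le: "x \<bullet> ((P \<gamma> ** B ** transpose B ** P \<gamma>) *v x) \<le> 2 * real CARD('n) * \<gamma> * (x \<bullet> (P \<gamma> *v x))"
  using trace_bound_quadratic[OF P_pos[OF \<gamma>], of x B] unfolding trace_BPB[OF \<gamma>] .

text \<open>Compare Lyapunov right-hand sides. With c = 2 n \<gamma>, the bounds P B B^T P \<le> c P
  and 2 \<gamma> X \<le> c X leave at least X + 2 \<gamma> X', which is definite.\<close>

lemma P'_lower: "pos_def (P' \<gamma> - (1 / (2 * real CARD('n) * \<gamma>)) *\<^sub>R P \<gamma>)"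
proof (rule lyap_pos_def[OF M_cl_stable])
  define c where "c = 2 * real CARD('n) * \<gamma>"
  have c: "c > 0" "2 * \<gamma> \<le> c" using \<gamma> by (auto simp: c_def intro!: Suc_leI)
  let ?G = "P \<gamma> ** B ** transpose B ** P \<gamma>"
  let ?R = "P \<gamma> + 2 *\<^sub>R X \<gamma> + (2 * \<gamma>) *\<^sub>R X' \<gamma> - (1 / c) *\<^sub>R ((2 * \<gamma>) *\<^sub>R X \<gamma> + ?G)"
  have "lyap_op (transpose M_cl) (3 * \<gamma>) (P' \<gamma> - (1 / c) *\<^sub>R P \<gamma>) = ?R"
    by (simp add: lyap_op_diff lyap_op_scaleR lyap_M_cl_P lyap_M_cl_P')
  moreover have "pos_def ?R"
    unfolding pos_def_def
  proof (intro conjI allI impI)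
    show "transpose ?R = ?R"
      by (simp add: transpose_distribs XT[OF \<gamma>] PT[OF \<gamma>] X'_T matrix_mul_assoc)
    fix x :: "real^'n" assume x: "x \<noteq> 0"
    have X: "x \<bullet> (X \<gamma> *v x) > 0" and X'x: "x \<bullet> (X' \<gamma> *v x) > 0"
      using pos_def_gt0[OF X_pos[OF \<gamma>] x] pos_def_gt0[OF X'_pos x] by auto
    have "x \<bullet> (?G *v x) / c \<le> x \<bullet> (P \<gamma> *v x)"
    proof -
      have "x \<bullet> (?G *v x) \<le> c * (x \<bullet> (P \<gamma> *v x))" using PGP_le[of x] unfolding c_def .
      then show ?thesis using c by (simp add: pos_divide_le_eq mult.commute)
    qed
    moreover have "2 * \<gamma> * (x \<bullet> (X \<gamma> *v x)) / c \<le> x \<bullet> (X \<gamma> *v x)"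
      using c X by (simp add: pos_divide_le_eq mult.commute)
    moreover have "2 * \<gamma> * (x \<bullet> (X' \<gamma> *v x)) > 0" using \<gamma> X'x by simp
    ultimately show "0 < x \<bullet> (?R *v x)" using X
      by (simp add: quadratic_form_simps add_divide_distrib)
  qed
  ultimately show "pos_def (lyap_op (transpose M_cl) (3 * \<gamma>) (P' \<gamma> - (1 / (2 * real CARD('n) * \<gamma>)) *\<^sub>R P \<gamma>))"
    by (simp add: c_def)
qed (use \<gamma> in simp)

lemma P'_pos: "pos_def (P' \<gamma>)"
proof -
  have "pos_def ((P' \<gamma> - (1 / (2 * real CARD('n) * \<gamma>)) *\<^sub>R P \<gamma>) + (1 / (2 * real CARD('n) * \<gamma>)) *\<^sub>R P \<gamma>)"
    using \<gamma> by (intro pos_def_add pos_def_scaleR P'_lower P_pos) auto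
  then show ?thesis by simp
qed

end

lemma P'_upper:
  obtains C where "C > 0" "\<And>\<gamma> x. \<gamma> > 0 \<Longrightarrow> \<gamma> * (x \<bullet> (P' \<gamma> *v x)) \<le> C * (x \<bullet> (P \<gamma> *v x))"
proof -
  have inv: "P t ** matrix_inv (P t) = mat 1" "matrix_inv (P t) ** P t = mat 1" if "t > 0" for t
    using pos_def_inverse[OF P_pos[OF that]] by auto
  have rat: "rational_pos (\<lambda>t. det (P t))"
    by (intro rational_pos_det) (use rational_P in \<open>simp add: rational_matrix_on_iff\<close>)
  have nz: "det (P t) \<noteq> 0" if "t > 0" for t
    using arg_cong[OF inv(1)[OF that], of det] by (auto simp: det_mul)
  define f' where "f' t = det (P t) * trace (P' t ** matrix_inv (P t))" for t
  have der: "((\<lambda>t. det (P t)) has_real_derivative f' t) (at t)" if "t > 0" for t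
    unfolding f'_def by (rule has_real_derivative_det[OF has_derivative_P[OF that] inv(2)[OF that]])
  obtain C where "\<And>t. t > 0 \<Longrightarrow> \<bar>t * f' t\<bar> \<le> C * \<bar>det (P t)\<bar>"
    using rational_pos_log_derivative_bound[OF rat nz der] by blast
  then have C: "\<bar>t * (det (P t) * trace (P' t ** matrix_inv (P t)))\<bar> \<le> C * \<bar>det (P t)\<bar>" if "t > 0" for t
    using that by (simp add: f'_def)
  show thesis
  proof (rule that)
    show "\<bar>C\<bar> + 1 > 0" by simp
    fix t x assume t: "(t::real) > 0"
    have "(t * trace (P' t ** matrix_inv (P t))) * \<bar>det (P t)\<bar> \<le> \<bar>t * (det (P t) * trace (P' t ** matrix_inv (P t)))\<bar>"
      using abs_ge_self[of "t * trace (P' t ** matrix_inv (P t))"]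
      unfolding mult.left_commute[of t] abs_mult[of "det (P t)"]
      by (simp add: mult.commute mult_left_mono)
    also have "\<dots> \<le> (\<bar>C\<bar> + 1) * \<bar>det (P t)\<bar>"
      using C[OF t] by (rule order_trans) (intro mult_right_mono, auto)
    finally have b: "t * trace (P' t ** matrix_inv (P t)) \<le> \<bar>C\<bar> + 1"
      using nz[OF t] by (simp add: mult_le_cancel_right)
    have "t * (x \<bullet> (P' t *v x)) \<le> t * (trace (P' t ** matrix_inv (P t)) * (x \<bullet> (P t *v x)))"
      using t by (intro mult_left_mono relative_trace_bound P_pos P'_pos) auto
    also have "\<dots> \<le> (\<bar>C\<bar> + 1) * (x \<bullet> (P t *v x))"
      unfolding mult.assoc[symmetric]
      using b pos_def_ge0[OF P_pos[OF t]] by (intro mult_right_mono) auto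
    finally show "t * (x \<bullet> (P' t *v x)) \<le> (\<bar>C\<bar> + 1) * (x \<bullet> (P t *v x))" .
  qed
qed

text \<open>With S = P^(1/2) one has 2 n \<gamma> P' = S H S, so a bound for the form of H at S x is
  a bound relative to P at x.\<close>

lemma delta_bar_bounds:
  assumes \<gamma>: "\<gamma> > 0"
  shows "delta_bar A B \<gamma> > 0"
    "2 * real CARD('n) * \<gamma> * (x \<bullet> (P' \<gamma> *v x)) \<le> delta_bar A B \<gamma> * (x \<bullet> (P \<gamma> *v x))"
proof -
  define n where "n = real CARD('n)"
  define S where "S = pd_sqrt (P \<gamma>)"
  define R where "R = matrix_inv S"
  note S = pd_sqrt[OF P_pos[OF \<gamma>], folded S_def]
  note inv = pos_def_inverse[OF S(1), folded R_def]
  have sym: "transpose S = S" "transpose R = R" using S(1) inv(3) by (auto simp: pos_def_sym)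
  define H where "H = (2 * n * \<gamma>) *\<^sub>R (R ** P' \<gamma> ** R)"
  have H: "H_mat A B \<gamma> = H"
    by (simp add: H_mat_def Let_def P_sol_eq[OF \<gamma>] dP_eq[OF \<gamma>] H_def n_def R_def S_def)
  have n: "n \<ge> 1" by (simp add: n_def Suc_leI)
  have Hpos: "pos_def H"
    using pos_def_congruence[OF P'_pos[OF \<gamma>] inv(2)] \<gamma> n unfolding H_def
    by (intro pos_def_scaleR) (simp_all add: sym)
  have db: "delta_bar A B \<gamma> = trace H / n + sqrt ((n - 1) / n * (trace (H ** H) - (trace H)^2 / n))"
    by (simp add: delta_bar_def Let_def H n_def)
  have "trace (H ** H) - (trace H)^2 / n \<ge> 0"
    using trace_sq_le[OF pos_def_sym[OF Hpos]] n by (simp add: n_def[symmetric] pos_divide_le_eq mult.commute)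
  then have "sqrt ((n - 1) / n * (trace (H ** H) - (trace H)^2 / n)) \<ge> 0" using n by simp
  moreover have "trace H / n > 0" using trace_pos_def[OF Hpos] n by simp
  ultimately show "delta_bar A B \<gamma> > 0" unfolding db by linarith
  have "(2 * n * \<gamma>) *\<^sub>R P' \<gamma> = S ** H ** S"
    by (simp add: H_def matrix_ring_simps matrix_mult_cancel[OF inv(2)] inv)
  then have "2 * n * \<gamma> * (x \<bullet> (P' \<gamma> *v x)) = x \<bullet> ((S ** H ** S) *v x)"
    by (metis inner_scaleR_right matrix_vector_scaleR_left)
  also have "\<dots> = (S *v x) \<bullet> (H *v (S *v x))"
    by (simp add: matrix_vector_mul_assoc[symmetric] dot_transpose[of x S] sym)
  also have "\<dots> \<le> delta_bar A B \<gamma> * ((S *v x) \<bullet> (S *v x))"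
    unfolding db n_def by (rule quadratic_form_le_trace_moments[OF pos_def_sym[OF Hpos]])
  also have "(S *v x) \<bullet> (S *v x) = x \<bullet> (P \<gamma> *v x)"
    using dot_transpose[of x S "S *v x"] by (simp add: sym S(2) matrix_vector_mul_assoc)
  finally show "2 * real CARD('n) * \<gamma> * (x \<bullet> (P' \<gamma> *v x)) \<le> delta_bar A B \<gamma> * (x \<bullet> (P \<gamma> *v x))"
    by (simp add: n_def)
qed

end

section \<open>Limits of bounded rational functions\<close>

text \<open>The bound forces a zero of order m: as x tends to 0 it gives p(0) = 0, and then one
  factor x cancels on both sides.\<close>

lemma poly_quotient_limit_at_0:
  fixes p q :: "real poly"
  assumes "poly q 0 \<noteq> 0"
    and "\<And>x. 0 < x \<Longrightarrow> x < d \<Longrightarrow> \<bar>poly p x\<bar> \<le> K * (x ^ m * \<bar>poly q x\<bar>)" "d > 0"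
  obtains r where "p = monom 1 m * r"
proof -
  have "\<exists>r. p = monom 1 m * r"
    using assms(2)
  proof (induction m arbitrary: p)
    case 0
    then show ?case by (intro exI[of _ p]) (simp add: monom_0)
  next
    case (Suc m)
    have "poly p 0 = 0"
    proof -
      have "((\<lambda>x. K * (x ^ Suc m * \<bar>poly q x\<bar>)) \<longlongrightarrow> K * (0 ^ Suc m * \<bar>poly q 0\<bar>)) (at_right 0)"
        by (intro tendsto_intros)
      moreover have "eventually (\<lambda>x. x \<in> {0<..<d}) (at_right 0)"
        using \<open>d > 0\<close> by (rule eventually_at_right_real)
      then have "eventually (\<lambda>x. norm (poly p x) \<le> K * (x ^ Suc m * \<bar>poly q x\<bar>)) (at_right 0)"
        by eventually_elim (use Suc.prems in auto)
      ultimately have "(poly p \<longlongrightarrow> 0) (at_right 0)"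
        by (intro Lim_null_comparison[of "poly p"]) auto
      moreover have "(poly p \<longlongrightarrow> poly p 0) (at_right 0)" by (intro tendsto_intros)
      ultimately show ?thesis using tendsto_unique trivial_limit_at_right_real by blast
    qed
    then obtain r where r: "p = [:0, 1:] * r" using poly_eq_0_iff_dvd[of p 0] by auto
    have "\<bar>poly r x\<bar> \<le> K * (x ^ m * \<bar>poly q x\<bar>)" if "0 < x" "x < d" for x
    proof -
      have "x * \<bar>poly r x\<bar> \<le> x * (K * (x ^ m * \<bar>poly q x\<bar>))"
        using Suc.prems[OF that] that(1) by (simp add: r abs_mult mult_ac)
      then show ?thesis using that(1) by simp
    qed
    then obtain s where "r = monom 1 m * s" using Suc.IH by blast
    then have "p = monom 1 (Suc m) * s" by (simp add: r monom_Suc)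
    then show ?case by blast
  qed
  then show thesis using that by blast
qed

text \<open>Write q = x^m s with s(0) \<noteq> 0. Boundedness makes x^m divide p as well, so f
  equals r / s to the right of 0 and tends to r(0) / s(0).\<close>

lemma rational_pos_bounded_limit_at_right:
  assumes f: "rational_pos f" and d: "d > 0" and K: "\<And>x. 0 < x \<Longrightarrow> x < d \<Longrightarrow> \<bar>f x\<bar> \<le> K"
  obtains l where "(f \<longlongrightarrow> l) (at_right 0)"
proof -
  from f obtain p q where pq: "\<And>\<gamma>. \<gamma> > 0 \<Longrightarrow> poly q \<gamma> \<noteq> 0" "\<And>\<gamma>. \<gamma> > 0 \<Longrightarrow> f \<gamma> = poly p \<gamma> / poly q \<gamma>"
    unfolding rational_pos_def by blast
  have "q \<noteq> 0" using pq(1)[of 1] by auto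
  obtain s where s: "q = [:- 0, 1:] ^ order 0 q * s" "\<not> [:- 0, 1:] dvd s"
    using order_decomp[OF \<open>q \<noteq> 0\<close>] by blast
  define m where "m = order 0 q"
  have qs: "poly q x = x ^ m * poly s x" for x
    by (subst s(1)) (simp add: m_def)
  have s0: "poly s 0 \<noteq> 0" using s(2) by (simp add: poly_eq_0_iff_dvd)
  have "\<bar>poly p x\<bar> \<le> K * (x ^ m * \<bar>poly s x\<bar>)" if "0 < x" "x < d" for x
  proof -
    have "\<bar>poly p x\<bar> = \<bar>f x\<bar> * \<bar>poly q x\<bar>" proof -
      have "poly p x = f x * poly q x" using pq[OF that(1)] by simp
      then show ?thesis by (simp add: abs_mult)
    qed
    also have "\<dots> \<le> K * \<bar>poly q x\<bar>" using K[OF that] by (intro mult_right_mono) auto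
    finally show ?thesis using that(1) by (simp add: qs abs_mult)
  qed
  then obtain r where r: "p = monom 1 m * r"
    using poly_quotient_limit_at_0[OF s0 _ d] by blast
  have "((\<lambda>x. poly r x / poly s x) \<longlongrightarrow> poly r 0 / poly s 0) (at_right 0)"
    by (intro tendsto_intros s0)
  moreover have "eventually (\<lambda>x. x \<in> {0<..<1}) (at_right (0::real))"
    by (rule eventually_at_right_real) simp
  then have "eventually (\<lambda>x. poly r x / poly s x = f x) (at_right 0)"
  proof eventually_elim
    case (elim x)
    then show ?case using pq(2)[of x] by (simp add: r qs poly_monom)
  qed
  ultimately have "(f \<longlongrightarrow> poly r 0 / poly s 0) (at_right 0)" by (rule Lim_transform_eventually)
  then show thesis by (rule that)
qed

lemma rational_pos_inverse_argument:
  assumes "rational_pos f" shows "rational_pos (\<lambda>x. f (inverse x))"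
proof -
  from assms obtain p q where pq: "\<And>\<gamma>. \<gamma> > 0 \<Longrightarrow> poly q \<gamma> \<noteq> 0" "\<And>\<gamma>. \<gamma> > 0 \<Longrightarrow> f \<gamma> = poly p \<gamma> / poly q \<gamma>"
    unfolding rational_pos_def by blast
  have ev: "poly r (inverse x) = poly (reflect_poly r) x / x ^ degree r" if "x > 0" for r :: "real poly" and x
    using poly_reflect_poly_nz[of x r] that by simp
  show ?thesis
  proof (rule rational_posI)
    fix x :: real assume x: "x > 0"
    have "poly q (inverse x) \<noteq> 0" "f (inverse x) = poly p (inverse x) / poly q (inverse x)"
      using pq[of "inverse x"] x by auto
    \<comment> \<open>The reflected polynomials carry the denominators x^(deg p) and x^(deg q),
      which trade places in the quotient.\<close>
    then show "poly (monom 1 (degree p) * reflect_poly q) x \<noteq> 0 \<and>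
      f (inverse x) = poly (monom 1 (degree q) * reflect_poly p) x / poly (monom 1 (degree p) * reflect_poly q) x"
      using x by (simp add: ev[OF x] poly_monom mult.commute)
  qed
qed

lemma rational_pos_bounded_limit_at_top:
  assumes f: "rational_pos f" and K: "\<And>x. x > 1 \<Longrightarrow> \<bar>f x\<bar> \<le> K"
  obtains l where "(f \<longlongrightarrow> l) at_top"
proof -
  obtain l where "((\<lambda>x. f (inverse x)) \<longlongrightarrow> l) (at_right 0)"
  proof (rule rational_pos_bounded_limit_at_right[OF rational_pos_inverse_argument[OF f], of 1 K])
    show "\<bar>f (inverse x)\<bar> \<le> K" if "0 < x" "x < 1" for x
      using that by (intro K) (simp add: one_less_inverse)
  qed auto
  then have "(f \<longlongrightarrow> l) at_top" by (simp add: filterlim_at_top_to_right)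
  then show thesis by (rule that)
qed

lemma rational_pos_power: "rational_pos f \<Longrightarrow> rational_pos (\<lambda>x. f x ^ k)"
  by (induction k) (auto intro: rational_pos_mult)

section \<open>Growth of the solution\<close>

lemma trace_similar_square:
  fixes S M T :: "real^'n^'n"
  assumes "T ** S = mat 1"
  shows "trace ((S ** M ** T) ** (S ** M ** T)) = trace (M ** M)"
proof -
  have "(S ** M ** T) ** (S ** M ** T) = S ** (M ** (T ** S) ** M) ** T" by (simp only: matrix_mul_assoc)
  then have "trace ((S ** M ** T) ** (S ** M ** T)) = trace (S ** (M ** M) ** T)" by (simp add: assms)
  also have "\<dots> = trace (T ** (S ** (M ** M)))" by (rule trace_mul_sym)
  also have "\<dots> = trace (M ** M)" by (simp add: matrix_mul_assoc assms)
  finally show ?thesis .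
qed

lemma lambda_max_scaleR:
  fixes M :: "real^'n^'n"
  assumes M: "transpose M = M" and c: "c > 0"
  shows "lambda_max (c *\<^sub>R M) = c * lambda_max M"
proof -
  have le: "lambda_max (c *\<^sub>R M) \<le> c * lambda_max M"
    if M: "transpose M = M" and c: "c > 0" for c and M :: "real^'n^'n"
  proof -
    have "transpose (c *\<^sub>R M) = c *\<^sub>R M" by (simp add: transpose_scalar M)
    then obtain x where x: "norm x = 1" "(c *\<^sub>R M) *v x = lambda_max (c *\<^sub>R M) *\<^sub>R x"
      using lambda_max_symmetric by metis
    obtain le: "\<And>y. y \<bullet> (M *v y) \<le> lambda_max M * (y \<bullet> y)" using lambda_max_symmetric[OF M] by metis
    have xx: "x \<bullet> x = 1" using x(1) by (simp add: norm_eq_1)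
    have "lambda_max (c *\<^sub>R M) = x \<bullet> ((c *\<^sub>R M) *v x)" by (simp add: x(2) xx)
    also have "\<dots> = c * (x \<bullet> (M *v x))" by (simp add: matrix_vector_scaleR_left)
    also have "\<dots> \<le> c * lambda_max M" using le[of x] c by (intro mult_left_mono) (simp_all add: xx)
    finally show ?thesis .
  qed
  have "lambda_max (inverse c *\<^sub>R (c *\<^sub>R M)) \<le> inverse c * lambda_max (c *\<^sub>R M)"
    using c by (intro le) (simp_all add: transpose_scalar M)
  then have "lambda_max M \<le> inverse c * lambda_max (c *\<^sub>R M)" using c by simp
  then have "c * lambda_max M \<le> lambda_max (c *\<^sub>R M)"
    using c by (simp add: inverse_eq_divide pos_le_divide_eq mult.commute)
  then show ?thesis using le[OF M c] by simp
qed

lemma square_le_expand: "0 \<le> (a::real) \<Longrightarrow> 0 \<le> t \<Longrightarrow> a * t \<le> a * (1 + t)^2"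
  by (intro mult_left_mono) (auto simp: power2_eq_square algebra_simps)

context nested_riccati
begin

definition "\<mu> = ctrb_index A B"

lemma mu_props: "\<mu> > 0" "ctrb_rank A B \<mu> = CARD('n)" "ctrb_rank A B (\<mu> - 1) \<noteq> CARD('n)"
proof -
  have "\<exists>k>0. ctrb_rank A B k = CARD('n)" using ctrb unfolding controllable_def
    by (intro exI[of _ "CARD('n)"]) simp
  then have "\<mu> > 0 \<and> ctrb_rank A B \<mu> = CARD('n)"
    unfolding \<mu>_def ctrb_index_def by (rule LeastI_ex)
  then show mu: "\<mu> > 0" "ctrb_rank A B \<mu> = CARD('n)" by auto
  show "ctrb_rank A B (\<mu> - 1) \<noteq> CARD('n)"
  \<comment> \<open>The minimum runs over positive integers, so minimality is silent about \<mu> - 1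
    = 0; there no block is present and the rank is 0.\<close>
  proof (cases "\<mu> = 1")
    case True
    have "ctrb_rank A B 0 = 0" by (simp add: ctrb_rank_def)
    then show ?thesis using True by simp
  next
    case False
    have "\<mu> - 1 < (LEAST k. 0 < k \<and> ctrb_rank A B k = CARD('n))"
      using mu(1) unfolding \<mu>_def ctrb_index_def by simp
    from not_less_Least[OF this] show ?thesis using False mu(1) by simp
  qed
qed

text \<open>Conjugated by \<open>S = P\<^sup>1\<^sup>/\<^sup>2\<close>, the closed-loop matrix \<open>F\<close> satisfies \<open>F\<^sup>T + F = - N\<close> with
  \<open>0 \<le> N = O(1 + \<gamma>)\<close>, so its Frobenius norm is determined by \<open>|F|\<^sup>2 = tr (N\<^sup>2) / 2 - tr (F\<^sup>2)\<close>,
  and \<open>tr (F\<^sup>2) = tr ((A - 2 \<gamma>)\<^sup>2)\<close> by similarity.\<close>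
lemma A_bounded_in_P_norm:
  obtains K where "K \<ge> 0"
    "\<And>\<gamma> x. \<gamma> > 0 \<Longrightarrow> (A *v x) \<bullet> (P \<gamma> *v (A *v x)) \<le> K * (1 + \<gamma>)^2 * (x \<bullet> (P \<gamma> *v x))"
proof -
  define n where "n = real CARD('n)"
  \<comment> \<open>N is the conjugate of \<gamma> (P + 2 X) + P B B^T P, so \<open>X_le_P\<close>
    and \<open>PGP_le\<close> bound it by \<gamma> + 2 n (\<gamma> - phi(A)) + 2 n \<gamma>, and
    this is at most k1 (1 + \<gamma>).\<close>
  define k1 where "k1 = 1 + 2 * n * (1 - phi A) + 2 * n"
  define K1 where "K1 = n * k1^2 / 2 + (\<bar>trace (A ** A)\<bar> + 4 * \<bar>trace A\<bar>)"
  have phi0: "phi A \<le> 0" by (rule phi_nonpos[OF stab])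
  have n: "n \<ge> 0" by (simp add: n_def)
  have k1: "k1 \<ge> 0" using n phi0 by (simp add: k1_def)
  have K1: "K1 \<ge> 0" using n by (simp add: K1_def)
  define K where "K = (sqrt K1 + 2 * n)^2"
  have main: "(A *v x) \<bullet> (P \<gamma> *v (A *v x)) \<le> K * (1 + \<gamma>)^2 * (x \<bullet> (P \<gamma> *v x))" if \<gamma>: "\<gamma> > 0" for \<gamma> x
  proof -
    define S where "S = pd_sqrt (P \<gamma>)"
    define R where "R = matrix_inv S"
    note S = pd_sqrt[OF P_pos[OF \<gamma>], folded S_def]
    note inv = pos_def_inverse[OF S(1), folded R_def]
    have sym: "transpose S = S" "transpose R = R" using S(1) inv(3) by (auto simp: pos_def_sym)
    note cancel = matrix_mult_cancel[OF inv(1)] matrix_mult_cancel[OF inv(2)] inv(1,2)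
    have normS: "(norm (S *v y))^2 = y \<bullet> (P \<gamma> *v y)" for y
      using dot_transpose[of y S "S *v y"] by (simp add: power2_norm_eq_inner sym S(2) matrix_vector_mul_assoc)
    define C where "C = A - B ** transpose B ** P \<gamma>"
    define G where "G = \<gamma> *\<^sub>R (P \<gamma> + 2 *\<^sub>R X \<gamma>) + P \<gamma> ** B ** transpose B ** P \<gamma>"
    define F where "F = S ** C ** R"
    define N where "N = R ** G ** R"
    have CG: "transpose C ** P \<gamma> + P \<gamma> ** C = - G"
    proof -
      have "transpose C ** P \<gamma> + P \<gamma> ** C
        = (transpose A ** P \<gamma> + P \<gamma> ** A - P \<gamma> ** B ** transpose B ** P \<gamma>) - P \<gamma> ** B ** transpose B ** P \<gamma>"
        by (simp add: C_def transpose_distribs PT[OF \<gamma>] matrix_ring_simps)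
      then show ?thesis unfolding P_eq[OF \<gamma>] by (simp add: G_def)
    qed
    have FN: "transpose F = - N - F"
    proof -
      have "R ** (transpose C ** P \<gamma> + P \<gamma> ** C) ** R = transpose F + F"
        unfolding S(2)[symmetric] F_def
        by (simp add: matrix_add_ldistrib matrix_add_rdistrib matrix_transpose_mul sym matrix_mul_assoc cancel)
      then have "transpose F + F = - N" unfolding CG N_def by (simp add: matrix_mult_minus_left matrix_mult_minus_right)
      then show ?thesis by (simp add: eq_diff_eq)
    qed
    have PG: "pos_semidef (P \<gamma> ** B ** transpose B ** P \<gamma>)"
      using pos_semidef_gram[of "P \<gamma> ** B"] by (simp add: matrix_transpose_mul PT[OF \<gamma>] matrix_mul_assoc)
    have Gpos: "pos_def G"
      unfolding G_def using \<gamma> by (intro pos_def_add_semidef PG pos_def_scaleR pos_def_add P_pos X_pos) auto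
    have Npos: "pos_def N" using pos_def_congruence[OF Gpos inv(2)] by (simp add: N_def sym)
    have Nle: "y \<bullet> (N *v y) \<le> k1 * (1 + \<gamma>) * (y \<bullet> y)" for y
    proof -
      let ?z = "R *v y"
      have "y \<bullet> (N *v y) = ?z \<bullet> (G *v ?z)"
        by (simp add: N_def matrix_vector_mul_assoc[symmetric] dot_transpose[of y R] sym)
      also have "\<dots> = \<gamma> * (?z \<bullet> (P \<gamma> *v ?z)) + 2 * (\<gamma> * (?z \<bullet> (X \<gamma> *v ?z)))
          + ?z \<bullet> ((P \<gamma> ** B ** transpose B ** P \<gamma>) *v ?z)"
        by (simp add: G_def quadratic_form_simps distrib_left)
      also have "\<dots> \<le> \<gamma> * (?z \<bullet> (P \<gamma> *v ?z)) + 2 * (n * (\<gamma> - phi A) * (?z \<bullet> (P \<gamma> *v ?z)))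
          + 2 * n * \<gamma> * (?z \<bullet> (P \<gamma> *v ?z))"
        using X_le_P[OF \<gamma>, of ?z] PGP_le[OF \<gamma>, of ?z] by (simp add: n_def)
      also have "\<dots> = (\<gamma> + 2 * n * (\<gamma> - phi A) + 2 * n * \<gamma>) * (?z \<bullet> (P \<gamma> *v ?z))"
        by (simp add: algebra_simps)
      also have "\<dots> \<le> (k1 * (1 + \<gamma>)) * (?z \<bullet> (P \<gamma> *v ?z))"
      proof (rule mult_right_mono)
        have "n * \<gamma> * phi A \<le> 0" using n \<gamma> phi0 by (simp add: mult_nonneg_nonpos)
        then show "\<gamma> + 2 * n * (\<gamma> - phi A) + 2 * n * \<gamma> \<le> k1 * (1 + \<gamma>)"
          using n \<gamma> by (simp add: k1_def algebra_simps)
      qed (rule pos_def_ge0[OF P_pos[OF \<gamma>]])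
      also have "?z \<bullet> (P \<gamma> *v ?z) = y \<bullet> y"
        unfolding normS[symmetric] by (simp add: power2_norm_eq_inner matrix_vector_mul_assoc inv)
      finally show ?thesis .
    qed
    have N2: "trace (N ** N) \<le> n * (k1 * (1 + \<gamma>))^2"
    proof -
      obtain T where T: "pos_def T" "T ** T = N" using pd_sqrt_exists[OF Npos] .
      have Tle: "(norm (T *v y))^2 \<le> k1 * (1 + \<gamma>) * (norm y)^2" for y
        using Nle[of y] dot_transpose[of y T "T *v y"]
        by (simp add: power2_norm_eq_inner pos_def_sym[OF T(1)] matrix_vector_mul_assoc T(2))
      have Ny: "(norm (N *v y))^2 \<le> (k1 * (1 + \<gamma>))^2 * (norm y)^2" for y
      proof -
        have "(norm (N *v y))^2 = (norm (T *v (T *v y)))^2" by (simp add: matrix_vector_mul_assoc T(2))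
        also have "\<dots> \<le> k1 * (1 + \<gamma>) * (norm (T *v y))^2" by (rule Tle)
        also have "\<dots> \<le> k1 * (1 + \<gamma>) * (k1 * (1 + \<gamma>) * (norm y)^2)"
          using k1 \<gamma> by (intro mult_left_mono Tle) auto
        finally show ?thesis by (simp add: power2_eq_square mult_ac)
      qed
      have "trace (N ** N) = (norm N)^2" by (simp add: norm_matrix_sq pos_def_sym[OF Npos])
      also have "\<dots> = (\<Sum>i\<in>UNIV. (norm (N *v axis i 1))^2)"
      proof -
        have "N *v axis i 1 = N $ i" for i
          using pos_def_sym[OF Npos] by (simp add: matrix_vector_mult_basis vec_eq_iff column_def transpose_def)
        then show ?thesis by (simp add: power2_norm_eq_inner inner_vec_def[of N])
      qed
      also have "\<dots> \<le> (\<Sum>i\<in>(UNIV::'n set). (k1 * (1 + \<gamma>))^2)"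
        using Ny by (intro sum_mono) (metis norm_axis_1 mult.right_neutral one_power2)
      finally show ?thesis by (simp add: n_def)
    qed
    have normF: "(norm F)^2 \<le> K1 * (1 + \<gamma>)^2"
    proof -
      \<comment> \<open>Transposing the product and inserting F^T = - N - F gives tr (N F) = - tr
        (N^2) - tr (N F).\<close>
      have tNF: "2 * trace (N ** F) = - trace (N ** N)"
      proof -
        have "trace (N ** F) = trace (transpose (N ** F))" by (simp only: trace_transpose)
        also have "\<dots> = trace ((- N - F) ** N)" by (simp add: matrix_transpose_mul FN pos_def_sym[OF Npos])
        also have "\<dots> = - trace (N ** N) - trace (F ** N)" by (simp add: matrix_ring_simps trace_distribs)
        also have "trace (F ** N) = trace (N ** F)" by (rule trace_mul_sym)
        finally show ?thesis by simp
      qed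
      have FF: "trace (F ** F) = trace (A ** A) - 4 * \<gamma> * trace A + 4 * \<gamma>^2 * n"
      proof -
        have inv': "(W \<gamma> ** Y \<gamma>) ** (Z \<gamma> ** X \<gamma>) = mat 1" using right_inverse_unique[OF ZXWY[OF \<gamma>]] by simp
        have C: "C = (Z \<gamma> ** X \<gamma>) ** (A - (2 * \<gamma>) *\<^sub>R mat 1) ** (W \<gamma> ** Y \<gamma>)"
          unfolding C_def closed_loop_eq[OF \<gamma>]
          by (simp only: matrix_diff_ldistrib matrix_diff_rdistrib matrix_scaleR_left matrix_scaleR_right
              matrix_mul_rid ZXWY[OF \<gamma>])
        have "trace (F ** F) = trace (C ** C)"
          unfolding F_def by (rule trace_similar_square[OF inv(2)])
        also have "\<dots> = trace ((A - (2 * \<gamma>) *\<^sub>R mat 1) ** (A - (2 * \<gamma>) *\<^sub>R mat 1))"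
          unfolding C by (rule trace_similar_square[OF inv'])
        also have "\<dots> = trace (A ** A) - 4 * \<gamma> * trace A + 4 * \<gamma>^2 * n"
          by (simp add: matrix_ring_simps trace_distribs trace_I n_def power2_eq_square) (simp add: algebra_simps)
        finally show ?thesis .
      qed
      have "(norm F)^2 = trace (transpose F ** F)" by (rule norm_matrix_sq')
      also have "\<dots> = - trace (N ** F) - trace (F ** F)" by (simp add: FN matrix_ring_simps trace_distribs)
      also have "\<dots> = trace (N ** N) / 2 - trace (F ** F)" using tNF by simp
      also have "\<dots> \<le> n * (k1 * (1 + \<gamma>))^2 / 2 + (\<bar>trace (A ** A)\<bar> + 4 * \<bar>trace A\<bar> * \<gamma>)"
      proof -
        have "\<gamma> * trace A \<le> \<gamma> * \<bar>trace A\<bar>" using \<gamma> by (intro mult_left_mono) auto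
        moreover have "0 \<le> \<gamma>^2 * n" using n by simp
        ultimately show ?thesis using N2 unfolding FF by (simp add: algebra_simps)
      qed
      also have "\<dots> \<le> n * k1^2 / 2 * (1 + \<gamma>)^2 + (\<bar>trace (A ** A)\<bar> * (1 + \<gamma>)^2 + 4 * \<bar>trace A\<bar> * (1 + \<gamma>)^2)"
      proof (intro add_mono)
        show "\<bar>trace (A ** A)\<bar> \<le> \<bar>trace (A ** A)\<bar> * (1 + \<gamma>)^2"
          using mult_left_mono[of 1 "(1 + \<gamma>)^2" "\<bar>trace (A ** A)\<bar>"] \<gamma> by (simp add: one_le_power)
        show "4 * \<bar>trace A\<bar> * \<gamma> \<le> 4 * \<bar>trace A\<bar> * (1 + \<gamma>)^2" using \<gamma> by (intro square_le_expand) auto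
      qed (simp add: power_mult_distrib)
      also have "\<dots> = K1 * (1 + \<gamma>)^2" by (simp add: K1_def distrib_right)
      finally show ?thesis .
    qed
    have SC: "norm (S *v (C *v x)) \<le> sqrt K1 * (1 + \<gamma>) * norm (S *v x)"
    proof -
      have "S *v (C *v x) = F *v (S *v x)"
        by (simp add: F_def matrix_vector_mul_assoc cancel)
      then have "norm (S *v (C *v x)) \<le> norm F * norm (S *v x)" by (simp add: norm_matrix_vector_le)
      also have "norm F \<le> sqrt (K1 * (1 + \<gamma>)^2)" using normF by (rule real_le_rsqrt)
      also have "sqrt (K1 * (1 + \<gamma>)^2) = sqrt K1 * (1 + \<gamma>)" using \<gamma> by (simp add: real_sqrt_mult)
      finally show ?thesis by (simp add: mult_right_mono)
    qed
    \<comment> \<open>S B B^T P x = (S B) (B^T S) (S x), and both factors have squared Frobenius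
      norm tr (B^T P B) = 2 n \<gamma>.\<close>
    have SB: "norm (S *v ((B ** transpose B ** P \<gamma>) *v x)) \<le> 2 * n * \<gamma> * norm (S *v x)"
    proof -
      have tr: "trace (transpose B ** S ** S ** B) = 2 * n * \<gamma>"
        using trace_BPB[OF \<gamma>] by (simp add: n_def matrix_mul_assoc flip: S(2))
      have n1: "(norm (S ** B))^2 = 2 * n * \<gamma>"
        unfolding norm_matrix_sq' using tr by (simp add: matrix_transpose_mul sym matrix_mul_assoc)
      have n2: "(norm (transpose B ** S))^2 = 2 * n * \<gamma>"
        unfolding norm_matrix_sq using tr by (simp add: matrix_transpose_mul sym matrix_mul_assoc)
      have "S *v ((B ** transpose B ** P \<gamma>) *v x) = (S ** B) *v ((transpose B ** S) *v (S *v x))"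
        by (simp add: matrix_vector_mul_assoc matrix_mul_assoc flip: S(2))
      then have "norm (S *v ((B ** transpose B ** P \<gamma>) *v x)) \<le> norm (S ** B) * norm ((transpose B ** S) *v (S *v x))"
        by (simp add: norm_matrix_vector_le)
      also have "\<dots> \<le> norm (S ** B) * (norm (transpose B ** S) * norm (S *v x))"
        by (intro mult_left_mono norm_matrix_vector_le) simp
      also have "\<dots> = (norm (S ** B) * norm (transpose B ** S)) * norm (S *v x)" by simp
      also have "norm (transpose B ** S) = norm (S ** B)"
        using n1 n2 by (metis norm_ge_zero power2_eq_imp_eq)
      finally show ?thesis using n1 by (simp add: power2_eq_square)
    qed
    have "A *v x = C *v x + (B ** transpose B ** P \<gamma>) *v x"
      by (simp add: C_def matrix_vector_mult_diff_rdistrib)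
    then have "norm (S *v (A *v x)) \<le> norm (S *v (C *v x)) + norm (S *v ((B ** transpose B ** P \<gamma>) *v x))"
      by (simp add: matrix_vector_right_distrib norm_triangle_ineq)
    also have "\<dots> \<le> sqrt K1 * (1 + \<gamma>) * norm (S *v x) + 2 * n * \<gamma> * norm (S *v x)"
      by (intro add_mono SC SB)
    also have "\<dots> \<le> (sqrt K1 + 2 * n) * (1 + \<gamma>) * norm (S *v x)"
      using n by (simp add: algebra_simps)
    finally have "(norm (S *v (A *v x)))^2 \<le> ((sqrt K1 + 2 * n) * (1 + \<gamma>) * norm (S *v x))^2"
      by (intro power_mono) auto
    then show ?thesis unfolding power_mult_distrib normS by (simp add: K_def)
  qed
  have "K \<ge> 0" by (simp add: K_def)
  from that[OF this main] show thesis .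
qed

end

lemma trace_congruence_columns:
  fixes M :: "real^'n^'n" and B :: "real^'m^'n"
  shows "trace (transpose B ** M ** B) = (\<Sum>j\<in>UNIV. column j B \<bullet> (M *v column j B))"
proof -
  have "(transpose B ** M ** B) $ j $ j = column j B \<bullet> (M *v column j B)" for j
  proof -
    have "(transpose B ** (M ** B)) $ j $ j = (\<Sum>i\<in>UNIV. column j B $ i * (M *v column j B) $ i)"
      by (simp add: matrix_matrix_mult_def transpose_def column_def matrix_vector_mult_def)
    then show ?thesis by (simp add: inner_vec_def matrix_mul_assoc)
  qed
  then show ?thesis by (simp add: trace_def)
qed

lemma matrix_limit_from_entries:
  fixes F :: "real \<Rightarrow> real^'n^'n"
  assumes "\<And>i j. \<exists>l. ((\<lambda>\<gamma>. F \<gamma> $ i $ j) \<longlongrightarrow> l) net"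
  obtains L where "(F \<longlongrightarrow> L) net"
proof -
  have "\<forall>i. \<exists>l. \<forall>j. ((\<lambda>\<gamma>. F \<gamma> $ i $ j) \<longlongrightarrow> l j) net"
    using assms by (intro allI choice)
  then obtain l where l: "\<forall>i j. ((\<lambda>\<gamma>. F \<gamma> $ i $ j) \<longlongrightarrow> l i j) net" using choice by metis
  have "(F \<longlongrightarrow> (\<chi> i j. l i j)) net"
    by (intro vec_tendstoI) (use l in simp)
  then show thesis by (rule that)
qed

context nested_riccati
begin

lemma P_psd: "\<gamma> > 0 \<Longrightarrow> 0 \<le> x \<bullet> (P \<gamma> *v x)"
  by (rule pos_def_ge0[OF P_pos])

text \<open>Vectors with this growth form a subspace, because 2 x . P y \<le> x . P x + y . P y, so
  the columns of A^i B with i < \<mu> suffice. Each factor A costs (1 + \<gamma>)^2, and at most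
  \<mu> - 1 of them occur.\<close>

lemma quadratic_form_growth:
  "\<exists>C. \<forall>\<gamma>>0. x \<bullet> (P \<gamma> *v x) \<le> C * (\<gamma> * (1 + \<gamma>)^(2 * \<mu> - 2))"
proof -
  define n where "n = real CARD('n)"
  obtain K where K: "K \<ge> 0"
    "\<And>\<gamma> x. \<gamma> > 0 \<Longrightarrow> (A *v x) \<bullet> (P \<gamma> *v (A *v x)) \<le> K * (1 + \<gamma>)^2 * (x \<bullet> (P \<gamma> *v x))"
    using A_bounded_in_P_norm by blast
  let ?M = "\<lambda>i. ((\<lambda>M. A ** M) ^^ i) B"
  have col: "column j (?M i) \<bullet> (P \<gamma> *v column j (?M i)) \<le> 2 * n * K^i * (\<gamma> * (1 + \<gamma>)^(2 * i))"
    if \<gamma>: "\<gamma> > 0" for \<gamma> i j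
  proof (induction i)
    case 0
    have "column j B \<bullet> (P \<gamma> *v column j B) \<le> (\<Sum>j\<in>UNIV. column j B \<bullet> (P \<gamma> *v column j B))"
      by (rule member_le_sum) (simp_all add: P_psd[OF \<gamma>])
    then show ?case using trace_BPB[OF \<gamma>] by (simp add: trace_congruence_columns n_def)
  next
    case (Suc i)
    have c: "column j (?M (Suc i)) = A *v column j (?M i)"
      by (simp add: vec_eq_iff column_def matrix_matrix_mult_def matrix_vector_mult_def)
    have "column j (?M (Suc i)) \<bullet> (P \<gamma> *v column j (?M (Suc i)))
      \<le> K * (1 + \<gamma>)^2 * (column j (?M i) \<bullet> (P \<gamma> *v column j (?M i)))"
      unfolding c by (rule K(2)[OF \<gamma>])
    also have "\<dots> \<le> K * (1 + \<gamma>)^2 * (2 * n * K^i * (\<gamma> * (1 + \<gamma>)^(2 * i)))"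
      using K(1) by (intro mult_left_mono Suc.IH) auto
    also have "\<dots> = 2 * n * K^Suc i * (\<gamma> * (1 + \<gamma>)^(2 * Suc i))"
      by (simp add: power2_eq_square mult_ac)
    finally show ?case .
  qed
  let ?S = "\<Union>i<\<mu>. columns (?M i)"
  let ?T = "{x. \<exists>C. \<forall>\<gamma>>0. x \<bullet> (P \<gamma> *v x) \<le> C * (\<gamma> * (1 + \<gamma>)^(2 * \<mu> - 2))}"
  have "x \<in> span ?S"
    using mu_props(2) dim_eq_full[of ?S] by (simp add: ctrb_rank_def)
  then show ?thesis
  proof (induction rule: span_induct)
    case base
    show ?case
      unfolding subspace_def
    proof (intro conjI ballI allI)
      show "0 \<in> ?T"
        by (auto intro: exI[of _ 0])
    next
      fix x y assume "x \<in> ?T"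
        "y \<in> ?T"
      then obtain C D where CD: "\<And>\<gamma>. \<gamma> > 0 \<Longrightarrow> x \<bullet> (P \<gamma> *v x) \<le> C * (\<gamma> * (1 + \<gamma>)^(2 * \<mu> - 2))"
        "\<And>\<gamma>. \<gamma> > 0 \<Longrightarrow> y \<bullet> (P \<gamma> *v y) \<le> D * (\<gamma> * (1 + \<gamma>)^(2 * \<mu> - 2))" by blast
      have "(x + y) \<bullet> (P \<gamma> *v (x + y)) \<le> (2 * C + 2 * D) * (\<gamma> * (1 + \<gamma>)^(2 * \<mu> - 2))" if \<gamma>: "\<gamma> > 0" for \<gamma>
      proof -
        have "0 \<le> (x + (- 1) *\<^sub>R y) \<bullet> (P \<gamma> *v (x + (- 1) *\<^sub>R y))" by (rule P_psd[OF \<gamma>])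
        then have "2 * (x \<bullet> (P \<gamma> *v y)) \<le> x \<bullet> (P \<gamma> *v x) + y \<bullet> (P \<gamma> *v y)"
          unfolding quadratic_form_add[OF PT[OF \<gamma>]] matrix_vector_mult_scaleR by simp
        then show ?thesis unfolding quadratic_form_add[OF PT[OF \<gamma>]]
          using CD(1)[OF \<gamma>] CD(2)[OF \<gamma>] unfolding distrib_right mult.assoc by linarith
      qed
      then show "x + y \<in> ?T" by blast
    next
      fix c x assume "x \<in> ?T"
      then obtain C where C: "\<And>\<gamma>. \<gamma> > 0 \<Longrightarrow> x \<bullet> (P \<gamma> *v x) \<le> C * (\<gamma> * (1 + \<gamma>)^(2 * \<mu> - 2))" by blast
      have "(c *\<^sub>R x) \<bullet> (P \<gamma> *v (c *\<^sub>R x)) \<le> (c^2 * C) * (\<gamma> * (1 + \<gamma>)^(2 * \<mu> - 2))" if \<gamma>: "\<gamma> > 0" for \<gamma>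
        using mult_left_mono[OF C[OF \<gamma>], of "c^2"]
        by (simp add: matrix_vector_mult_scaleR power2_eq_square mult.assoc)
      then show "c *\<^sub>R x \<in> ?T" by blast
    qed
  next
    case (step x)
    then obtain i j where ij: "i < \<mu>" "x = column j (?M i)" by (auto simp: columns_def)
    have "x \<bullet> (P \<gamma> *v x) \<le> (2 * n * K^i) * (\<gamma> * (1 + \<gamma>)^(2 * \<mu> - 2))" if \<gamma>: "\<gamma> > 0" for \<gamma>
    proof -
      have "x \<bullet> (P \<gamma> *v x) \<le> (2 * n * K^i) * (\<gamma> * (1 + \<gamma>)^(2 * i))" unfolding ij(2) by (rule col[OF \<gamma>])
      also have "\<dots> \<le> (2 * n * K^i) * (\<gamma> * (1 + \<gamma>)^(2 * \<mu> - 2))"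
        using \<gamma> ij(1) K(1) by (intro mult_left_mono power_increasing) (auto simp: n_def)
      finally show ?thesis .
    qed
    then show ?case by blast
  qed
qed

text \<open>Polarization: an entry of P is controlled by the forms at e_i, e_j and e_i +
  e_j.\<close>

lemma entry_growth:
  obtains C where "\<And>\<gamma>. \<gamma> > 0 \<Longrightarrow> \<bar>P \<gamma> $ i $ j\<bar> \<le> C * (\<gamma> * (1 + \<gamma>)^(2 * \<mu> - 2))"
proof -
  let ?g = "\<lambda>\<gamma>. \<gamma> * (1 + \<gamma>)^(2 * \<mu> - 2)"
  let ?e = "\<lambda>i. axis i 1 :: real^'n"
  obtain C1 C2 C3 where C: "\<And>\<gamma>. \<gamma> > 0 \<Longrightarrow> ?e i \<bullet> (P \<gamma> *v ?e i) \<le> C1 * ?g \<gamma>"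
    "\<And>\<gamma>. \<gamma> > 0 \<Longrightarrow> ?e j \<bullet> (P \<gamma> *v ?e j) \<le> C2 * ?g \<gamma>"
    "\<And>\<gamma>. \<gamma> > 0 \<Longrightarrow> (?e i + ?e j) \<bullet> (P \<gamma> *v (?e i + ?e j)) \<le> C3 * ?g \<gamma>"
    using quadratic_form_growth[of "?e i"] quadratic_form_growth[of "?e j"]
      quadratic_form_growth[of "?e i + ?e j"] by blast
  have "\<bar>P \<gamma> $ i $ j\<bar> \<le> (C1 + C2 + C3) * ?g \<gamma>" if \<gamma>: "\<gamma> > 0" for \<gamma>
  proof -
    have ij: "?e i \<bullet> (P \<gamma> *v ?e j) = P \<gamma> $ i $ j"
      by (simp add: matrix_vector_mult_basis inner_axis' column_def)
    note q = quadratic_form_add[OF PT[OF \<gamma>], of "?e i" "?e j", unfolded ij]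
    have "0 \<le> ?e i \<bullet> (P \<gamma> *v ?e i)" "0 \<le> ?e j \<bullet> (P \<gamma> *v ?e j)"
      "0 \<le> (?e i + ?e j) \<bullet> (P \<gamma> *v (?e i + ?e j))" by (rule P_psd[OF \<gamma>])+
    then have "\<bar>P \<gamma> $ i $ j\<bar> \<le> C1 * ?g \<gamma> + C2 * ?g \<gamma> + C3 * ?g \<gamma>"
      using C[OF \<gamma>] q by linarith
    then show ?thesis by (simp add: distrib_right)
  qed
  then show thesis by (rule that)
qed

lemma rational_P_entry: "rational_pos (\<lambda>\<gamma>. P \<gamma> $ i $ j)"
  using rational_P by (simp add: rational_matrix_on_iff)

text \<open>Entrywise limits give a limit matrix, symmetric like its approximants, to which
  \<open>lambda_max\<close> converges by continuity; the eventual lower bound c keeps the limit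
  positive.\<close>

lemma lambda_max_limit:
  fixes d :: "real \<Rightarrow> real"
  assumes lim: "\<And>i j. \<exists>l. ((\<lambda>\<gamma>. P \<gamma> $ i $ j / d \<gamma>) \<longlongrightarrow> l) net" and net: "net \<noteq> bot"
    and d: "eventually (\<lambda>\<gamma>. \<gamma> > 0 \<and> d \<gamma> > 0) net"
    and c: "c > 0" "eventually (\<lambda>\<gamma>. c \<le> lambda_max (P \<gamma>) / d \<gamma>) net"
  shows "\<exists>l>0. ((\<lambda>\<gamma>. lambda_max (P \<gamma>) / d \<gamma>) \<longlongrightarrow> l) net"
proof -
  define F where "F \<gamma> = (1 / d \<gamma>) *\<^sub>R P \<gamma>" for \<gamma>
  have "\<exists>l. ((\<lambda>\<gamma>. F \<gamma> $ i $ j) \<longlongrightarrow> l) net" for i j using lim[of i j] by (simp add: F_def)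
  then obtain L where L: "(F \<longlongrightarrow> L) net" using matrix_limit_from_entries by blast
  have sym: "eventually (\<lambda>\<gamma>. transpose (F \<gamma>) = F \<gamma>) net"
    using d by eventually_elim (simp add: F_def transpose_scalar PT)
  have LT: "transpose L = L"
  proof -
    have "L $ i $ j = L $ j $ i" for i j
    proof (rule tendsto_unique[OF net])
      show "((\<lambda>\<gamma>. F \<gamma> $ i $ j) \<longlongrightarrow> L $ i $ j) net" by (intro tendsto_vec_nth L)
      have "((\<lambda>\<gamma>. F \<gamma> $ j $ i) \<longlongrightarrow> L $ j $ i) net" by (intro tendsto_vec_nth L)
      moreover have "eventually (\<lambda>\<gamma>. F \<gamma> $ j $ i = F \<gamma> $ i $ j) net"
        using sym
      proof eventually_elim
        case (elim \<gamma>)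
        have "transpose (F \<gamma>) $ i $ j = F \<gamma> $ i $ j" unfolding elim ..
        then show ?case by (simp add: transpose_def)
      qed
      ultimately show "((\<lambda>\<gamma>. F \<gamma> $ i $ j) \<longlongrightarrow> L $ j $ i) net" by (rule Lim_transform_eventually)
    qed
    then show ?thesis by (simp add: vec_eq_iff transpose_def)
  qed
  have "((\<lambda>\<gamma>. lambda_max (F \<gamma>)) \<longlongrightarrow> lambda_max L) net" by (rule tendsto_lambda_max[OF L sym LT])
  moreover have "eventually (\<lambda>\<gamma>. lambda_max (F \<gamma>) = lambda_max (P \<gamma>) / d \<gamma>) net"
    using d by eventually_elim (simp add: F_def lambda_max_scaleR PT)
  ultimately have lim: "((\<lambda>\<gamma>. lambda_max (P \<gamma>) / d \<gamma>) \<longlongrightarrow> lambda_max L) net"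
    by (rule Lim_transform_eventually)
  have "c \<le> lambda_max L" by (rule tendsto_lowerbound[OF lim c(2) net])
  then show ?thesis using lim c(1) by (intro exI[of _ "lambda_max L"]) simp
qed

lemma le_lambda_max_P: "\<gamma> > 0 \<Longrightarrow> y \<bullet> (P \<gamma> *v y) \<le> lambda_max (P \<gamma>) * (y \<bullet> y)"
  using lambda_max_symmetric[OF PT] by metis

lemma limit_at_0: "\<exists>c2>0. ((\<lambda>\<gamma>. lambda_max (P \<gamma>) / \<gamma>) \<longlongrightarrow> c2) (at_right 0)"
proof -
  define n b where "n = real CARD('n)" and "b = (\<Sum>j\<in>UNIV. column j B \<bullet> column j B)"
  have n: "n > 0" by (simp add: n_def)
  have ge: "2 * n * \<gamma> \<le> lambda_max (P \<gamma>) * b" if \<gamma>: "\<gamma> > 0" for \<gamma>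
  proof -
    have "2 * n * \<gamma> = (\<Sum>j\<in>UNIV. column j B \<bullet> (P \<gamma> *v column j B))"
      using trace_BPB[OF \<gamma>] by (simp add: trace_congruence_columns n_def)
    also have "\<dots> \<le> (\<Sum>j\<in>UNIV. lambda_max (P \<gamma>) * (column j B \<bullet> column j B))"
      by (intro sum_mono le_lambda_max_P \<gamma>)
    finally show ?thesis by (simp add: b_def sum_distrib_left)
  qed
  have "b \<ge> 0" by (simp add: b_def sum_nonneg)
  \<comment> \<open>If B were 0, the trace identity at \<gamma> = 1 would give 2 n \<le> 0.\<close>
  moreover have "b \<noteq> 0" using ge[of 1] n by auto
  ultimately have b: "b > 0" by simp
  have pos: "eventually (\<lambda>\<gamma>::real. \<gamma> > 0) (at_right 0)" by (rule eventually_at_right_less)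
  show ?thesis
  proof (rule lambda_max_limit[where c = "2 * n / b" and d = "\<lambda>\<gamma>. \<gamma>" and net = "at_right 0"])
    fix i j
    obtain C where C: "\<And>\<gamma>. \<gamma> > 0 \<Longrightarrow> \<bar>P \<gamma> $ i $ j\<bar> \<le> C * (\<gamma> * (1 + \<gamma>)^(2 * \<mu> - 2))"
      using entry_growth by blast
    have "rational_pos (\<lambda>\<gamma>. P \<gamma> $ i $ j / \<gamma>)"
      by (intro rational_pos_divide rational_P_entry) simp_all
    moreover have "\<bar>P \<gamma> $ i $ j / \<gamma>\<bar> \<le> \<bar>C\<bar> * 2^(2 * \<mu> - 2)" if "0 < \<gamma>" "\<gamma> < 1" for \<gamma>
    proof -
      have "\<bar>P \<gamma> $ i $ j\<bar> \<le> \<bar>C\<bar> * (\<gamma> * (1 + \<gamma>)^(2 * \<mu> - 2))"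
        using C[OF that(1)] by (rule order_trans) (intro mult_right_mono, use that in auto)
      also have "\<dots> \<le> \<bar>C\<bar> * (\<gamma> * 2^(2 * \<mu> - 2))"
        using that by (intro mult_left_mono power_mono) auto
      finally show ?thesis using that by (simp add: abs_divide pos_divide_le_eq mult_ac)
    qed
    ultimately obtain l where "((\<lambda>\<gamma>. P \<gamma> $ i $ j / \<gamma>) \<longlongrightarrow> l) (at_right 0)"
      using rational_pos_bounded_limit_at_right[of "\<lambda>\<gamma>. P \<gamma> $ i $ j / \<gamma>" 1 "\<bar>C\<bar> * 2^(2 * \<mu> - 2)"]
        zero_less_one by blast
    then show "\<exists>l. ((\<lambda>\<gamma>. P \<gamma> $ i $ j / \<gamma>) \<longlongrightarrow> l) (at_right 0)" by blast
  next
    show "eventually (\<lambda>\<gamma>. 2 * n / b \<le> lambda_max (P \<gamma>) / \<gamma>) (at_right 0)"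
      using pos
    proof eventually_elim
      case (elim \<gamma>)
      then show ?case using ge[OF elim] b by (simp add: divide_simps mult.commute)
    qed
    show "eventually (\<lambda>\<gamma>::real. \<gamma> > 0 \<and> \<gamma> > 0) (at_right 0)" using pos by simp
    show "at_right 0 \<noteq> (bot :: real filter)" by simp
    show "2 * n / b > 0" using n b by simp
  qed
qed

text \<open>In \<gamma> W = B B^T + (A W + W A^T) the bracket has norm at most k times that of W;
  for \<gamma> \<ge> 2 k it is absorbed into half of the left-hand side.\<close>

lemma W_decay:
  obtains K \<gamma>0 where "K \<ge> 0" "\<gamma>0 > 0" "\<And>\<gamma>. \<gamma> \<ge> \<gamma>0 \<Longrightarrow> \<gamma> * norm (W \<gamma>) \<le> K"
proof -
  have lin: "linear (\<lambda>M. A ** M + M ** transpose A)"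
    by (intro linearI) (simp_all add: matrix_ring_simps scaleR_add_right)
  obtain k where k: "k > 0" "\<And>M. norm (A ** M + M ** transpose A) \<le> k * norm M"
    using linear_bounded_pos[OF lin] by blast
  have "\<gamma> * norm (W \<gamma>) \<le> 2 * norm (B ** transpose B)" if "\<gamma> \<ge> 2 * k" for \<gamma>
  proof -
    have \<gamma>: "\<gamma> > 0" using that k by linarith
    have "\<gamma> *\<^sub>R W \<gamma> = B ** transpose B + (A ** W \<gamma> + W \<gamma> ** transpose A)"
      using lyap_W[OF \<gamma>] unfolding lyap_op_def by (simp add: algebra_simps)
    then have "\<gamma> * norm (W \<gamma>) = norm (B ** transpose B + (A ** W \<gamma> + W \<gamma> ** transpose A))"
      using \<gamma> by (metis abs_of_pos norm_scaleR)
    also have "\<dots> \<le> norm (B ** transpose B) + k * norm (W \<gamma>)"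
      using norm_triangle_ineq k(2) by (meson add_left_mono order_trans)
    also have "k * norm (W \<gamma>) \<le> \<gamma> / 2 * norm (W \<gamma>)" using that by (intro mult_right_mono) auto
    finally show ?thesis by simp
  qed
  moreover have "2 * k > 0" "2 * norm (B ** transpose B) \<ge> 0" using k by auto
  ultimately show thesis using that by blast
qed

text \<open>For \<open>v\<close> orthogonal to the columns of \<open>A\<^sup>j B\<close>, \<open>j < \<mu> - 1\<close>, the numbers
  \<open>a j k = ((A\<^sup>T)\<^sup>j v) \<bullet> W ((A\<^sup>T)\<^sup>k v)\<close> satisfy \<open>\<gamma> a j k = a (j+1) k + a j (k+1)\<close> as long as
  \<open>j + k < 2 (\<mu> - 1)\<close>, which gains one power of \<open>1 / \<gamma>\<close> at each step.\<close>
lemma W_small_direction: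
  obtains v C \<gamma>0 where "v \<noteq> 0" "\<gamma>0 > 0"
    "\<And>\<gamma>. \<gamma> \<ge> \<gamma>0 \<Longrightarrow> (v \<bullet> (W \<gamma> *v v)) * \<gamma>^(2 * \<mu> - 1) \<le> C"
proof -
  obtain v where v: "v \<noteq> 0" "\<And>i. i < \<mu> - 1 \<Longrightarrow> transpose B *v (((*v) (transpose A) ^^ i) v) = 0"
    using ctrb_rank_deficient_obtain[OF mu_props(3)] by blast
  obtain K \<gamma>0 where K: "K \<ge> 0" "\<gamma>0 > 0" "\<And>\<gamma>. \<gamma> \<ge> \<gamma>0 \<Longrightarrow> \<gamma> * norm (W \<gamma>) \<le> K" using W_decay by blast
  define u where "u j = ((*v) (transpose A) ^^ j) v" for j
  have u_Suc: "transpose A *v u j = u (Suc j)" for j by (simp add: u_def)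
  define a where "a \<gamma> j k = u j \<bullet> (W \<gamma> *v u k)" for \<gamma> j k
  have rec: "\<gamma> * a \<gamma> j k = (transpose B *v u j) \<bullet> (transpose B *v u k) + a \<gamma> (Suc j) k + a \<gamma> j (Suc k)"
    if \<gamma>: "\<gamma> > 0" for \<gamma> j k
  proof -
    have "\<gamma> *\<^sub>R W \<gamma> = B ** transpose B + A ** W \<gamma> + W \<gamma> ** transpose A"
      using lyap_W[OF \<gamma>] unfolding lyap_op_def by (simp add: algebra_simps)
    then have "u j \<bullet> ((\<gamma> *\<^sub>R W \<gamma>) *v u k) = u j \<bullet> ((B ** transpose B + A ** W \<gamma> + W \<gamma> ** transpose A) *v u k)"
      by simp
    then show ?thesis
      by (simp add: a_def quadratic_form_simps
          matrix_vector_mul_assoc[symmetric] dot_transpose[of "u j" A] dot_transpose[of "u j" B] u_Suc)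
  qed
  \<comment> \<open>The exponent m + 1 counts m uses of the recursion plus the one power supplied by
    \<open>W_decay\<close>, which is all there is when j + k = 2 (\<mu> - 1).\<close>
  have bound: "\<exists>C. \<forall>\<gamma>\<ge>\<gamma>0. \<bar>a \<gamma> j k\<bar> * \<gamma>^(m + 1) \<le> C" if "j + k + m = 2 * (\<mu> - 1)" for j k m
    using that
  proof (induction m arbitrary: j k)
    case 0
    have "\<bar>a \<gamma> j k\<bar> * \<gamma> \<le> norm (u j) * norm (u k) * K" if "\<gamma> \<ge> \<gamma>0" for \<gamma>
    proof -
      have "\<bar>a \<gamma> j k\<bar> \<le> norm (u j) * norm (W \<gamma> *v u k)" unfolding a_def by (rule Cauchy_Schwarz_ineq2)
      also have "\<dots> \<le> norm (u j) * (norm (W \<gamma>) * norm (u k))"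
        by (intro mult_left_mono norm_matrix_vector_le) simp
      finally have "\<bar>a \<gamma> j k\<bar> * \<gamma> \<le> norm (u j) * (norm (W \<gamma>) * norm (u k)) * \<gamma>"
        using that K(2) by (intro mult_right_mono) auto
      also have "\<dots> = norm (u j) * norm (u k) * (\<gamma> * norm (W \<gamma>))" by (simp add: mult_ac)
      also have "\<dots> \<le> norm (u j) * norm (u k) * K" using K(3)[OF that] by (intro mult_left_mono) auto
      finally show ?thesis .
    qed
    then show ?case by (intro exI[of _ "norm (u j) * norm (u k) * K"]) simp
  next
    case (Suc m)
    obtain C D where C: "\<forall>\<gamma>\<ge>\<gamma>0. \<bar>a \<gamma> (Suc j) k\<bar> * \<gamma>^(m + 1) \<le> C"
      and D: "\<forall>\<gamma>\<ge>\<gamma>0. \<bar>a \<gamma> j (Suc k)\<bar> * \<gamma>^(m + 1) \<le> D"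
      using Suc.IH[of "Suc j" k] Suc.IH[of j "Suc k"] Suc.prems by auto
    \<comment> \<open>As j + k < 2 (\<mu> - 1), one index is below \<mu> - 1, and its factor under
      B^T vanishes by the choice of v.\<close>
    have "j < \<mu> - 1 \<or> k < \<mu> - 1" using Suc.prems by linarith
    then have z: "(transpose B *v u j) \<bullet> (transpose B *v u k) = 0" using v(2) by (auto simp: u_def)
    have "\<bar>a \<gamma> j k\<bar> * \<gamma>^(Suc m + 1) \<le> C + D" if g: "\<gamma> \<ge> \<gamma>0" for \<gamma>
    proof -
      have \<gamma>: "\<gamma> > 0" using g K(2) by linarith
      have "\<bar>a \<gamma> j k\<bar> * \<gamma>^(Suc m + 1) = \<bar>\<gamma> * a \<gamma> j k\<bar> * \<gamma>^(m + 1)" using \<gamma> by (simp add: abs_mult)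
      also have "\<dots> \<le> (\<bar>a \<gamma> (Suc j) k\<bar> + \<bar>a \<gamma> j (Suc k)\<bar>) * \<gamma>^(m + 1)"
        unfolding rec[OF \<gamma>] z using \<gamma> by (intro mult_right_mono) auto
      also have "\<dots> \<le> C + D" using C D g by (simp add: distrib_right add_mono)
      finally show ?thesis .
    qed
    then show ?case by blast
  qed
  obtain C where C: "\<forall>\<gamma>\<ge>\<gamma>0. \<bar>a \<gamma> 0 0\<bar> * \<gamma>^(2 * (\<mu> - 1) + 1) \<le> C" using bound[of 0 0 "2 * (\<mu> - 1)"] by auto
  have e: "2 * (\<mu> - 1) + 1 = 2 * \<mu> - 1" using mu_props(1) by linarith
  have main: "(v \<bullet> (W \<gamma> *v v)) * \<gamma>^(2 * \<mu> - 1) \<le> C" if "\<gamma> \<ge> \<gamma>0" for \<gamma>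
  proof -
    have "(v \<bullet> (W \<gamma> *v v)) * \<gamma>^(2 * \<mu> - 1) \<le> \<bar>a \<gamma> 0 0\<bar> * \<gamma>^(2 * \<mu> - 1)"
      using that K(2) by (intro mult_right_mono) (auto simp: a_def u_def)
    then show ?thesis using C that unfolding e by force
  qed
  show thesis by (rule that[OF v(1) K(2) main])
qed

lemma limit_at_infinity: "\<exists>c1>0. ((\<lambda>\<gamma>. lambda_max (P \<gamma>) / \<gamma>^(2 * \<mu> - 1)) \<longlongrightarrow> c1) at_top"
proof -
  define n where "n = real CARD('n)"
  have n: "n > 0" by (simp add: n_def)
  have phi0: "phi A \<le> 0" by (rule phi_nonpos[OF stab])
  obtain v C \<gamma>0 where v: "v \<noteq> 0" "\<gamma>0 > 0"
    "\<And>\<gamma>. \<gamma> \<ge> \<gamma>0 \<Longrightarrow> (v \<bullet> (W \<gamma> *v v)) * \<gamma>^(2 * \<mu> - 1) \<le> C"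
    by (rule W_small_direction) (rule that)
  define N where "N = v \<bullet> v"
  have N: "N > 0" using v(1) by (simp add: N_def)
  \<comment> \<open>For \<gamma> \<ge> 1 one has n (\<gamma> - phi(A)) \<le> k \<gamma>, so
    \<open>X_le_P\<close> becomes X \<le> k P with a constant k.\<close>
  define k where "k = n * (1 - phi A)"
  have k: "k > 0" using n phi0 by (simp add: k_def)
  have wpos: "v \<bullet> (W \<gamma> *v v) > 0" if "\<gamma> > 0" for \<gamma> using pos_def_gt0[OF W_pos[OF that] v(1)] .
  have "0 < (v \<bullet> (W \<gamma>0 *v v)) * \<gamma>0^(2 * \<mu> - 1)" using wpos[OF v(2)] v(2) by simp
  then have C: "C > 0" using v(3)[of \<gamma>0] by simp
  have low: "N / (C * k) \<le> lambda_max (P \<gamma>) / \<gamma>^(2 * \<mu> - 1)" if g: "\<gamma> \<ge> max 1 \<gamma>0" for \<gamma>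
  proof -
    have \<gamma>: "\<gamma> > 0" "\<gamma> \<ge> 1" "\<gamma> \<ge> \<gamma>0" using g by auto
    let ?w = "v \<bullet> (W \<gamma> *v v)"
    let ?g = "\<gamma>^(2 * \<mu> - 1)"
    have w: "?w > 0" by (rule wpos[OF \<gamma>(1)])
    text \<open>Cauchy--Schwarz: \<open>(v \<bullet> v)\<^sup>2 \<le> (v \<bullet> W v) (v \<bullet> X v)\<close>.\<close>
    have "N^2 / ?w \<le> v \<bullet> (X \<gamma> *v v)"
    proof -
      define t where "t = N / ?w"
      define z where "z = X \<gamma> *v v - t *\<^sub>R v"
      have Wz: "W \<gamma> *v z = v - t *\<^sub>R (W \<gamma> *v v)"
        by (simp add: z_def matrix_vector_mult_diff_distrib matrix_vector_mult_scaleR matrix_vector_mul_assoc WX[OF \<gamma>(1)])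
      have XWv: "(X \<gamma> *v v) \<bullet> (W \<gamma> *v v) = N"
        using dot_transpose[of "X \<gamma> *v v" "W \<gamma>" v] by (simp add: WT[OF \<gamma>(1)] matrix_vector_mul_assoc WX[OF \<gamma>(1)] N_def)
      have "0 \<le> z \<bullet> (W \<gamma> *v z)" by (rule pos_def_ge0[OF W_pos[OF \<gamma>(1)]])
      also have "\<dots> = v \<bullet> (X \<gamma> *v v) - 2 * t * N + t^2 * ?w"
        unfolding Wz by (simp add: z_def inner_diff_left inner_diff_right XWv N_def[symmetric] power2_eq_square
          inner_commute[of "X \<gamma> *v v" v] algebra_simps)
      also have "t^2 * ?w = t * N" using w by (simp add: t_def power2_eq_square)
      finally show ?thesis by (simp add: t_def power2_eq_square)
    qed
    moreover have "N^2 * ?g / C \<le> N^2 / ?w"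
    proof -
      have "?g / C \<le> 1 / ?w" using v(3)[OF \<gamma>(3)] C w by (simp add: divide_simps mult.commute)
      then have "N^2 * (?g / C) \<le> N^2 * (1 / ?w)" by (intro mult_left_mono) auto
      then show ?thesis by simp
    qed
    ultimately have X: "N^2 * ?g / C \<le> v \<bullet> (X \<gamma> *v v)" by linarith
    have Pv: "0 \<le> v \<bullet> (P \<gamma> *v v)" by (rule P_psd[OF \<gamma>(1)])
    have "\<gamma> * (v \<bullet> (X \<gamma> *v v)) \<le> n * (\<gamma> - phi A) * (v \<bullet> (P \<gamma> *v v))"
      unfolding n_def by (rule X_le_P[OF \<gamma>(1)])
    also have "\<dots> \<le> (\<gamma> * k) * (v \<bullet> (P \<gamma> *v v))"
    proof (rule mult_right_mono[OF _ Pv])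
      have "- phi A \<le> \<gamma> * (- phi A)" using mult_right_mono[OF \<gamma>(2), of "- phi A"] phi0 by simp
      then have "n * (\<gamma> - phi A) \<le> n * (\<gamma> * (1 - phi A))"
        using n by (intro mult_left_mono) (auto simp: algebra_simps)
      then show "n * (\<gamma> - phi A) \<le> \<gamma> * k" by (simp add: k_def mult_ac)
    qed
    finally have "\<gamma> * (v \<bullet> (X \<gamma> *v v)) \<le> \<gamma> * (k * (v \<bullet> (P \<gamma> *v v)))" by (simp add: mult.assoc)
    then have "v \<bullet> (X \<gamma> *v v) \<le> k * (v \<bullet> (P \<gamma> *v v))" using \<gamma>(1) by simp
    also have "\<dots> \<le> k * (lambda_max (P \<gamma>) * N)"
      using le_lambda_max_P[OF \<gamma>(1), of v] k by (intro mult_left_mono) (auto simp: N_def)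
    finally have "N * (N * ?g / C) \<le> N * (k * lambda_max (P \<gamma>))"
      using X by (simp add: power2_eq_square mult_ac)
    then have "N * ?g / C \<le> k * lambda_max (P \<gamma>)" using N by (rule mult_left_le_imp_le)
    then have "N * ?g \<le> lambda_max (P \<gamma>) * (C * k)" using C by (simp add: pos_divide_le_eq mult_ac)
    then show ?thesis using C k \<gamma>(1)
      by (simp add: pos_divide_le_eq pos_le_divide_eq mult_ac)
  qed
  show ?thesis
  proof (rule lambda_max_limit[where c = "N / (C * k)" and d = "\<lambda>\<gamma>. \<gamma>^(2 * \<mu> - 1)" and net = at_top])
    fix i j
    obtain D where D: "\<And>\<gamma>. \<gamma> > 0 \<Longrightarrow> \<bar>P \<gamma> $ i $ j\<bar> \<le> D * (\<gamma> * (1 + \<gamma>)^(2 * \<mu> - 2))"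
      using entry_growth by blast
    have "rational_pos (\<lambda>\<gamma>. P \<gamma> $ i $ j / \<gamma>^(2 * \<mu> - 1))"
      by (intro rational_pos_divide rational_P_entry rational_pos_power) simp_all
    moreover have "\<bar>P \<gamma> $ i $ j / \<gamma>^(2 * \<mu> - 1)\<bar> \<le> \<bar>D\<bar> * 2^(2 * \<mu> - 2)" if "\<gamma> > 1" for \<gamma>
    proof -
      have \<gamma>: "\<gamma> > 0" using that by simp
      \<comment> \<open>The linear factor \<gamma> of the growth bound supplies the odd power; \<mu>
        > 0 makes the truncated subtractions exact.\<close>
      have e: "2 * \<mu> - 1 = Suc (2 * \<mu> - 2)" using mu_props(1) by linarith
      have "\<bar>P \<gamma> $ i $ j\<bar> \<le> \<bar>D\<bar> * (\<gamma> * (1 + \<gamma>)^(2 * \<mu> - 2))"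
        using D[OF \<gamma>] by (rule order_trans) (intro mult_right_mono, use \<gamma> in auto)
      also have "\<dots> \<le> \<bar>D\<bar> * (\<gamma> * (2 * \<gamma>)^(2 * \<mu> - 2))"
        using that by (intro mult_left_mono power_mono) auto
      also have "\<dots> = \<bar>D\<bar> * 2^(2 * \<mu> - 2) * \<gamma>^(2 * \<mu> - 1)"
        unfolding e by (simp add: power_mult_distrib mult_ac)
      finally show ?thesis using \<gamma> by (simp add: abs_divide pos_divide_le_eq)
    qed
    ultimately obtain l where "((\<lambda>\<gamma>. P \<gamma> $ i $ j / \<gamma>^(2 * \<mu> - 1)) \<longlongrightarrow> l) at_top"
      using rational_pos_bounded_limit_at_top[of "\<lambda>\<gamma>. P \<gamma> $ i $ j / \<gamma>^(2 * \<mu> - 1)"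
        "\<bar>D\<bar> * 2^(2 * \<mu> - 2)"] by blast
    then show "\<exists>l. ((\<lambda>\<gamma>. P \<gamma> $ i $ j / \<gamma>^(2 * \<mu> - 1)) \<longlongrightarrow> l) at_top" by blast
  next
    show "eventually (\<lambda>\<gamma>. N / (C * k) \<le> lambda_max (P \<gamma>) / \<gamma>^(2 * \<mu> - 1)) at_top"
      using eventually_ge_at_top[of "max 1 \<gamma>0"] by eventually_elim (rule low)
    show "eventually (\<lambda>\<gamma>::real. \<gamma> > 0 \<and> \<gamma>^(2 * \<mu> - 1) > 0) at_top"
      using eventually_gt_at_top[of 0] by eventually_elim simp
    show "at_top \<noteq> (bot :: real filter)" by simp
    show "N / (C * k) > 0" using N C k by simp
  qed
qed

end

section \<open>Transfer of the six assertions to the solutions singled out by uniqueness\<close>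

theorem theorem1:
  fixes A :: "real^'n^'n" and B :: "real^'m^'n"
  assumes "controllable A B"
    and "\<forall>z \<in># eigvals A. Re z \<le> 0"
  shows
    "let n = real CARD('n); X = X_sol A B; P = P_sol A B in
     ((\<forall>\<gamma>>0. (\<exists>!X'. pos_def X' \<and> eq_X A B \<gamma> X') \<and>
              (\<exists>!Y'. pos_def Y' \<and> eq_Y A B \<gamma> (X \<gamma>) Y') \<and>
              eigvals (A - B ** transpose B ** P \<gamma>)
                = image_mset (\<lambda>z. z - of_real (2 * \<gamma>)) (eigvals A)) \<and>
      rational_matrix_on {0<..} P) \<and>
     (\<forall>\<gamma>>0. pos_def (P \<gamma>)) \<and>
     (\<forall>\<gamma>>0. trace (transpose B ** P \<gamma> ** B) = 2 * n * \<gamma>) \<and>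
     (\<exists>k>0. \<forall>\<gamma>>0.
        (- k * (\<gamma> - phi A)) *\<^sub>R P \<gamma>
          \<preceq> transpose A ** P \<gamma> + P \<gamma> ** A - P \<gamma> ** B ** transpose B ** P \<gamma> \<and>
        transpose A ** P \<gamma> + P \<gamma> ** A - P \<gamma> ** B ** transpose B ** P \<gamma> \<preceq> - (\<gamma> *\<^sub>R P \<gamma>)) \<and>
     (\<exists>c1>0. \<exists>c2>0.
        ((\<lambda>\<gamma>. lambda_max (P \<gamma>) / \<gamma> ^ (2 * ctrb_index A B - 1)) \<longlongrightarrow> c1) at_top \<and>
        ((\<lambda>\<gamma>. lambda_max (P \<gamma>) / \<gamma>) \<longlongrightarrow> c2) (at_right 0)) \<and>
     (\<exists>\<delta>>0. \<exists>f :: real \<Rightarrow> real. \<forall>\<gamma>>0.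
        0 < f \<gamma> \<and> f \<gamma> = min \<delta> (delta_bar A B \<gamma>) \<and>
        P differentiable (at \<gamma>) \<and>
        (1 / (2 * n * \<gamma>)) *\<^sub>R P \<gamma> \<prec> dP A B \<gamma> \<and>
        dP A B \<gamma> \<preceq> (f \<gamma> / (2 * n * \<gamma>)) *\<^sub>R P \<gamma> \<and>
        (f \<gamma> / (2 * n * \<gamma>)) *\<^sub>R P \<gamma> \<preceq> (\<delta> / (2 * n * \<gamma>)) *\<^sub>R P \<gamma>)"
proof -
  interpret nested_riccati A B
    using assms by unfold_locales (simp_all add: weakly_stable_def)
  define n where "n = real CARD('n)"
  have n: "n > 0" by (simp add: n_def)
  have P_eq': "P_sol A B \<gamma> = P \<gamma>" if "\<gamma> > 0" for \<gamma> using that by (rule P_sol_eq)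
  have item1: "(\<forall>\<gamma>>0. (\<exists>!R. pos_def R \<and> eq_X A B \<gamma> R) \<and>
              (\<exists>!R. pos_def R \<and> eq_Y A B \<gamma> (X_sol A B \<gamma>) R) \<and>
              eigvals (A - B ** transpose B ** P_sol A B \<gamma>)
                = image_mset (\<lambda>z. z - of_real (2 * \<gamma>)) (eigvals A))"
  proof (intro allI impI conjI)
    fix \<gamma> :: real assume \<gamma>: "\<gamma> > 0"
    show "\<exists>!R. pos_def R \<and> eq_X A B \<gamma> R"
      using X_pos[OF \<gamma>] eq_X_X[OF \<gamma>] eq_X_unique[OF \<gamma>] by blast
    show "\<exists>!R. pos_def R \<and> eq_Y A B \<gamma> (X_sol A B \<gamma>) R"
      unfolding X_sol_eq[OF \<gamma>] using Y_pos[OF \<gamma>] eq_Y_Y[OF \<gamma>] eq_Y_unique[OF \<gamma>] by blast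
    show "eigvals (A - B ** transpose B ** P_sol A B \<gamma>)
      = image_mset (\<lambda>z. z - of_real (2 * \<gamma>)) (eigvals A)"
      unfolding P_eq'[OF \<gamma>] by (rule eigvals_closed_loop[OF \<gamma>])
  qed
  have rat: "rational_matrix_on {0<..} (P_sol A B)"
    using rational_P P_eq' by (simp add: rational_matrix_on_def)
  have item2: "\<forall>\<gamma>>0. pos_def (P_sol A B \<gamma>)" using P_pos P_eq' by simp
  have item3: "\<forall>\<gamma>>0. trace (transpose B ** P_sol A B \<gamma> ** B) = 2 * n * \<gamma>"
    using trace_BPB P_eq' by (simp add: n_def)
  have item4: "\<exists>k>0. \<forall>\<gamma>>0.
        (- k * (\<gamma> - phi A)) *\<^sub>R P_sol A B \<gamma>
          \<preceq> transpose A ** P_sol A B \<gamma> + P_sol A B \<gamma> ** A - P_sol A B \<gamma> ** B ** transpose B ** P_sol A B \<gamma> \<and>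
        transpose A ** P_sol A B \<gamma> + P_sol A B \<gamma> ** A - P_sol A B \<gamma> ** B ** transpose B ** P_sol A B \<gamma>
          \<preceq> - (\<gamma> *\<^sub>R P_sol A B \<gamma>)"
  \<comment> \<open>The negated middle term is \<gamma> P + 2 \<gamma> X, where \<gamma> P \<le>
    (\<gamma> - phi(A)) P and \<gamma> X \<le> n (\<gamma> - phi(A)) P.\<close>
  proof (intro exI[of _ "1 + 2 * n"] conjI allI impI)
    fix \<gamma> :: real assume \<gamma>: "\<gamma> > 0"
    have T: "transpose (P \<gamma>) = P \<gamma>" "transpose (X \<gamma>) = X \<gamma>" using PT[OF \<gamma>] XT[OF \<gamma>] .
    have "0 \<le> x \<bullet> ((- (\<gamma> *\<^sub>R (P \<gamma> + 2 *\<^sub>R X \<gamma>)) - (- (1 + 2 * n) * (\<gamma> - phi A)) *\<^sub>R P \<gamma>) *v x)" for x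
    proof -
      have "\<gamma> * (x \<bullet> (P \<gamma> *v x)) \<le> (\<gamma> - phi A) * (x \<bullet> (P \<gamma> *v x))"
        using gamma_minus_phi(1)[OF \<gamma>] P_psd[OF \<gamma>] by (intro mult_right_mono)
      moreover have "\<gamma> * (x \<bullet> (X \<gamma> *v x)) \<le> n * (\<gamma> - phi A) * (x \<bullet> (P \<gamma> *v x))"
        unfolding n_def by (rule X_le_P[OF \<gamma>])
      ultimately show ?thesis
        by (simp add: quadratic_form_simps algebra_simps)
    qed
    then show "(- (1 + 2 * n) * (\<gamma> - phi A)) *\<^sub>R P_sol A B \<gamma>
          \<preceq> transpose A ** P_sol A B \<gamma> + P_sol A B \<gamma> ** A - P_sol A B \<gamma> ** B ** transpose B ** P_sol A B \<gamma>"
      unfolding P_eq'[OF \<gamma>] P_eq[OF \<gamma>] loewner_le_def pos_semidef_def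
      by (simp add: transpose_distribs T del: scaleR_add_right)
    have "0 \<le> x \<bullet> ((- (\<gamma> *\<^sub>R P \<gamma>) - - (\<gamma> *\<^sub>R (P \<gamma> + 2 *\<^sub>R X \<gamma>))) *v x)" for x
      using \<gamma> pos_semidef_ge0[OF pos_def_imp_semidef[OF X_pos[OF \<gamma>]], of x]
      by (simp add: scaleR_add_right matrix_vector_scaleR_left)
    then show "transpose A ** P_sol A B \<gamma> + P_sol A B \<gamma> ** A - P_sol A B \<gamma> ** B ** transpose B ** P_sol A B \<gamma>
          \<preceq> - (\<gamma> *\<^sub>R P_sol A B \<gamma>)"
      unfolding P_eq'[OF \<gamma>] P_eq[OF \<gamma>] loewner_le_def pos_semidef_def
      by (simp add: transpose_distribs T del: scaleR_add_right)
  qed (use n in simp)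
  have item5: "\<exists>c1>0. \<exists>c2>0.
        ((\<lambda>\<gamma>. lambda_max (P_sol A B \<gamma>) / \<gamma> ^ (2 * ctrb_index A B - 1)) \<longlongrightarrow> c1) at_top \<and>
        ((\<lambda>\<gamma>. lambda_max (P_sol A B \<gamma>) / \<gamma>) \<longlongrightarrow> c2) (at_right 0)"
  proof -
    obtain c1 where c1: "c1 > 0" "((\<lambda>\<gamma>. lambda_max (P \<gamma>) / \<gamma> ^ (2 * ctrb_index A B - 1)) \<longlongrightarrow> c1) at_top"
      using limit_at_infinity unfolding \<mu>_def by blast
    obtain c2 where c2: "c2 > 0" "((\<lambda>\<gamma>. lambda_max (P \<gamma>) / \<gamma>) \<longlongrightarrow> c2) (at_right 0)"
      using limit_at_0 by blast
    \<comment> \<open>\<open>P\<close> and \<open>P_sol A B\<close> are known to agree for positive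
      arguments, which is eventually the case along both filters.\<close>
    have "eventually (\<lambda>\<gamma>. lambda_max (P \<gamma>) / \<gamma> ^ (2 * ctrb_index A B - 1)
        = lambda_max (P_sol A B \<gamma>) / \<gamma> ^ (2 * ctrb_index A B - 1)) at_top"
      using eventually_gt_at_top[of 0] by eventually_elim (simp add: P_eq')
    from Lim_transform_eventually[OF c1(2) this]
    have 1: "((\<lambda>\<gamma>. lambda_max (P_sol A B \<gamma>) / \<gamma> ^ (2 * ctrb_index A B - 1)) \<longlongrightarrow> c1) at_top" .
    have "eventually (\<lambda>\<gamma>. lambda_max (P \<gamma>) / \<gamma> = lambda_max (P_sol A B \<gamma>) / \<gamma>) (at_right 0)"
      using eventually_at_right_less[of 0] by eventually_elim (simp add: P_eq')
    from Lim_transform_eventually[OF c2(2) this]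
    have 2: "((\<lambda>\<gamma>. lambda_max (P_sol A B \<gamma>) / \<gamma>) \<longlongrightarrow> c2) (at_right 0)" .
    show ?thesis by (intro exI[of _ c1] exI[of _ c2] conjI c1(1) c2(1) 1 2)
  qed
  have item6: "\<exists>\<delta>>0. \<exists>f :: real \<Rightarrow> real. \<forall>\<gamma>>0.
        0 < f \<gamma> \<and> f \<gamma> = min \<delta> (delta_bar A B \<gamma>) \<and>
        P_sol A B differentiable (at \<gamma>) \<and>
        (1 / (2 * n * \<gamma>)) *\<^sub>R P_sol A B \<gamma> \<prec> dP A B \<gamma> \<and>
        dP A B \<gamma> \<preceq> (f \<gamma> / (2 * n * \<gamma>)) *\<^sub>R P_sol A B \<gamma> \<and>
        (f \<gamma> / (2 * n * \<gamma>)) *\<^sub>R P_sol A B \<gamma> \<preceq> (\<delta> / (2 * n * \<gamma>)) *\<^sub>R P_sol A B \<gamma>"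
  proof -
    obtain C where C: "C > 0" "\<And>\<gamma> x. \<gamma> > 0 \<Longrightarrow> \<gamma> * (x \<bullet> (P' \<gamma> *v x)) \<le> C * (x \<bullet> (P \<gamma> *v x))"
      by (rule P'_upper) (rule that)
    \<comment> \<open>C bounds \<gamma> P' relative to P uniformly in \<gamma>; the factor 2 n
      matches the normalization P / (2 n \<gamma>).\<close>
    define \<delta> where "\<delta> = 2 * n * C"
    have \<delta>: "\<delta> > 0" using n C(1) by (simp add: \<delta>_def)
    define f where "f \<gamma> = min \<delta> (delta_bar A B \<gamma>)" for \<gamma>
    have "0 < f \<gamma> \<and> f \<gamma> = min \<delta> (delta_bar A B \<gamma>) \<and>
        P_sol A B differentiable (at \<gamma>) \<and>
        (1 / (2 * n * \<gamma>)) *\<^sub>R P_sol A B \<gamma> \<prec> dP A B \<gamma> \<and>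
        dP A B \<gamma> \<preceq> (f \<gamma> / (2 * n * \<gamma>)) *\<^sub>R P_sol A B \<gamma> \<and>
        (f \<gamma> / (2 * n * \<gamma>)) *\<^sub>R P_sol A B \<gamma> \<preceq> (\<delta> / (2 * n * \<gamma>)) *\<^sub>R P_sol A B \<gamma>"
      if \<gamma>: "\<gamma> > 0" for \<gamma>
    proof (intro conjI)
      have T: "transpose (P \<gamma>) = P \<gamma>" "transpose (P' \<gamma>) = P' \<gamma>" using PT[OF \<gamma>] P'_T[OF \<gamma>] .
      have g: "2 * n * \<gamma> > 0" using n \<gamma> by simp
      show "0 < f \<gamma>" using \<delta> delta_bar_bounds(1)[OF \<gamma>] by (simp add: f_def)
      show "f \<gamma> = min \<delta> (delta_bar A B \<gamma>)" by (simp add: f_def)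
      show "P_sol A B differentiable (at \<gamma>)"
        by (rule differentiableI_vector[OF has_derivative_P_sol[OF \<gamma>]])
      show "(1 / (2 * n * \<gamma>)) *\<^sub>R P_sol A B \<gamma> \<prec> dP A B \<gamma>"
        using P'_lower[OF \<gamma>] unfolding P_eq'[OF \<gamma>] dP_eq[OF \<gamma>] loewner_less_def n_def
        by (simp add: transpose_scalar T)
      have "2 * n * \<gamma> * (x \<bullet> (P' \<gamma> *v x)) \<le> f \<gamma> * (x \<bullet> (P \<gamma> *v x))" for x
      proof (cases "\<delta> \<le> delta_bar A B \<gamma>")
        case True
        have "2 * n * (\<gamma> * (x \<bullet> (P' \<gamma> *v x))) \<le> 2 * n * (C * (x \<bullet> (P \<gamma> *v x)))"
          using C(2)[OF \<gamma>] n by (intro mult_left_mono) auto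
        then show ?thesis using True by (simp add: f_def \<delta>_def mult.assoc)
      next
        case False
        then show ?thesis using delta_bar_bounds(2)[OF \<gamma>, of x] by (simp add: f_def n_def)
      qed
      then have "x \<bullet> (P' \<gamma> *v x) \<le> f \<gamma> / (2 * n * \<gamma>) * (x \<bullet> (P \<gamma> *v x))" for x
        using g by (simp add: pos_le_divide_eq mult.commute)
      then show "dP A B \<gamma> \<preceq> (f \<gamma> / (2 * n * \<gamma>)) *\<^sub>R P_sol A B \<gamma>"
        unfolding P_eq'[OF \<gamma>] dP_eq[OF \<gamma>] loewner_le_def pos_semidef_def
        by (simp add: transpose_distribs T quadratic_form_simps)
      have "f \<gamma> / (2 * n * \<gamma>) * (x \<bullet> (P \<gamma> *v x)) \<le> \<delta> / (2 * n * \<gamma>) * (x \<bullet> (P \<gamma> *v x))" for x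
        using g P_psd[OF \<gamma>] by (intro mult_right_mono divide_right_mono) (auto simp: f_def)
      then show "(f \<gamma> / (2 * n * \<gamma>)) *\<^sub>R P_sol A B \<gamma> \<preceq> (\<delta> / (2 * n * \<gamma>)) *\<^sub>R P_sol A B \<gamma>"
        unfolding P_eq'[OF \<gamma>] loewner_le_def pos_semidef_def
        by (simp add: transpose_distribs T quadratic_form_simps)
    qed
    then show ?thesis using \<delta> by blast
  qed
  show ?thesis
    unfolding Let_def n_def[symmetric] using item1 rat item2 item3 item4 item5 item6 by blast
qed

end
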